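(* Let $k$ be an algebraically closed field of characteristic $p>0$ and let $f(X)\in k[X]$ be a polynomial of degree $m:=\deg f$ prime to $p$. Let $k(X,W)/k(X)$ be the extension of degree $p$ defined by $W^p-W=f(X)$, and denote by $\infty$ the place of $k(X,W)$ above $X=\infty$. Let $G_{\infty,1}(f)$ be the wild inertia group at $\infty$ in the full automorphism group of $k(X,W)/k$. Let $g(f)=\frac{(m-1)(p-1)}{2}$ be the genus of $k(X,W)/k$ and assume $g(f)>1$. Then: a) $|G_{\infty,1}(f)|\leq p(m-1)^2$. b) If $\gcd(m-1,p)=1$, then $|G_{\infty,1}(f)|=p$. c) If $f(X)=X^m$, then $|G_{\infty,1}(f)|=p$ for $m-1\neq p^s$ (i.e. $m-1$ not a power of $p$), and $|G_{\infty,1}(f)|=p^{2s+1}$ for $m-1=p^s$. d) If $m-1=\ell p^s$ with $s>0$, $\ell>1$, $\gcd(\ell,p)=1$, then $|G_{\infty,1}(f)|\leq p^{s+1}$ for $p>2$ and $|G_{\infty,1}(f)|\leq 2^s$ for $p=2$; moreover these bounds are optimal. e) If $\frac{|G_{\infty,1}(f)|}{g(f)}>\frac{p}{p-1}$, then $f(X)=XR(X)$, where $R(X)$ is an additive polynomial.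
   Context: $\mathrm{Aut}\,k(X,W)$ is the full group of $k$-automorphisms of the field $k(X,W)$. $G_\infty(f)\subset \mathrm{Aut}\,k(X,W)$ is the inertia group at $\infty$ (the automorphisms fixing the place $\infty$), and $G_{\infty,1}(f)\subset G_\infty(f)$ is the wild inertia group at $\infty$ (its unique Sylow $p$-subgroup). A polynomial $R\in k[X]$ is additive if it is of the form $\sum_i a_iX^{p^i}$.
   Formalization: In e), f = XR(X) is proved up to a translation and Artin–Schreier equivalence, f(X+a) = XR(X) + h^p − h, as X^{1+p^s}+cX (c≠0) refutes the literal form; in d), for p>2 the bound is shown attained for each s by some ℓ. *)

theory Defs
  imports
    Complex_Main
    "HOL-Computational_Algebra.Computational_Algebra"
    "HOL-Algebra.Algebraic_Closure_Type"
    "HOL-Algebra.Bij"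
    "HOL-Algebra.Coset"
begin

text \<open>
  The field \<open>k(X,W)\<close> is realised inside a fixed algebraic closure of the rational function field
  \<open>k(X)\<close>, which is the type \<open>'k poly fract\<close>.
\<close>

type_synonym 'k rat_closure = "'k poly fract alg_closure"

definition emb_poly :: "'k::field poly \<Rightarrow> 'k rat_closure" where
  "emb_poly g = to_ac (to_fract g)"

definition emb_const :: "'k::field \<Rightarrow> 'k rat_closure" where
  "emb_const c = emb_poly [:c:]"

definition is_subring :: "'a::field set \<Rightarrow> bool" where
  "is_subring A \<longleftrightarrow> 0 \<in> A \<and> 1 \<in> A \<and>
     (\<forall>x\<in>A. \<forall>y\<in>A. x + y \<in> A \<and> x * y \<in> A) \<and> (\<forall>x\<in>A. - x \<in> A)"

definition is_subfield :: "'a::field set \<Rightarrow> bool" where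
  "is_subfield A \<longleftrightarrow> is_subring A \<and> (\<forall>x\<in>A. inverse x \<in> A)"

text \<open>
  The roots of \<open>W\<^sup>p - W = f(X)\<close> differ by elements of the prime field, so the field generated by
  a root does not depend on the choice made here.
\<close>

definition as_root :: "'k::field poly \<Rightarrow> 'k rat_closure" where
  "as_root f = (SOME w. w ^ CHAR('k) - w = emb_poly f)"

definition function_field :: "'k::field poly \<Rightarrow> 'k rat_closure set" where
  "function_field f =
     \<Inter> {L. is_subfield L \<and> range emb_const \<subseteq> L \<and> emb_poly [:0, 1:] \<in> L \<and> as_root f \<in> L}"

lemma as_root_eq:
  fixes f :: "'k::field poly"
  assumes "CHAR('k) > 0"
  shows "as_root f ^ CHAR('k) - as_root f = emb_poly f"
proof -
  define p where "p = CHAR('k)"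
  have "p > 1"
    using assms prime_CHAR_semidom[where ?'a = 'k] prime_gt_1_nat by (auto simp: p_def)
  define q where "q = monom (1 :: 'k rat_closure) p - [:emb_poly f, 1:]"
  have "degree [:emb_poly f, 1:] < degree (monom (1 :: 'k rat_closure) p)"
    using \<open>p > 1\<close> by (simp add: degree_monom_eq)
  hence "degree q = p"
    unfolding q_def diff_conv_add_uminus by (subst degree_add_eq_left) (auto simp: degree_monom_eq)
  then obtain w where "poly q w = 0"
    using alg_closed_imp_poly_has_root[of q] \<open>p > 1\<close> by auto
  hence "w ^ p - w = emb_poly f"
    by (simp add: q_def poly_monom algebra_simps)
  thus ?thesis
    unfolding as_root_def p_def by (rule someI)
qed


text \<open>The \<open>k\<close>-automorphisms of \<open>k(X,W)\<close>; composition comes from \<^const>\<open>BijGroup\<close>.\<close>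

definition aut_group :: "'k::field poly \<Rightarrow> ('k rat_closure \<Rightarrow> 'k rat_closure) monoid" where
  "aut_group f = (BijGroup (function_field f))
     \<lparr>carrier := {\<sigma> \<in> Bij (function_field f).
        (\<forall>x\<in>function_field f. \<forall>y\<in>function_field f.
           \<sigma> (x + y) = \<sigma> x + \<sigma> y \<and> \<sigma> (x * y) = \<sigma> x * \<sigma> y) \<and>
        (\<forall>c. \<sigma> (emb_const c) = emb_const c)}\<rparr>"

text \<open>
  Places of a function field \<open>L\<close> over \<open>k\<close>: the maximal ideals (sets of non-units) of the valuation
  rings \<open>k \<subset> A \<subset> L\<close>, both inclusions being proper.
\<close>

definition is_valuation_ring :: "'k::field rat_closure set \<Rightarrow> 'k rat_closure set \<Rightarrow> bool" where
  "is_valuation_ring L A \<longleftrightarrow>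
     is_subring A \<and> range emb_const \<subset> A \<and> A \<subset> L \<and> (\<forall>z\<in>L. z \<in> A \<or> inverse z \<in> A)"

definition is_place :: "'k::field rat_closure set \<Rightarrow> 'k rat_closure set \<Rightarrow> bool" where
  "is_place L P \<longleftrightarrow> (\<exists>A. is_valuation_ring L A \<and> P = {z\<in>A. z = 0 \<or> inverse z \<notin> A})"

text \<open>The place \<open>X = \<infinity>\<close> of \<open>k(X)\<close>.\<close>

definition rational_infinity :: "'k::field rat_closure set" where
  "rational_infinity = {emb_poly g / emb_poly h | g h. h \<noteq> 0 \<and> (g = 0 \<or> degree g < degree h)}"

text \<open>A place \<open>P\<close> lies above a place \<open>Q\<close> of a subfield iff \<open>Q \<subseteq> P\<close>.\<close>

definition place_infinity :: "'k::field poly \<Rightarrow> 'k rat_closure set" where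
  "place_infinity f = (THE P. is_place (function_field f) P \<and> rational_infinity \<subseteq> P)"

definition inertia_group :: "'k::field poly \<Rightarrow> ('k rat_closure \<Rightarrow> 'k rat_closure) monoid" where
  "inertia_group f = (aut_group f)
     \<lparr>carrier := {\<sigma> \<in> carrier (aut_group f). \<sigma> ` place_infinity f = place_infinity f}\<rparr>"

definition is_sylow_subgroup :: "nat \<Rightarrow> 'a set \<Rightarrow> ('a, 'b) monoid_scheme \<Rightarrow> bool" where
  "is_sylow_subgroup p P G \<longleftrightarrow>
     finite (carrier G) \<and> subgroup P G \<and> card P = p ^ multiplicity p (Coset.order G)"

definition wild_inertia_group :: "'k::field poly \<Rightarrow> ('k rat_closure \<Rightarrow> 'k rat_closure) set" where
  "wild_inertia_group f = (THE P. is_sylow_subgroup CHAR('k) P (inertia_group f))"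

text \<open>The genus of \<open>k(X,W)\<close>, for \<open>deg f\<close> prime to the characteristic.\<close>

definition as_genus :: "'k::field poly \<Rightarrow> real" where
  "as_genus f = (real (degree f) - 1) * (real CHAR('k) - 1) / 2"

definition additive_poly :: "'k::field poly \<Rightarrow> bool" where
  "additive_poly R \<longleftrightarrow> (\<exists>(a :: nat \<Rightarrow> 'k) n. R = (\<Sum>i\<le>n. monom (a i) (CHAR('k) ^ i)))"

text \<open>
  In the statement the normal form \<open>f = X R(X)\<close> is taken up to a change of coordinates
  \<open>X \<mapsto> X + a\<close>, \<open>W \<mapsto> W + h(X)\<close>, which alters neither the isomorphism class of
  \<open>k(X,W)\<close> nor the place at infinity. Without this it fails: for \<open>q > 1\<close> a power of \<open>p\<close> and
  \<open>c \<noteq> 0\<close>, the polynomials \<open>X\<^bsup>1+q\<^esup> + X\<^sup>p - X\<close> and \<open>X\<^bsup>1+q\<^esup> + c X\<close> give fields isomorphic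
  to that of \<open>X\<^bsup>1+q\<^esup>\<close> but are not of the form \<open>X R(X)\<close>.
\<close>

end

theory Submission
  imports Defs "HOL-Algebra.Sylow"
begin

text \<open>
  Every automorphism fixing the place at infinity permutes the places of the affine curve, hence
  preserves the ring \<open>k[X,W]\<close> and the pole order at infinity. Since \<open>X\<close> and \<open>W\<close> have the coprime pole
  orders \<open>p\<close> and \<open>m\<close>, it has the form \<open>X \<mapsto> c X + d\<close>, \<open>W \<mapsto> a W + h(X)\<close> with
  \<open>f(c X + d) = a f(X) + h\<^sup>p - h\<close>. As \<open>k\<close> has no nontrivial \<open>p\<close>-th roots of unity, the wild part is
  given by \<open>c = 1\<close>, so its order is \<open>p\<close> times the number of \<open>d\<close> for which
  \<open>f(X + d) - f(X)\<close> is of the form \<open>h\<^sup>p - h\<close>.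

  A polynomial \<open>g\<close> of this form satisfies \<open>g\<^sub>t + g\<^sub>t\<^sub>p\<^bsup>1/p\<^esup> + \<dots> = 0\<close> for every \<open>t\<close> prime to \<open>p\<close>.
  Write \<open>m - 1 = l p\<^sup>s\<close> with \<open>l\<close> prime to \<open>p\<close>. The exponent \<open>t = l\<close> gives a nonzero
  polynomial condition on \<open>d\<close> of degree at most \<open>l p\<^sup>2\<^sup>s\<close>; for \<open>l > 1\<close> the exponent
  \<open>t = 1 + (l - 1) p\<^sup>s\<close>, no proper \<open>p\<close>-power multiple of which occurs, gives one of degree \<open>p\<^sup>s\<close>.
  For \<open>p = 2\<close> the latter is a square once \<open>f\<close> is reduced to odd exponents.
\<close>

section \<open>Polynomials modulo \<open>h\<^sup>p - h\<close>\<close>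

text \<open>Everything about infinity comes from one observation: in a valuation ring where X has a
  pole, X and W have pole orders p and m, and the number p a + m i with i < p determines i. Hence 1,
  W, ..., W^(p-1) are independent over k(X), and only one place lies over X = infinity.

  Coprimality of p and m alone does not yet give the affine shape: for m < p the image of X could
  contain a polynomial Q in W. A first-order Taylor expansion of the curve equation excludes it,
  since a nonzero Q would produce a pole order that no expression g(X) + b W has.

  In e) the hypothesis says that more than (m - 1)/2 translations exist. For l > 1 the bounds of d)
  forbid this, so m - 1 is a power p^s; and since the number of translations is a power of p, there
  are at least p^s of them. So many translations force all exponents of the reduced f to be 1 or 1 +
  p^i, and a suitable translation of X removes the linear term.\<close>

definition as_image :: "nat \<Rightarrow> 'a::comm_ring_1 set" where
  "as_image p = range (\<lambda>h. h ^ p - h)"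

definition shift :: "'a::comm_ring_1 \<Rightarrow> 'a poly \<Rightarrow> 'a poly" where
  "shift d f = pcompose f [:d, 1:]"

text \<open>The translations X -> X + d that lift to the curve W^p - W = f. They form an additive
  group, the quotient of the wild inertia group by the p automorphisms W -> W + c with c in the
  prime field.\<close>

definition as_translations :: "nat \<Rightarrow> 'a::comm_ring_1 poly \<Rightarrow> 'a set" where
  "as_translations p f = {d. shift d f - f \<in> as_image p}"

lemma diff_power_CHAR:
  fixes x y :: "'a::comm_ring_1"
  assumes "prime CHAR('a)"
  shows "(x - y) ^ CHAR('a) = x ^ CHAR('a) - y ^ CHAR('a)"
proof -
  have "(x - y + y) ^ CHAR('a) = (x - y) ^ CHAR('a) + y ^ CHAR('a)"
    using assms by (intro freshmans_dream) auto
  then show ?thesis by (simp add: algebra_simps)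
qed

lemma minus_power_CHAR:
  fixes x :: "'a::comm_ring_1"
  assumes "prime CHAR('a)"
  shows "(- x) ^ CHAR('a) = - (x ^ CHAR('a))"
  using diff_power_CHAR[OF assms, of 0 x] assms by (simp add: power_0_left prime_gt_0_nat)

text \<open>Frobenius is trivial modulo the image, hence so are its iterates; the witness h makes
  the difference telescope.\<close>

lemma as_image_diff_power:
  fixes u :: "'a::comm_ring_1"
  assumes "prime CHAR('a)" "CHAR('a) = p"
  shows "u ^ p ^ n - u \<in> as_image p"
proof -
  define h where "h = (\<Sum>i<n. u ^ p ^ i)"
  have "h ^ p = (\<Sum>i<n. (u ^ p ^ i) ^ p)"
    unfolding h_def by (rule freshmans_dream_sum) (use assms in auto)
  also have "\<dots> = (\<Sum>i<n. u ^ p ^ Suc i)"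
    by (intro sum.cong refl) (simp only: power_mult[symmetric] power_Suc2)
  finally have "h ^ p = (\<Sum>i<n. u ^ p ^ Suc i)" .
  then have "h ^ p - h = (\<Sum>i<n. u ^ p ^ Suc i - u ^ p ^ i)"
    by (simp add: h_def sum_subtractf)
  also have "\<dots> = u ^ p ^ n - u"
    by (induction n) auto
  finally have "u ^ p ^ n - u = h ^ p - h" by simp
  then show ?thesis unfolding as_image_def by (rule range_eqI)
qed

lemma pcompose_power: "pcompose (f ^ n) g = pcompose f g ^ n" for f :: "'a::comm_semiring_1 poly"
  by (induction n) (simp_all add: pcompose_mult pcompose_1)

lemma degree_power_diff_self:
  fixes h :: "'a::idom poly"
  assumes "degree h > 0" "p > 1"
  shows "degree (h ^ p - h) = p * degree h"
proof -
  have "h \<noteq> 0" using assms by auto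
  then have "degree (h ^ p) = p * degree h" by (rule degree_power_eq)
  moreover have "degree h < p * degree h" using assms by simp
  ultimately show ?thesis
    unfolding diff_conv_add_uminus by (subst degree_add_eq_left) auto
qed

locale alg_closed_char =
  fixes p :: nat and K :: "'k::alg_closed_field itself"
  assumes char_p: "CHAR('k) = p" and p_pos: "p > 0"
begin

lemma prime_p: "prime p"
  using prime_CHAR_semidom[where ?'a = 'k] char_p p_pos by simp

lemma p_gt_1: "p > 1"
  using prime_p prime_gt_1_nat by blast

lemma char_poly_p: "CHAR('k poly) = p"
  by (simp add: char_p)

lemma frobenius_add_poly: "(x + y) ^ p = x ^ p + y ^ p" for x y :: "'k poly"
  by (rule freshmans_dream) (simp_all only: char_poly_p prime_p)

lemma frobenius_sum: "sum g A ^ p = (\<Sum>i\<in>A. g i ^ p)" for g :: "'b \<Rightarrow> 'k"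
  by (rule freshmans_dream_sum) (simp_all only: char_p prime_p)

lemma frobenius_sum_poly: "sum g A ^ p = (\<Sum>i\<in>A. g i ^ p)" for g :: "'b \<Rightarrow> 'k poly"
  by (rule freshmans_dream_sum) (simp_all only: char_poly_p prime_p)

lemma frobenius_minus: "(- x) ^ p = - (x ^ p)" for x :: 'k
  using minus_power_CHAR[where ?'a = 'k] unfolding char_p using prime_p by blast

lemma frobenius_minus_poly: "(- x) ^ p = - (x ^ p)" for x :: "'k poly"
  using minus_power_CHAR[where ?'a = "'k poly"] unfolding char_poly_p using prime_p by blast

lemma as_image_0: "(0::'k poly) \<in> as_image p"
  unfolding as_image_def by (rule range_eqI[of _ _ 0]) (use p_gt_1 in \<open>simp add: power_0_left\<close>)

lemma as_image_add:
  fixes f g :: "'k poly"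
  assumes "f \<in> as_image p" "g \<in> as_image p"
  shows "f + g \<in> as_image p"
proof -
  obtain a b where "f = a ^ p - a" "g = b ^ p - b"
    using assms by (auto simp: as_image_def)
  moreover have "(a + b) ^ p = a ^ p + b ^ p"
    by (rule frobenius_add_poly)
  ultimately have "f + g = (a + b) ^ p - (a + b)" by simp
  then show ?thesis unfolding as_image_def by blast
qed

lemma as_image_uminus:
  fixes f :: "'k poly"
  assumes "f \<in> as_image p"
  shows "- f \<in> as_image p"
proof -
  obtain a where "f = a ^ p - a"
    using assms by (auto simp: as_image_def)
  moreover have "(- a) ^ p = - (a ^ p)"
    by (rule frobenius_minus_poly)
  ultimately have "- f = (- a) ^ p - (- a)" by simp
  then show ?thesis unfolding as_image_def by blast
qed

lemma as_image_diff:
  fixes f g :: "'k poly"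
  assumes "f \<in> as_image p" "g \<in> as_image p"
  shows "f - g \<in> as_image p"
  using as_image_add[OF assms(1) as_image_uminus[OF assms(2)]] by simp

lemma as_image_shift:
  fixes f :: "'k poly"
  assumes "f \<in> as_image p"
  shows "shift d f \<in> as_image p"
proof -
  obtain a where "f = a ^ p - a"
    using assms by (auto simp: as_image_def)
  then have "shift d f = (shift d a) ^ p - shift d a"
    by (simp add: shift_def pcompose_diff pcompose_power)
  then show ?thesis unfolding as_image_def by blast
qed

lemma as_image_const: "[:c:] \<in> as_image p" for c :: 'k
proof -
  have "degree (monom 1 p - [:c, 1:] :: 'k poly) > 0"
  proof -
    have "degree (monom 1 p - [:c, 1:] :: 'k poly) = p"
      unfolding diff_conv_add_uminus using p_gt_1
      by (subst degree_add_eq_left) (auto simp: degree_monom_eq)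
    then show ?thesis using p_pos by simp
  qed
  then obtain a where "poly (monom 1 p - [:c, 1:]) a = 0"
    using alg_closed_imp_poly_has_root by blast
  then have "c = a ^ p - a" by (simp add: poly_monom algebra_simps)
  then have "[:c:] = [:a:] ^ p - [:a:]" by (simp add: poly_const_pow)
  then show ?thesis unfolding as_image_def by blast
qed

lemma coeff_power_p:
  fixes h :: "'k poly"
  shows "coeff (h ^ p) n = (if p dvd n then coeff h (n div p) ^ p else 0)"
proof -
  have "h ^ p = (\<Sum>i\<le>degree h. monom (coeff h i) i) ^ p"
    by (simp add: poly_as_sum_of_monoms)
  also have "\<dots> = (\<Sum>i\<le>degree h. monom (coeff h i ^ p) (p * i))"
    unfolding frobenius_sum_poly by (simp add: monom_power mult.commute)
  finally have eq: "coeff (h ^ p) n = (\<Sum>i\<le>degree h. if p * i = n then coeff h i ^ p else 0)"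
    by (simp add: coeff_sum)
  show ?thesis
  proof (cases "p dvd n")
    case True
    then obtain j where j: "n = p * j" by blast
    have "coeff (h ^ p) n = (\<Sum>i\<le>degree h. if i = j then coeff h i ^ p else 0)"
      unfolding eq using p_pos j by (intro sum.cong) auto
    also have "\<dots> = coeff h j ^ p"
      using p_pos by (auto simp: coeff_eq_0)
    finally show ?thesis using j p_pos by simp
  next
    case False
    then have "\<And>i. p * i \<noteq> n" by auto
    with False show ?thesis unfolding eq by simp
  qed
qed

text \<open>Along the exponents t, t p, t p^2, ... the coefficients of h^p - h are -h_t, h_t^p -
  h_(tp), and so on. Raising the j-th one to the power p^(N-j) makes consecutive terms cancel. This
  is the condition with p-th roots, freed of roots by the power p^N.\<close>

lemma as_image_telescope:
  fixes h :: "'k poly"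
  assumes "\<not> p dvd t"
  shows "(\<Sum>j\<le>N. coeff (h ^ p - h) (t * p ^ j) ^ p ^ (N - j)) = - coeff h (t * p ^ N)"
proof (induction N)
  case 0
  then show ?case using assms by (simp add: coeff_power_p)
next
  case (Suc N)
  have "(\<Sum>j\<le>Suc N. coeff (h ^ p - h) (t * p ^ j) ^ p ^ (Suc N - j))
      = (\<Sum>j\<le>N. coeff (h ^ p - h) (t * p ^ j) ^ p ^ (Suc N - j)) + coeff (h ^ p - h) (t * p ^ Suc N)"
    by simp
  also have "(\<Sum>j\<le>N. coeff (h ^ p - h) (t * p ^ j) ^ p ^ (Suc N - j))
     = (\<Sum>j\<le>N. (coeff (h ^ p - h) (t * p ^ j) ^ p ^ (N - j)) ^ p)"
    by (intro sum.cong) (auto simp: Suc_diff_le mult.commute simp flip: power_mult)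
  also have "\<dots> = (\<Sum>j\<le>N. coeff (h ^ p - h) (t * p ^ j) ^ p ^ (N - j)) ^ p"
    by (simp add: frobenius_sum)
  also have "\<dots> = - (coeff h (t * p ^ N) ^ p)"
    unfolding Suc by (rule frobenius_minus)
  also have "coeff (h ^ p - h) (t * p ^ Suc N) = coeff h (t * p ^ N) ^ p - coeff h (t * p ^ Suc N)"
    using p_pos by (simp add: coeff_power_p)
  finally show ?case by simp
qed

text \<open>Of the telescoped sum only the coefficient of h at t p^N survives, and h has degree
  smaller than that.\<close>

lemma as_image_sum_coeff_eq_0:
  fixes g :: "'k poly"
  assumes "g \<in> as_image p" "\<not> p dvd t" "degree g \<le> t * p ^ N"
  shows "(\<Sum>j\<le>N. coeff g (t * p ^ j) ^ p ^ (N - j)) = 0"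
proof -
  obtain h where h: "g = h ^ p - h"
    using assms by (auto simp: as_image_def)
  have t: "t > 0" using assms(2) by (cases t) auto
  have "degree h < t * p ^ N"
  proof (cases "degree h = 0")
    case True
    then show ?thesis using t p_pos by simp
  next
    case False
    then have "degree g = p * degree h" unfolding h using p_gt_1 by (intro degree_power_diff_self) auto
    moreover have "degree h < p * degree h" using False p_gt_1 by simp
    ultimately show ?thesis using assms(3) by linarith
  qed
  then have "coeff h (t * p ^ N) = 0" by (simp add: coeff_eq_0)
  then show ?thesis
    unfolding h using as_image_telescope[OF assms(2), of h N] by simp
qed

lemma as_image_coeff_eq_0:
  fixes g :: "'k poly"
  assumes g: "g \<in> as_image p" and t: "\<not> p dvd t"
    and zero: "\<And>j. j > 0 \<Longrightarrow> coeff g (t * p ^ j) = 0"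
  shows "coeff g t = 0"
proof -
  \<comment> \<open>This N is large enough because p^N is at least N, so t p^N reaches the degree of
    g.\<close>
  define N where "N = degree g"
  have "t > 0" using t by (cases t) auto
  have "N \<le> p ^ N" using p_gt_1 by (simp add: less_imp_le power_gt_expt)
  also have "\<dots> \<le> t * p ^ N" using \<open>t > 0\<close> by simp
  finally have "(\<Sum>j\<le>N. coeff g (t * p ^ j) ^ p ^ (N - j)) = 0"
    using as_image_sum_coeff_eq_0[OF g t] N_def by simp
  also have "(\<Sum>j\<le>N. coeff g (t * p ^ j) ^ p ^ (N - j)) = (\<Sum>j\<in>{0}. coeff g (t * p ^ j) ^ p ^ (N - j))"
    by (rule sum.mono_neutral_right) (use zero p_pos in \<open>auto simp: power_0_left\<close>)
  finally show ?thesis by simp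
qed

lemma ex_root_p: "\<exists>b. b ^ p ^ n = (a :: 'k)"
  using nth_root_exists[of "p ^ n" a] p_pos by simp

text \<open>A leading term c X^(jp) is congruent to b X^j with b^p = c, which lowers the degree;
  constants lie in the image because k is algebraically closed. The degree bound on h ensures that a
  leading term of degree prime to p is not disturbed.\<close>

lemma reduce_exponents:
  fixes f :: "'k poly"
  shows "\<exists>h. degree h * p \<le> degree f \<and> (\<forall>i. p dvd i \<longrightarrow> coeff (f - (h ^ p - h)) i = 0)"
proof (induction "degree f" arbitrary: f rule: less_induct)
  case less
  define n where "n = degree f"
  show ?case
  proof (cases "n = 0")
    case True
    then obtain c where c: "f = [:c:]" using n_def by (auto elim: degree_eq_zeroE)
    obtain h where h: "[:c:] = h ^ p - h" using as_image_const by (auto simp: as_image_def)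
    have "degree h = 0"
    proof (rule ccontr)
      assume *: "degree h \<noteq> 0"
      then have "degree (h ^ p - h) = p * degree h" using p_gt_1 by (intro degree_power_diff_self) auto
      moreover have "degree (h ^ p - h) = 0" unfolding h[symmetric] by simp
      ultimately show False using * p_pos by simp
    qed
    then show ?thesis using c h by (intro exI[of _ h]) auto
  next
    case False
    define c where "c = coeff f n"
    define f1 where "f1 = f - monom c n"
    have f1: "degree f1 < n"
    proof (rule degree_lessI)
      show "f1 \<noteq> 0 \<or> 0 < n" using False by simp
      show "\<forall>k\<ge>n. coeff f1 k = 0"
        by (auto simp: f1_def c_def n_def coeff_eq_0)
    qed
    show ?thesis
    proof (cases "p dvd n")
      case False
      have "degree f1 < degree f" using f1 n_def by simp
      from less[OF this] obtain h where
        h: "degree h * p \<le> degree f1" "\<forall>i. p dvd i \<longrightarrow> coeff (f1 - (h ^ p - h)) i = 0" by blast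
      have "coeff (f - (h ^ p - h)) i = 0" if "p dvd i" for i
        using h(2) that False by (auto simp: f1_def split: if_splits)
      then show ?thesis using h(1) f1 n_def by (intro exI[of _ h]) auto
    next
      case True
      then obtain j where j: "n = j * p" by (metis dvd_div_mult_self)
      obtain b where b: "b ^ p = c" using ex_root_p[of 1] by auto
      define f2 where "f2 = f1 + monom b j"
      have "j < n" using j p_gt_1 \<open>n \<noteq> 0\<close> by simp
      then have "degree f2 < degree f"
        unfolding f2_def using f1 n_def degree_monom_le[of b j] by (intro degree_add_less) auto
      from less[OF this] obtain h where
        h: "degree h * p \<le> degree f2" "\<forall>i. p dvd i \<longrightarrow> coeff (f2 - (h ^ p - h)) i = 0" by blast
      have "(h + monom b j) ^ p = h ^ p + monom b j ^ p"
        by (rule frobenius_add_poly)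
      also have "monom b j ^ p = monom c n" by (simp add: monom_power b j)
      finally have eq: "f - ((h + monom b j) ^ p - (h + monom b j)) = f2 - (h ^ p - h)"
        by (simp add: f2_def f1_def)
      have "degree h * p < j * p"
        \<comment> \<open>The h obtained for f2 has degree below j, so adding b X^j keeps the degree
          within j, and j p is the degree of f.\<close>
        using h(1) \<open>degree f2 < degree f\<close> j n_def by linarith
      then have "degree h \<le> j" by simp
      then have "degree (h + monom b j) \<le> j"
        by (meson degree_add_le degree_monom_le)
      then show ?thesis using h(2) j n_def by (intro exI[of _ "h + monom b j"]) (simp only: eq, auto)
    qed
  qed
qed

end

section \<open>Translations\<close>

text \<open>The t-th Hasse derivative of f. Its value at d is the coefficient of X^t in f(X + d), so
  a condition on that coefficient becomes a polynomial equation in d.\<close>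

definition shift_coeff :: "nat \<Rightarrow> 'a::comm_ring_1 poly \<Rightarrow> 'a poly" where
  "shift_coeff t f = (\<Sum>i\<le>degree f. monom (coeff f i * of_nat (i choose t)) (i - t))"

lemma shift_add: "shift d (f + g) = shift d f + shift d g"
  by (simp add: shift_def pcompose_add)

lemma shift_diff: "shift d (f - g) = shift d f - shift d g"
  by (simp add: shift_def pcompose_diff)

lemma shift_mult: "shift d (f * g) = shift d f * shift d g"
  by (simp add: shift_def pcompose_mult)

lemma shift_power: "shift d (f ^ n) = shift d f ^ n"
  by (simp add: shift_def pcompose_power)

lemma shift_sum: "shift d (sum g A) = (\<Sum>i\<in>A. shift d (g i))"
  by (simp add: shift_def pcompose_sum)

lemma shift_shift: "shift d (shift e f) = shift (d + e) f"
  by (simp add: shift_def pcompose_assoc[symmetric] pcompose_pCons add.commute)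

lemma shift_0: "shift 0 f = f"
  by (simp add: shift_def)

lemma shift_monom: "shift d (monom c n) = smult c ([:d, 1:] ^ n)"
proof -
  have "monom c n = smult c ([:0, 1:] ^ n)" by (simp add: monom_altdef)
  then show ?thesis by (simp add: shift_def pcompose_smult pcompose_power pcompose_pCons)
qed

lemma degree_shift [simp]: "degree (shift d f) = degree f" for f :: "'a::idom poly"
  by (simp add: shift_def degree_pcompose)

lemma lead_coeff_shift: "coeff (shift d f) (degree f) = lead_coeff f" for f :: "'a::idom poly"
  using lead_coeff_comp[of "[:d, 1:]" f] by (simp add: shift_def degree_pcompose)

lemma degree_shift_diff:
  fixes f :: "'a::idom poly"
  assumes "degree f > 0"
  shows "degree (shift d f - f) < degree f"
  by (rule degree_lessI) (use assms lead_coeff_shift[of d f] in \<open>auto simp: coeff_eq_0 le_less\<close>)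

lemma coeff_shift_coeff: "coeff (shift_coeff t f) j = coeff f (j + t) * of_nat ((j + t) choose t)"
proof -
  have "coeff (shift_coeff t f) j
      = (\<Sum>i\<le>degree f. if i = j + t then coeff f i * of_nat (i choose t) else 0)"
    unfolding shift_coeff_def coeff_sum
  proof (intro sum.cong refl)
    fix i
    show "coeff (monom (coeff f i * of_nat (i choose t)) (i - t)) j =
         (if i = j + t then coeff f i * of_nat (i choose t) else 0)"
      by (cases "t \<le> i") (auto simp: binomial_eq_0)
  qed
  also have "\<dots> = coeff f (j + t) * of_nat ((j + t) choose t)"
    by (auto simp: coeff_eq_0)
  finally show ?thesis .
qed

lemma poly_shift_coeff: "poly (shift_coeff t f) d = coeff (shift d f) t"
proof -
  have "shift d f = (\<Sum>i\<le>degree f. smult (coeff f i) ([:d, 1:] ^ i))"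
    by (subst poly_as_sum_of_monoms[of f, symmetric]) (simp add: shift_sum shift_monom)
  then have "coeff (shift d f) t = (\<Sum>i\<le>degree f. coeff f i * coeff ([:d, 1:] ^ i) t)"
    by (simp add: coeff_sum)
  also have "\<dots> = (\<Sum>i\<le>degree f. coeff f i * of_nat (i choose t) * d ^ (i - t))"
  proof (intro sum.cong refl)
    fix i
    show "coeff f i * coeff ([:d, 1:] ^ i) t = coeff f i * of_nat (i choose t) * d ^ (i - t)"
    proof (cases "t \<le> i")
      case True
      then show ?thesis by (simp add: coeff_linear_poly_power mult.assoc)
    next
      case False
      have "degree ([:d, 1:] ^ i) = i" by (rule degree_linear_power)
      with False show ?thesis by (simp add: coeff_eq_0 binomial_eq_0)
    qed
  qed
  also have "\<dots> = poly (shift_coeff t f) d"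
    by (simp add: shift_coeff_def poly_sum poly_monom)
  finally show ?thesis by simp
qed

lemma degree_shift_coeff: "degree (shift_coeff t f) \<le> degree f - t"
  by (rule degree_le) (auto simp: coeff_shift_coeff coeff_eq_0)

text \<open>The multiset of roots has size \<open>degree P\<close> over an algebraically closed
  field, and a root where the derivative does not vanish is simple.\<close>

lemma card_roots_eq_degree:
  fixes P :: "'a::alg_closed_field poly"
  assumes "P \<noteq> 0" and sep: "\<And>a. poly P a = 0 \<Longrightarrow> poly (pderiv P) a \<noteq> 0"
  shows "card {a. poly P a = 0} = degree P"
proof -
  obtain A where A: "size A = degree P" "P = smult (lead_coeff P) (\<Prod>x\<in>#A. [:-x, 1:])"
    using alg_closed_imp_factorization[OF assms(1)] by blast
  have "proots P = proots (\<Prod>x\<in>#A. [:-x, 1:])"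
    by (subst A(2)) (use assms(1) in simp)
  also have "\<dots> = A"
  proof -
    have "proots (\<Prod>q\<in>#image_mset (\<lambda>x. [:-x, 1:]) A. q) = A"
      by (subst proots_prod_mset) (auto simp: image_mset.compositionality o_def)
    then show ?thesis by simp
  qed
  finally have pA: "proots P = A" .
  have ord: "order a P = 1" if "poly P a = 0" for a
  proof -
    have "\<not> [:-a, 1:] ^ 2 dvd P"
    proof
      define A where "A = [:-a, 1:]"
      assume "[:-a, 1:] ^ 2 dvd P"
      then have "A ^ 2 dvd P" by (simp only: A_def)
      then obtain R where "P = A ^ 2 * R" by (rule dvdE)
      then have "P = A * (A * R)" by (simp only: power2_eq_square mult.assoc)
      then have "pderiv P = A * pderiv (A * R) + A * R * pderiv A" by (simp only: pderiv_mult)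
      then have "poly (pderiv P) a = 0" by (simp add: A_def)
      with sep[OF that] show False by simp
    qed
    then have "order a P < 2" using order_divides[of a 2 P] assms(1) by auto
    moreover have "order a P \<noteq> 0" using that assms(1) order_root by blast
    ultimately show ?thesis by simp
  qed
  have "degree P = size (proots P)" using A(1) pA by simp
  also have "\<dots> = (\<Sum>x\<in>set_mset (proots P). count (proots P) x)"
    by (simp add: size_multiset_overloaded_eq)
  also have "\<dots> = (\<Sum>x\<in>{a. poly P a = 0}. 1)"
    using assms(1) ord by (intro sum.cong) auto
  finally show ?thesis by simp
qed

section \<open>Bounds on the number of translations\<close>

context alg_closed_char
begin

text \<open>Translation keeps the leading term, so the degree of f(X + d) - f lies below that of f
  and hence below every t p^j with j > 0. Only the exponent t itself is left in the coefficient
  condition.\<close>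

lemma as_translations_coeff:
  fixes f :: "'k poly"
  assumes "d \<in> as_translations p f" "\<not> p dvd t" "degree f \<le> t * p"
  shows "coeff (shift d f) t = coeff f t"
proof (cases "degree f = 0")
  case True
  then show ?thesis by (metis degree_eq_zeroE pcompose_const shift_def)
next
  case False
  have "coeff (shift d f - f) t = 0"
  proof (rule as_image_coeff_eq_0)
    show "shift d f - f \<in> as_image p" using assms(1) by (simp add: as_translations_def)
    show "\<not> p dvd t" by fact
    fix j :: nat assume "j > 0"
    then have "p \<le> p ^ j" using p_gt_1 by (metis One_nat_def Suc_leI less_imp_le power_increasing power_one_right)
    then have "degree f \<le> t * p ^ j" using assms(3) by (meson mult_le_mono2 le_trans)
    then show "coeff (shift d f - f) (t * p ^ j) = 0"
      using degree_shift_diff[of f d] False by (intro coeff_eq_0) auto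
  qed
  then show ?thesis by simp
qed

text \<open>For r > 0 the binomial coefficient is congruent to l modulo p: with q = p^r one has (1 +
  X)^(1 + l q) = (1 + X)(1 + X^q)^l, where X^q has coefficient l. For r = 0 it equals 1 + l.\<close>

lemma of_nat_choose_nonzero:
  assumes "\<not> p dvd l" "\<not> p dvd 1 + l * p ^ r" "l > 0"
  shows "(of_nat ((1 + l * p ^ r) choose (1 + (l - 1) * p ^ r)) :: 'k) \<noteq> 0"
proof -
  define q where "q = p ^ r"
  have q: "q > 0" using p_pos by (simp add: q_def)
  have lq: "1 + l * q = q + (1 + (l - 1) * q)" using assms(3) by (cases l) auto
  have sym: "(1 + l * q) choose (1 + (l - 1) * q) = (1 + l * q) choose q"
    using binomial_symmetric[of q "1 + l * q"] lq by simp
  show ?thesis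
  proof (cases "r = 0")
    case True
    then have "(1 + l * p ^ r) choose (1 + (l - 1) * p ^ r) = 1 + l * p ^ r"
      using sym by (simp add: q_def)
    then show ?thesis using assms(2) by (simp only: of_nat_eq_0_iff_char_dvd char_p) simp
  next
    case False
    then have "q > 1" using p_gt_1 using False by (simp add: q_def one_less_power del: One_nat_def)
    have "(1 + monom 1 1 :: 'k poly) ^ q = 1 + monom 1 q"
    proof -
      have "(1 + monom 1 1 :: 'k poly) ^ q = 1 ^ q + monom 1 1 ^ q"
        by (rule freshmans_dream') (simp_all only: char_poly_p prime_p q_def)
      then show ?thesis by (simp add: monom_power)
    qed
    then have "(1 + monom 1 1 :: 'k poly) ^ (1 + l * q) = (1 + monom 1 1) * (1 + monom 1 q) ^ l"
      by (simp only: power_add power_one_right) (metis power_mult mult.commute)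
    also have "(1 + monom 1 q :: 'k poly) ^ l = (\<Sum>k\<le>l. monom (of_nat (l choose k)) (q * k))"
    proof -
      have "(1 + monom 1 q :: 'k poly) ^ l = (monom 1 q + 1) ^ l" by (simp add: add.commute)
      also have "\<dots> = (\<Sum>k\<le>l. of_nat (l choose k) * monom 1 q ^ k * 1 ^ (l - k))"
        by (rule binomial_ring)
      also have "\<dots> = (\<Sum>k\<le>l. monom (of_nat (l choose k)) (q * k))"
        by (intro sum.cong refl) (simp add: monom_power of_nat_mult_conv_smult smult_monom)
      finally show ?thesis .
    qed
    finally have eq: "(1 + monom 1 1 :: 'k poly) ^ (1 + l * q)
        = (1 + monom 1 1) * (\<Sum>k\<le>l. monom (of_nat (l choose k)) (q * k))" (is "_ = _ * ?B") .
    have B: "coeff ?B n = (\<Sum>k\<le>l. if q * k = n then of_nat (l choose k) else 0)" for n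
      by (simp add: coeff_sum)
    have "coeff ?B q = (\<Sum>k\<le>l. if k = 1 then of_nat (l choose k) else 0)"
      unfolding B using q by (intro sum.cong) auto
    also have "\<dots> = of_nat l" using assms(3) by auto
    finally have Bq: "coeff ?B q = of_nat l" .
    \<comment> \<open>As q > 1, the exponent q - 1 is no multiple of q, so the summand X of 1 + X
      contributes nothing at X^q.\<close>
    have "q * k \<noteq> q - 1" for k
      using \<open>q > 1\<close> by (cases k) auto
    then have Bq1: "coeff ?B (q - 1) = 0" unfolding B by simp
    have "coeff ((1 + monom 1 1) * ?B) q = coeff ?B q + coeff ?B (q - 1)"
      using q by (simp add: distrib_right coeff_monom_mult)
    then have "coeff ((1 + monom 1 1 :: 'k poly) ^ (1 + l * q)) q = of_nat l"
      unfolding eq Bq Bq1 by simp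
    moreover have "(1 + monom 1 1 :: 'k poly) = [:1, 1:]"
      by (simp add: monom_altdef one_pCons)
    moreover have "coeff ([:1, 1 :: 'k:] ^ (1 + l * q)) q = of_nat ((1 + l * q) choose q)"
      using lq by (subst coeff_linear_poly_power) auto
    ultimately have "of_nat ((1 + l * q) choose q) = (of_nat l :: 'k)" by simp
    then show ?thesis using assms(1) sym by (simp add: q_def of_nat_eq_0_iff_char_dvd char_p)
  qed
qed

text \<open>The exponents of \<open>shift_coeff t g\<close> end at degree g - t = p^r, and its top
  coefficient is the leading coefficient of g times the binomial just shown to be nonzero.\<close>

lemma shift_coeff_diff_bound:
  fixes g :: "'k poly"
  assumes deg: "degree g = 1 + l * p ^ r" and l: "\<not> p dvd l" "\<not> p dvd degree g"
  defines "t \<equiv> 1 + (l - 1) * p ^ r"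
  defines "P \<equiv> shift_coeff t g - [:coeff g t:]"
  shows "degree P = p ^ r" and "{d. coeff (shift d g) t = coeff g t} = {d. poly P d = 0}"
proof -
  have l0: "l > 0" using l(1) by (cases l) auto
  have dt: "degree g = p ^ r + t" using deg l0 unfolding t_def by (cases l) auto
  have q: "p ^ r > 0" using p_pos by simp
  have "coeff P (p ^ r) = lead_coeff g * of_nat (degree g choose t)"
    using q p_pos by (simp add: P_def coeff_shift_coeff dt coeff_pCons split: nat.splits)
  moreover have "of_nat (degree g choose t) \<noteq> (0::'k)"
    unfolding deg t_def using of_nat_choose_nonzero[OF l(1) _ l0] l(2) deg by metis
  moreover have "lead_coeff g \<noteq> 0" using deg by (metis Suc_eq_plus1_left degree_0 leading_coeff_0_iff nat.distinct(1))
  ultimately have "coeff P (p ^ r) \<noteq> 0" by simp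
  moreover have "degree P \<le> p ^ r"
    unfolding P_def using degree_shift_coeff[of t g] dt
    by (intro degree_diff_le) auto
  ultimately show "degree P = p ^ r" by (simp add: le_degree order_antisym)
  show "{d. coeff (shift d g) t = coeff g t} = {d. poly P d = 0}"
    by (simp add: P_def poly_shift_coeff)
qed

lemma shift_coeff_fixed_card:
  fixes g :: "'k poly"
  assumes deg: "degree g = 1 + l * p ^ r" and l: "\<not> p dvd l" "\<not> p dvd degree g"
  defines "t \<equiv> 1 + (l - 1) * p ^ r"
  shows "finite {d. coeff (shift d g) t = coeff g t}"
    and "card {d. coeff (shift d g) t = coeff g t} \<le> p ^ r"
proof -
  note * = shift_coeff_diff_bound[OF deg l, folded t_def]
  have "shift_coeff t g - [:coeff g t:] \<noteq> 0" using *(1) p_pos by auto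
  then show "finite {d. coeff (shift d g) t = coeff g t}"
      "card {d. coeff (shift d g) t = coeff g t} \<le> p ^ r"
    unfolding *(2) using poly_roots_finite card_poly_roots_bound *(1) by (blast, metis)
qed

text \<open>The field is perfect, so roots can be taken coefficient by coefficient.\<close>

lemma pth_root_poly:
  fixes P :: "'k poly"
  assumes "\<And>i. \<not> p dvd i \<Longrightarrow> coeff P i = 0"
  shows "\<exists>Q. Q ^ p = P \<and> degree Q * p = degree P"
proof -
  obtain root where root: "\<And>a :: 'k. root a ^ p = a"
    using ex_root_p[of 1] by (metis power_one_right)
  define Q where "Q = (\<Sum>j\<le>degree P. monom (root (coeff P (p * j))) j)"
  have "coeff (Q ^ p) n = coeff P n" for n
  proof (cases "p dvd n")
    case True
    then obtain j where j: "n = p * j" by blast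
    have "coeff Q j = (if j \<le> degree P then root (coeff P n) else 0)"
      by (simp add: Q_def coeff_sum j)
    moreover have "coeff P n = 0" if "\<not> j \<le> degree P"
    proof -
      have "j \<le> n" using j p_pos by simp
      with that show ?thesis by (intro coeff_eq_0) auto
    qed
    ultimately show ?thesis using True j p_pos by (auto simp: coeff_power_p root)
  next
    case False
    then show ?thesis using assms by (simp add: coeff_power_p)
  qed
  then have "Q ^ p = P" by (rule poly_eqI)
  moreover from this have "degree Q * p = degree P"
  proof (cases "Q = 0")
    case True
    then show ?thesis using \<open>Q ^ p = P\<close> p_pos by (auto simp: power_0_left)
  next
    case False
    then show ?thesis using degree_power_eq[OF False, of p] \<open>Q ^ p = P\<close> by (simp add: mult.commute)
  qed
  ultimately show ?thesis by blast
qed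

text \<open>The substitution W -> W + h identifies the two curves, so they admit the same
  translations.\<close>

lemma as_translations_add_image:
  fixes f :: "'k poly"
  assumes "w \<in> as_image p"
  shows "as_translations p (f + w) = as_translations p f"
proof -
  have *: "d \<in> as_translations p (f + w)" if "d \<in> as_translations p f" "w \<in> as_image p" for d and f w :: "'k poly"
  proof -
    have "shift d (f + w) - (f + w) = (shift d f - f) + (shift d w - w)"
      by (simp add: shift_add)
    moreover have "\<dots> \<in> as_image p"
      using that unfolding as_translations_def mem_Collect_eq
      by (intro as_image_add[OF _ as_image_diff[OF as_image_shift]])
    ultimately show ?thesis by (simp only: as_translations_def mem_Collect_eq)
  qed
  show ?thesis
    using *[of _ f w] *[of _ "f + w" "- w"] assms as_image_uminus by auto
qed

lemma zero_in_as_translations: "0 \<in> as_translations p f" for f :: "'k poly"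
  by (simp add: as_translations_def shift_0 as_image_0)

lemma as_translations_add:
  fixes f :: "'k poly"
  assumes "d \<in> as_translations p f" "e \<in> as_translations p f"
  shows "d + e \<in> as_translations p f"
proof -
  have "shift (d + e) f - f = shift d (shift e f - f) + (shift d f - f)"
    by (simp add: shift_diff shift_shift)
  moreover have "\<dots> \<in> as_image p"
    using assms by (intro as_image_add as_image_shift) (auto simp: as_translations_def)
  ultimately show ?thesis by (simp only: as_translations_def mem_Collect_eq)
qed

lemma as_translations_uminus:
  fixes f :: "'k poly"
  assumes "d \<in> as_translations p f"
  shows "- d \<in> as_translations p f"
proof -
  have "shift (- d) f - f = - shift (- d) (shift d f - f)"
    by (simp add: shift_diff shift_shift shift_0)
  then show ?thesis using assms
    by (simp add: as_translations_def as_image_uminus as_image_shift)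
qed

text \<open>Here t = m - 1 is itself prime to p, and a translation by d changes the coefficient of
  X^(m-1) by d m times the leading coefficient.\<close>

lemma as_translations_trivial:
  fixes f :: "'k poly"
  assumes "\<not> p dvd degree f" "\<not> p dvd degree f - 1"
  shows "as_translations p f = {0}"
proof -
  define m where "m = degree f"
  have m: "m > 1" using assms by (cases m; cases "m - 1") (auto simp: m_def)
  have "d = 0" if "d \<in> as_translations p f" for d
  proof -
    have "m \<le> (m - 1) * 2" using m by simp
    also have "\<dots> \<le> (m - 1) * p" using p_gt_1 by simp
    finally have "coeff (shift d f) (m - 1) = coeff f (m - 1)"
      using as_translations_coeff[OF that assms(2)] m_def by simp
    moreover have "coeff (shift d f) (m - 1) = coeff f (m - 1) + lead_coeff f * of_nat m * d"
    proof -
      have sm: "Suc (m - 1) = m" using m by simp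
      define P where "P = shift_coeff (m - 1) f"
      have "degree P \<le> 1" unfolding P_def using degree_shift_coeff[of "m - 1" f] m_def m by simp
      then have "P = [:coeff P 0, coeff P 1:]"
        by (intro poly_eqI) (auto simp: coeff_pCons coeff_eq_0 split: nat.splits)
      moreover have "coeff P 0 = coeff f (m - 1)" by (simp add: P_def coeff_shift_coeff)
      moreover have "coeff P 1 = lead_coeff f * of_nat m"
        using sm binomial_symmetric[of 1 m] m by (simp add: P_def coeff_shift_coeff m_def)
      moreover have "coeff (shift d f) (m - 1) = poly P d" by (simp add: P_def poly_shift_coeff)
      ultimately show ?thesis by (metis poly_pCons poly_0 mult.commute mult_zero_right add_0_right)
    qed
    ultimately have "lead_coeff f * of_nat m * d = 0" by simp
    moreover have "lead_coeff f \<noteq> 0" using m m_def by auto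
    moreover have "(of_nat m :: 'k) \<noteq> 0" using assms(1) by (simp add: of_nat_eq_0_iff_char_dvd char_p m_def)
    ultimately show ?thesis by simp
  qed
  then show ?thesis using zero_in_as_translations by auto
qed

text \<open>The condition at t = l with N = s is the polynomial Q in d. Its linear term shows that
  it is nonzero: summands with j < s are p-th powers and have none, while j = s concerns the
  coefficient of X^(m-1), which contributes m times the leading coefficient of f. The bound l p^(2s)
  on the degree is then weakened to a square, the form needed in a).\<close>

lemma degree_as_translations_bound: 
  fixes f :: "'k poly"
  assumes deg: "degree f = 1 + l * p ^ s" and l: "\<not> p dvd l" and m: "\<not> p dvd degree f"
  shows "finite (as_translations p f)" and "card (as_translations p f) \<le> (l * p ^ s)\<^sup>2"
proof -
  define m where "m = degree f"
  have l0: "l > 0" using l(1) by (cases l) auto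
  define P where "P j = shift_coeff (l * p ^ j) f - [:coeff f (l * p ^ j):]" for j
  define Q where "Q = (\<Sum>j\<le>s. P j ^ p ^ (s - j))"
  have root: "poly Q d = 0" if "d \<in> as_translations p f" for d
  proof -
    have "degree (shift d f - f) \<le> l * p ^ s"
      using degree_shift_diff[of f d] deg by simp
    then have "(\<Sum>j\<le>s. coeff (shift d f - f) (l * p ^ j) ^ p ^ (s - j)) = 0"
      using that l by (intro as_image_sum_coeff_eq_0) (auto simp: as_translations_def)
    then show ?thesis
      by (simp add: Q_def P_def poly_sum poly_power poly_shift_coeff)
  qed
  have "coeff Q 1 = (\<Sum>j\<in>{s}. coeff (P j ^ p ^ (s - j)) 1)"
    unfolding Q_def coeff_sum
  proof (rule sum.mono_neutral_right)
    show "\<forall>i\<in>{..s} - {s}. coeff (P i ^ p ^ (s - i)) 1 = 0"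
    proof
      fix i assume i: "i \<in> {..s} - {s}"
      then obtain e where e: "s - i = Suc e" by (cases "s - i") auto
      have "P i ^ p ^ (s - i) = (P i ^ p ^ e) ^ p" by (simp add: e power_mult[symmetric] mult.commute)
      then show "coeff (P i ^ p ^ (s - i)) 1 = 0"
        using p_gt_1 by (simp only: coeff_power_p) simp
    qed
  qed auto
  also have "\<dots> = coeff (P s) 1" by simp
  also have "\<dots> = lead_coeff f * of_nat m"
  proof -
    have "m choose (l * p ^ s) = m" using binomial_symmetric[of 1 m] deg by (simp add: m_def)
    then show ?thesis using deg by (simp add: P_def coeff_shift_coeff m_def)
  qed
  finally have "coeff Q 1 = lead_coeff f * of_nat m" .
  moreover have "lead_coeff f \<noteq> 0" using deg by (metis Suc_eq_plus1_left degree_0 leading_coeff_0_iff nat.distinct(1))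
  moreover have "(of_nat m :: 'k) \<noteq> 0" using m by (simp add: of_nat_eq_0_iff_char_dvd char_p m_def)
  ultimately have "Q \<noteq> 0" by auto
  have sub: "as_translations p f \<subseteq> {d. poly Q d = 0}" using root by auto
  then show "finite (as_translations p f)"
    using poly_roots_finite[OF \<open>Q \<noteq> 0\<close>] finite_subset by blast
  have "card (as_translations p f) \<le> card {d. poly Q d = 0}"
    using sub poly_roots_finite[OF \<open>Q \<noteq> 0\<close>] by (rule card_mono[rotated])
  also have "\<dots> \<le> degree Q" using \<open>Q \<noteq> 0\<close> by (rule card_poly_roots_bound)
  also have "\<dots> \<le> (l * p ^ s)\<^sup>2"
    unfolding Q_def
  proof (rule degree_sum_le)
    fix j assume "j \<in> {..s}"
    have lp: "l * p ^ j \<ge> 1" using l0 p_pos by simp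
    have "degree (P j) \<le> degree f - l * p ^ j"
      unfolding P_def using degree_shift_coeff[of "l * p ^ j" f] by (intro degree_diff_le) auto
    also have "\<dots> \<le> l * p ^ s" using deg lp by linarith
    finally have "degree (P j) * p ^ (s - j) \<le> (l * p ^ s) * p ^ s"
      using p_pos by (intro mult_le_mono power_increasing) auto
    also have "\<dots> \<le> (l * p ^ s) * (l * p ^ s)" using l0 by simp
    finally show "degree (P j ^ p ^ (s - j)) \<le> (l * p ^ s)\<^sup>2"
      using degree_power_le[of "P j" "p ^ (s - j)"] by (simp add: power2_eq_square)
  qed simp
  finally show "card (as_translations p f) \<le> (l * p ^ s)\<^sup>2" .
qed

text \<open>For l at least 2 the exponent t = 1 + (l - 1) p^r is at least half of 1 + l p^r, so t p
  already reaches it. For l = 1 and r > 0 this fails, and such degrees allow more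
  translations.\<close>

lemma l_ge_2_exponent:
  assumes "l \<ge> 2"
  shows "1 + l * p ^ r \<le> (1 + (l - 1) * p ^ r) * p"
proof -
  obtain k where k: "l = Suc (Suc k)" using assms by (metis add_2_eq_Suc le_Suc_ex)
  have "1 + l * p ^ r \<le> (1 + (l - 1) * p ^ r) * 2" by (simp add: k)
  also have "\<dots> \<le> (1 + (l - 1) * p ^ r) * p" using p_gt_1 by (intro mult_le_mono2) simp
  finally show ?thesis .
qed

lemma not_dvd_exponent:
  assumes "\<not> p dvd l" "r = 0 \<or> l > 0"
  shows "\<not> p dvd 1 + (l - 1) * p ^ r"
proof (cases "r = 0")
  case True
  then show ?thesis using assms by (cases l) auto
next
  case False
  then have "p dvd (l - 1) * p ^ r" by simp
  then show ?thesis using p_gt_1 by (metis dvd_add_left_iff nat_dvd_1_iff_1 less_irrefl)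
qed

lemma as_translations_card_le:
  fixes f :: "'k poly"
  assumes deg: "degree f = 1 + l * p ^ s" and l: "\<not> p dvd l" "l \<ge> 2" and m: "\<not> p dvd degree f"
  shows "card (as_translations p f) \<le> p ^ s"
proof -
  define t where "t = 1 + (l - 1) * p ^ s"
  have "as_translations p f \<subseteq> {d. coeff (shift d f) t = coeff f t}"
    using as_translations_coeff[of _ f t] l_ge_2_exponent[OF l(2), of s]
      not_dvd_exponent[OF l(1), of s] deg l by (auto simp: t_def)
  then have "card (as_translations p f) \<le> card {d. coeff (shift d f) t = coeff f t}"
    using shift_coeff_fixed_card[OF deg l(1) m] by (intro card_mono) (simp_all add: t_def)
  also have "\<dots> \<le> p ^ s"
    using shift_coeff_fixed_card[OF deg l(1) m] by (simp add: t_def)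
  finally show ?thesis .
qed

text \<open>As p does not divide the degree, removing the exponents divisible by p leaves the
  leading term alone, and the curve changes only by a substitution in W.\<close>

lemma ex_reduced:
  fixes f :: "'k poly"
  assumes m: "\<not> p dvd degree f"
  shows "\<exists>g. f - g \<in> as_image p \<and> as_translations p g = as_translations p f \<and> degree g = degree f \<and>
    lead_coeff g = lead_coeff f \<and> (\<forall>i. p dvd i \<longrightarrow> coeff g i = 0)"
proof -
  obtain h where h: "degree h * p \<le> degree f" "\<forall>i. p dvd i \<longrightarrow> coeff (f - (h ^ p - h)) i = 0"
    using reduce_exponents by blast
  define w where "w = h ^ p - h"
  define g where "g = f - w"
  have w: "w \<in> as_image p" by (auto simp: as_image_def w_def)
  have degh: "degree h < degree f"
  proof (cases "degree h = 0")
    case True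
    then show ?thesis using m by (cases "degree f") auto
  next
    case False
    then have "degree h < degree h * p" using p_gt_1 by simp
    then show ?thesis using h(1) by linarith
  qed
  have lead: "coeff g (degree f) = lead_coeff f"
    using m degh by (simp add: g_def w_def coeff_power_p coeff_eq_0)
  have "degree (h ^ p) \<le> degree f"
    using degree_power_le[of h p] h(1) by simp
  then have "degree g \<le> degree f"
    unfolding g_def w_def using degh by (intro degree_diff_le) auto
  moreover have "lead_coeff f \<noteq> 0" using m by auto
  ultimately have degg: "degree g = degree f" using lead by (metis le_degree order_antisym)
  moreover have "as_translations p g = as_translations p f"
    using as_translations_add_image[OF w, of g] by (simp add: g_def)
  ultimately show ?thesis using w h(2) lead by (intro exI[of _ g]) (auto simp: g_def w_def)
qed

text \<open>If g has only odd exponents and t is odd, the condition at t involves only even powers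
  of d. It is therefore the square of a polynomial Q with the same zeros and half the
  degree.\<close>

lemma as_translations_card_le_two:
  fixes f :: "'k poly"
  assumes deg: "degree f = 1 + l * p ^ s" and l: "\<not> p dvd l" "l \<ge> 2" and m: "\<not> p dvd degree f"
    and p2: "p = 2" and s: "s > 0"
  shows "card (as_translations p f) \<le> 2 ^ (s - 1)"
proof -
  obtain g where g: "as_translations p g = as_translations p f" "degree g = degree f"
    "\<And>i. p dvd i \<Longrightarrow> coeff g i = 0"
    using ex_reduced[OF m] by blast
  note Vg = g(1) and degg = g(2)
  define t where "t = 1 + (l - 1) * p ^ s"
  have t: "\<not> p dvd t" using not_dvd_exponent[OF l(1), of s] l by (simp add: t_def)
  define P where "P = shift_coeff t g - [:coeff g t:]"
  note b = shift_coeff_diff_bound[of g l s, folded t_def P_def, unfolded degg, OF deg l(1) m]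
  have odd: "coeff P i = 0" if "\<not> p dvd i" for i
  proof -
    have "even (i + t)" using that t p2 by simp
    then have "coeff g (i + t) = 0" using g(3) p2 by simp
    then show ?thesis using that by (cases i) (auto simp: P_def coeff_shift_coeff)
  qed
  obtain Q where Q: "Q ^ p = P" "degree Q * p = degree P" using pth_root_poly[of P] odd by blast
  have "P \<noteq> 0" using b(1) p_pos by auto
  then have "Q \<noteq> 0" using Q(1) p_pos by (auto simp: power_0_left)
  have dQ: "degree Q = 2 ^ (s - 1)" using Q(2) s p2 unfolding b(1) by (cases s) auto
  have "as_translations p f \<subseteq> {d. coeff (shift d g) t = coeff g t}"
    using as_translations_coeff[of _ g t] l_ge_2_exponent[OF l(2), of s] t degg deg Vg
    by (auto simp: t_def)
  also have "\<dots> = {d. poly Q d = 0}"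
    unfolding b(2) Q(1)[symmetric] using p_pos by (simp add: poly_power)
  finally have "card (as_translations p f) \<le> card {d. poly Q d = 0}"
    using poly_roots_finite[OF \<open>Q \<noteq> 0\<close>] by (intro card_mono)
  also have "\<dots> \<le> degree Q" using \<open>Q \<noteq> 0\<close> by (rule card_poly_roots_bound)
  finally show ?thesis using dQ by simp
qed

text \<open>In (X + d)^m the coefficient at t is a nonzero binomial times d^(p^s), while X^m has no
  term there.\<close>

lemma as_translations_monom_trivial:
  assumes m: "m = 1 + l * p ^ s" and l: "\<not> p dvd l" "l \<ge> 2" and pm: "\<not> p dvd m"
  shows "as_translations p (monom (1::'k) m) = {0}"
proof -
  define t where "t = 1 + (l - 1) * p ^ s"
  have mt: "m = p ^ s + t" using m l(2) unfolding t_def by (cases l) auto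
  have t: "\<not> p dvd t" using not_dvd_exponent[OF l(1), of s] l by (simp add: t_def)
  have "d = 0" if "d \<in> as_translations p (monom (1::'k) m)" for d
  proof -
    have "coeff (shift d (monom 1 m)) t = coeff (monom 1 m) t"
      using as_translations_coeff[OF that t] l_ge_2_exponent[OF l(2), of s]
      by (simp add: degree_monom_eq m t_def)
    moreover have "coeff (monom (1::'k) m) t = 0" using mt p_pos by simp
    moreover have "coeff (shift d (monom 1 m)) t = of_nat (m choose t) * d ^ p ^ s"
      using mt by (simp add: shift_monom coeff_linear_poly_power)
    moreover have "(of_nat (m choose t) :: 'k) \<noteq> 0"
      using of_nat_choose_nonzero[OF l(1), of s] l(2) pm by (simp add: m t_def)
    ultimately show ?thesis by simp
  qed
  then show ?thesis using zero_in_as_translations by auto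
qed

section \<open>Monomials of degree 1 + q, and polynomials with many translations\<close>

lemma power_q_add: "(x + y) ^ p ^ s = x ^ p ^ s + y ^ p ^ s" for x y :: 'k
  by (rule freshmans_dream') (simp_all only: char_p prime_p)

lemma power_q_add_poly: "(x + y) ^ p ^ s = x ^ p ^ s + y ^ p ^ s" for x y :: "'k poly"
  by (rule freshmans_dream') (simp_all only: char_poly_p prime_p)

lemma power_q_sum: "sum g A ^ p ^ s = (\<Sum>i\<in>A. g i ^ p ^ s)" for g :: "'b \<Rightarrow> 'k"
  by (rule freshmans_dream_sum') (simp_all only: char_p prime_p)

lemma as_image_power_q: "u ^ p ^ s - u \<in> as_image p" for u :: "'k poly"
  by (rule as_image_diff_power) (simp_all only: char_poly_p prime_p)

lemma monom_1_in_as_image_iff: "monom c 1 \<in> as_image p \<longleftrightarrow> c = 0" for c :: 'k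
proof
  assume *: "monom c 1 \<in> as_image p"
  have "coeff (monom c 1) 1 = 0"
  proof (rule as_image_coeff_eq_0[OF *])
    show "\<not> p dvd 1" using p_gt_1 by simp
    fix j :: nat assume "j > 0"
    then have "p ^ j > 1" using p_gt_1 by (simp add: one_less_power del: One_nat_def)
    then show "coeff (monom c 1) (1 * p ^ j) = 0" by simp
  qed
  then show "c = 0" by simp
qed (simp add: as_image_0)

text \<open>Modulo \<open>h\<^sup>p - h\<close>, the monomial \<open>c X\<^bsup>q\<^esup>\<close> is equivalent to \<open>c\<^bsup>1/q\<^esup> X\<close>.\<close>

lemma monom_q_equiv: "monom (b ^ p ^ s) (p ^ s) - monom b 1 \<in> as_image p" for b :: 'k
  using as_image_power_q[of "monom b 1" s] by (simp add: monom_power)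

lemma shift_monom_q: "shift d (monom c (p ^ s)) = monom c (p ^ s) + [:c * d ^ p ^ s:]" for c :: 'k
proof -
  have "[:d, 1:] = monom 1 1 + [:d:]" by (simp add: monom_altdef)
  then have "[:d, 1:] ^ p ^ s = monom 1 (p ^ s) + [:d ^ p ^ s:]"
    by (simp only: power_q_add_poly poly_const_pow monom_power) simp
  then show ?thesis by (simp add: shift_monom smult_add_right smult_monom)
qed

lemma shift_monom_Suc_q: 
  "shift d (monom c (1 + p ^ s)) = monom c (1 + p ^ s) + monom (c * d) (p ^ s)
     + monom (c * d ^ p ^ s) 1 + [:c * d * d ^ p ^ s:]" for c :: 'k
proof -
  have "monom c (1 + p ^ s) = [:0, 1:] * monom c (p ^ s)" by (simp add: monom_Suc)
  then have "shift d (monom c (1 + p ^ s)) = [:d, 1:] * (monom c (p ^ s) + [:c * d ^ p ^ s:])"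
    by (simp only: shift_mult shift_monom_q) (simp add: shift_def pcompose_pCons)
  then show ?thesis
    by (simp add: monom_Suc monom_0 smult_add_right smult_monom algebra_simps)
qed

text \<open>The difference f(X + d) - f is d X^q + d^q X plus a constant. Modulo the image it
  collapses to (d^q + e) X with e^q = d, and a multiple of X lies in the image only if it is zero.
  Raising d^q + e to the power q gives the equation for d.\<close>

lemma as_translations_monom_Suc_q:
  "as_translations p (monom (1::'k) (1 + p ^ s)) = {d. d ^ (p ^ (2 * s)) + d = 0}"
proof -
  have "d \<in> as_translations p (monom (1::'k) (1 + p ^ s)) \<longleftrightarrow> d ^ (p ^ (2 * s)) + d = 0" for d
  proof -
    obtain e where e: "e ^ p ^ s = d" using ex_root_p by blast
    define w where "w = monom d (p ^ s) - monom e 1 + [:d * d ^ p ^ s:]"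
    have w: "w \<in> as_image p"
      unfolding w_def using monom_q_equiv[of e s] as_image_const as_image_add e by blast
    have eq: "shift d (monom 1 (1 + p ^ s)) - monom 1 (1 + p ^ s) = monom (d ^ p ^ s + e) 1 + w"
      unfolding shift_monom_Suc_q w_def by (simp add: add_monom[symmetric])
    have "d \<in> as_translations p (monom 1 (1 + p ^ s)) \<longleftrightarrow> monom (d ^ p ^ s + e) 1 + w \<in> as_image p"
      unfolding as_translations_def mem_Collect_eq eq ..
    also have "\<dots> \<longleftrightarrow> monom (d ^ p ^ s + e) 1 \<in> as_image p"
      using w as_image_add as_image_diff by (metis add_diff_cancel_right')
    also have "\<dots> \<longleftrightarrow> d ^ p ^ s + e = 0" by (rule monom_1_in_as_image_iff)
    also have "\<dots> \<longleftrightarrow> (d ^ p ^ s + e) ^ p ^ s = 0" using p_pos by simp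
    also have "(d ^ p ^ s + e) ^ p ^ s = d ^ (p ^ (2 * s)) + d"
      unfolding power_q_add e by (simp add: power_mult[symmetric] power_add[symmetric] mult_2)
    finally show ?thesis .
  qed
  then show ?thesis by blast
qed

text \<open>The derivative is the nonzero constant c, so all roots are simple.\<close>

lemma card_power_q_roots:
  assumes "s > 0" "c \<noteq> (0::'k)"
  shows "card {d::'k. d ^ p ^ s + c * d = 0} = p ^ s"
proof -
  define P where "P = monom 1 (p ^ s) + monom c 1"
  have q: "p ^ s > 1" using p_gt_1 assms(1) by (simp add: one_less_power del: One_nat_def)
  have "degree (monom (1::'k) (p ^ s)) = p ^ s" "degree (monom c 1) = 1"
    using assms by (auto simp: degree_monom_eq)
  then have deg: "degree P = p ^ s"
    unfolding P_def using q by (subst degree_add_eq_left) auto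
  have "(of_nat (p ^ s) :: 'k) = 0"
    using assms(1) by (simp add: of_nat_eq_0_iff_char_dvd char_p del: of_nat_power)
  then have "pderiv P = [:c:]" by (simp add: P_def pderiv_add pderiv_monom monom_0)
  moreover have "P \<noteq> 0" using deg p_pos by auto
  ultimately have "card {a. poly P a = 0} = degree P"
    using assms(2) by (intro card_roots_eq_degree) auto
  then show ?thesis by (simp add: deg) (simp add: P_def poly_monom)
qed

lemma card_as_translations_monom_Suc_q:
  assumes "s > 0"
  shows "card (as_translations p (monom (1::'k) (1 + p ^ s))) = p ^ (2 * s)"
  using card_power_q_roots[of "2 * s" 1] assms by (simp only: as_translations_monom_Suc_q mult_1) simp

text \<open>The polynomial \<open>(X\<^bsup>q\<^esup> - X)\<^bsup>n\<^esup>\<close> is invariant under translation by \<open>\<bbbF>\<^bsub>q\<^esub>\<close>. Modulo \<open>h\<^sup>p - h\<close>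
  its leading term \<open>X\<^bsup>nq\<^esup>\<close> can be replaced by \<open>X\<^sup>n\<close>, which makes the degree prime to \<open>p\<close>.\<close>

lemma ex_many_translations:
  assumes e: "e > 0" and n: "\<not> p dvd n" "n \<ge> 2"
  shows "\<exists>f :: 'k poly. degree f = 1 + (n - 1) * p ^ e \<and> {d. d ^ p ^ e = d} \<subseteq> as_translations p f"
proof -
  define q where "q = p ^ e"
  define A :: "'k poly" where "A = monom 1 q - monom 1 1"
  define w :: "'k poly" where "w = monom 1 (n * q) - monom 1 n"
  define f where "f = A ^ n - w"
  have q: "q > 1" using p_gt_1 e by (simp add: q_def one_less_power del: One_nat_def)
  have w: "w \<in> as_image p"
    using as_image_power_q[of "monom 1 n" e] by (simp add: w_def monom_power q_def)
  obtain n' where n': "n = Suc n'" "n' > 0" using n(2) by (cases n) auto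
  have "A ^ n = (- monom 1 1 + monom 1 q) ^ n" by (simp add: A_def)
  also have "\<dots> = (\<Sum>k\<le>n. of_nat (n choose k) * (- monom 1 1) ^ k * monom 1 q ^ (n - k))"
    by (rule binomial_ring)
  also have "\<dots> = (\<Sum>k\<le>n. monom (of_nat (n choose k) * (-1) ^ k) (k + q * (n - k)))"
  proof (intro sum.cong refl)
    fix k
    have "(- monom 1 1 :: 'k poly) ^ k = monom ((-1) ^ k) k"
      by (simp only: minus_monom monom_power) simp
    then show "of_nat (n choose k) * (- monom 1 1 :: 'k poly) ^ k * monom 1 q ^ (n - k)
       = monom (of_nat (n choose k) * (-1) ^ k) (k + q * (n - k))"
      by (simp add: monom_power of_nat_mult_conv_smult smult_monom mult_monom)
  qed
  \<comment> \<open>The term k = 0 is cancelled by the leading term of w. The term k = 1 then leads,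
    as its exponent exceeds all remaining ones, and its coefficient -n is nonzero in k.\<close>
  also have "\<dots> = monom 1 (q * n) + monom (- of_nat n) (1 + q * n')
       + (\<Sum>k=2..n. monom (of_nat (n choose k) * (-1) ^ k) (k + q * (n - k)))"
  proof -
    have "{..n} = insert 0 (insert 1 {2..n})" using n' by auto
    then show ?thesis using n' by simp
  qed
  finally have fA: "f = monom (- of_nat n) (1 + q * n')
       + ((\<Sum>k=2..n. monom (of_nat (n choose k) * (-1) ^ k) (k + q * (n - k))) + monom 1 n)"
    by (simp add: f_def w_def mult.commute)
  have less: "k + q * (n - k) < 1 + q * n'" if k: "k \<in> {2..n}" for k
  proof -
    have "2 \<le> k" using k by simp
    then obtain i where i: "k = Suc (Suc i)" using le_Suc_ex[of 2 k] by auto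
    obtain j where j: "n = k + j" using k le_Suc_ex[of k n] by auto
    have "n' = Suc i + j" using n' i j by simp
    moreover have "Suc (Suc i) < 1 + q * Suc i"
    proof -
      have "2 * Suc i \<le> q * Suc i" using q by (intro mult_le_mono1) simp
      then show ?thesis by simp
    qed
    ultimately show ?thesis using i j by (simp add: algebra_simps)
  qed
  have "degree (\<Sum>k=2..n. monom (of_nat (n choose k) * (-1) ^ k :: 'k) (k + q * (n - k))) < 1 + q * n'"
  proof (rule degree_sum_less)
    fix k assume "k \<in> {2..n}"
    then show "degree (monom (of_nat (n choose k) * (-1) ^ k :: 'k) (k + q * (n - k))) < 1 + q * n'"
      using less[of k] degree_monom_le le_less_trans by blast
  qed simp
  moreover have "degree (monom (1::'k) n) < 1 + q * n'"
    using less[of n] n(2) by (simp add: degree_monom_eq)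
  moreover have "(of_nat n :: 'k) \<noteq> 0" using n(1) by (simp add: of_nat_eq_0_iff_char_dvd char_p)
  then have "degree (monom (- of_nat n :: 'k) (1 + q * n')) = 1 + q * n'"
    by (intro degree_monom_eq) simp
  ultimately have "degree f = 1 + q * n'"
    unfolding fA by (subst degree_add_eq_left) (auto intro!: degree_add_less)
  moreover have "d \<in> as_translations p f" if "d ^ p ^ e = d" for d
  proof -
    have "shift d A = A"
      using shift_monom_q[of d 1 e] shift_monom_q[of d 1 0] that
      by (simp add: A_def shift_diff q_def)
    then have "shift d f - f = w - shift d w"
      by (simp add: f_def shift_diff shift_power)
    moreover have "w - shift d w \<in> as_image p" using w by (intro as_image_diff as_image_shift)
    ultimately show ?thesis by (simp only: as_translations_def mem_Collect_eq)
  qed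
  ultimately show ?thesis using n' by (intro exI[of _ f]) (auto simp: q_def mult.commute)
qed

lemma card_fixed_power_q:
  assumes "e > 0"
  shows "card {d::'k. d ^ p ^ e = d} = p ^ e"
  using card_power_q_roots[OF assms, of "-1"] by (simp add: diff_eq_eq)

text \<open>For a prime q dividing the order, Sylow's theorem yields a nonzero x in S with q x = 0;
  in characteristic p this forces q = p.\<close>

lemma card_additive_subgroup:
  fixes S :: "'k set"
  assumes fin: "finite S" and 0: "0 \<in> S" and add: "\<And>x y. x \<in> S \<Longrightarrow> y \<in> S \<Longrightarrow> x + y \<in> S"
    and uminus: "\<And>x. x \<in> S \<Longrightarrow> - x \<in> S"
  shows "\<exists>n. card S = p ^ n"
proof -
  define G where "G = \<lparr>carrier = S, monoid.mult = (+), one = (0::'k)\<rparr>"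
  interpret group G
    by (rule groupI) (auto simp: G_def 0 add add.assoc intro!: bexI[OF _ uminus])
  have pow: "x [^]\<^bsub>G\<^esub> (n::nat) = of_nat n * x" if "x \<in> S" for x n
    by (induction n) (simp_all add: G_def nat_pow_def algebra_simps)
  have "q = p" if q: "prime q" "q dvd card S" for q
  proof -
    obtain c where c: "Coset.order G = q ^ 1 * c" using q(2) by (auto simp: Coset.order_def G_def)
    obtain H where H: "subgroup H G" "card H = q ^ 1"
      using sylow_thm[OF q(1) is_group c] fin by (auto simp: G_def)
    have "card H > 1" using H that(1) prime_gt_1_nat by simp
    have "\<not> H \<subseteq> {0}"
    proof
      assume "H \<subseteq> {0}"
      then have "card H \<le> card {0::'k}" by (intro card_mono) auto
      with \<open>card H > 1\<close> show False by simp
    qed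
    then obtain x where x: "x \<in> H" "x \<noteq> 0" by blast
    have HS: "H \<subseteq> S" using subgroup.subset[OF H(1)] by (simp add: G_def)
    then have xS: "x \<in> S" using x by auto
    interpret H: group "G\<lparr>carrier := H\<rparr>" using H(1) subgroup_imp_group by blast
    have "x [^]\<^bsub>G\<lparr>carrier := H\<rparr>\<^esub> Coset.order (G\<lparr>carrier := H\<rparr>) = \<one>\<^bsub>G\<lparr>carrier := H\<rparr>\<^esub>"
      using H.pow_order_eq_1 x by simp
    then have "x [^]\<^bsub>G\<^esub> q = 0"
      using H(2) by (simp add: Coset.order_def G_def nat_pow_def)
    then have "(of_nat q :: 'k) = 0" using pow[OF xS, of q] x(2) by simp
    then have "p dvd q" by (simp add: of_nat_eq_0_iff_char_dvd char_p)
    then show ?thesis using primes_dvd_imp_eq[OF prime_p q(1)] by simp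
  qed
  moreover have "card S > 0" using fin 0 card_gt_0_iff by blast
  ultimately have "prime_factors (card S) \<subseteq> {p}" by (auto simp: prime_factors_dvd)
  then have "(\<Prod>q\<in>prime_factors (card S). q ^ multiplicity q (card S))
      = (\<Prod>q\<in>{p}. q ^ multiplicity q (card S))"
    by (intro prod.mono_neutral_left) (auto simp: prime_factors_multiplicity prime_p)
  moreover have "(\<Prod>q\<in>prime_factors (card S). q ^ multiplicity q (card S)) = card S"
    using \<open>card S > 0\<close> prod_prime_factors[of "card S"] by simp
  ultimately show ?thesis by auto
qed

section \<open>Normal form when there are many translations\<close>

lemma shift_linearised_coeff:
  fixes c :: "nat \<Rightarrow> 'k"
  assumes "u \<noteq> 0" "\<And>i. u \<noteq> p ^ i"
  shows "coeff (shift d (\<Sum>i\<le>s. monom (c i) (1 + p ^ i)) - (\<Sum>i\<le>s. monom (c i) (1 + p ^ i))) u = 0"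
proof -
  have "u \<noteq> 1" using assms(2)[of 0] by simp
  \<comment> \<open>Translating X^(1 + p^i) affects only the coefficients at 0, 1 and p^i.\<close>
  have "coeff (shift d (monom (c i) (1 + p ^ i)) - monom (c i) (1 + p ^ i)) u = 0" for i
    unfolding shift_monom_Suc_q using assms(1) assms(2)[of i] \<open>u \<noteq> 1\<close>
    by (auto simp: coeff_pCons split: nat.splits)
  then show ?thesis
    unfolding shift_sum sum_subtractf[symmetric] coeff_sum by simp
qed

text \<open>Otherwise let n > 1 be the degree of the remainder f0 and write n = 1 + l p^r. Then r <
  s, and l > 1 because the exponents 1 + p^i with i at most s have been split off. The condition at
  t = 1 + (l - 1) p^r is not influenced by the split part and leaves at most p^r < p^s
  translations.\<close>

lemma linearised_part:
  fixes f :: "'k poly"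
  assumes red: "\<And>i. p dvd i \<Longrightarrow> coeff f i = 0" and deg: "degree f = 1 + p ^ s"
    and card: "card (as_translations p f) \<ge> p ^ s"
  defines "c \<equiv> \<lambda>i. coeff f (1 + p ^ i)"
  shows "f = (\<Sum>i\<le>s. monom (c i) (1 + p ^ i)) + monom (coeff f 1) 1"
proof -
  define S where "S = (\<Sum>i\<le>s. monom (c i) (1 + p ^ i))"
  define f0 where "f0 = f - S"
  have inj: "p ^ i = p ^ j \<longleftrightarrow> i = j" for i j
    using p_gt_1 by simp
  have S1: "coeff S (1 + p ^ j) = coeff f (1 + p ^ j)" if "j \<le> s" for j
  proof -
    have "coeff S (1 + p ^ j) = (\<Sum>i\<le>s. if i = j then c i else 0)"
      unfolding S_def coeff_sum by (intro sum.cong refl) (auto simp: inj)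
    then show ?thesis using that by (simp add: c_def)
  qed
  have S2: "coeff S n = 0" if "\<And>j. j \<le> s \<Longrightarrow> n \<noteq> 1 + p ^ j" for n
    unfolding S_def coeff_sum using that by (intro sum.neutral) auto
  have deg0: "degree f0 < 1 + p ^ s"
  proof (rule degree_lessI)
    show "\<forall>k\<ge>1 + p ^ s. coeff f0 k = 0"
    proof (intro allI impI)
      fix k assume k: "k \<ge> 1 + p ^ s"
      show "coeff f0 k = 0"
      proof (cases "k = 1 + p ^ s")
        case True
        then show ?thesis using S1[of s] by (simp add: f0_def)
      next
        case False
        have "p ^ j \<le> p ^ s" if "j \<le> s" for j
          using that p_pos by (intro power_increasing) auto
        then have "coeff S k = 0" using k False by (intro S2) fastforce
        moreover have "coeff f k = 0" using k False deg by (intro coeff_eq_0) auto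
        ultimately show ?thesis by (simp add: f0_def)
      qed
    qed
  qed simp
  have "degree f0 \<le> 1"
  proof (rule ccontr)
    assume n2: "\<not> degree f0 \<le> 1"
    define n where "n = degree f0"
    have "coeff f0 n \<noteq> 0" using n2 by (auto simp: n_def)
    have nform: "n \<noteq> 1 + p ^ j" if "j \<le> s" for j
      using S1[OF that] \<open>coeff f0 n \<noteq> 0\<close> by (auto simp: f0_def)
    then have "coeff f n \<noteq> 0" using S2[of n] \<open>coeff f0 n \<noteq> 0\<close> by (auto simp: f0_def)
    then have pn: "\<not> p dvd n" using red by blast
    have "n - 1 \<noteq> 0" using n2 n_def by simp
    then obtain l r where lr: "n - 1 = l * p ^ r" "\<not> p dvd l"
      using prime_power_canonical[OF prime_p, of "n - 1"] by blast
    have nl: "n = 1 + l * p ^ r" using lr(1) \<open>n - 1 \<noteq> 0\<close> by linarith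
    have "l > 0" using lr(2) by (cases l) auto
    have "p ^ r \<le> n - 1" using nl \<open>l > 0\<close> by simp
    also have "\<dots> < p ^ s" using deg0 \<open>n - 1 \<noteq> 0\<close> n_def by simp
    finally have rs: "p ^ r < p ^ s" .
    then have "r < s" using p_gt_1 by (simp add: power_strict_increasing_iff)
    then have "l \<noteq> 1" using nform[of r] nl by auto
    with \<open>l > 0\<close> have l2: "l \<ge> 2" by simp
    define t where "t = 1 + (l - 1) * p ^ r"
    have t: "\<not> p dvd t" using not_dvd_exponent[OF lr(2), of r] \<open>l > 0\<close> by (simp add: t_def)
    have "t > 1" using l2 p_pos by (simp add: t_def)
    have tp: "n \<le> t * p" using l_ge_2_exponent[OF l2, of r] nl by (simp add: t_def)
    \<comment> \<open>This separates the exponents t p^j from the exponents p^i at which a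
      translation changes S.\<close>
    have not_pow: "t * p ^ j \<noteq> p ^ i" for i j
    proof
      assume *: "t * p ^ j = p ^ i"
      then have "t dvd p ^ i" by (metis dvd_triv_left)
      then obtain k where "t = p ^ k" using divides_primepow_nat[OF prime_p] by blast
      with t \<open>t > 1\<close> show False by (cases k) auto
    qed
    have "as_translations p f \<subseteq> {d. coeff (shift d f0) t = coeff f0 t}"
    proof
      fix d assume d: "d \<in> as_translations p f"
      have split: "shift d f - f = (shift d S - S) + (shift d f0 - f0)"
        by (simp add: f0_def shift_diff)
      have "coeff (shift d f - f) t = 0"
      proof (rule as_image_coeff_eq_0)
        show "shift d f - f \<in> as_image p" using d by (simp add: as_translations_def)
        show "\<not> p dvd t" by fact
        fix j :: nat assume "j > 0"
        have "coeff (shift d S - S) (t * p ^ j) = 0"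
          unfolding S_def using \<open>t > 1\<close> p_pos not_pow by (intro shift_linearised_coeff) auto
        moreover have "coeff (shift d f0 - f0) (t * p ^ j) = 0"
        proof (rule coeff_eq_0)
          have "p \<le> p ^ j" using p_gt_1 \<open>j > 0\<close> by (metis One_nat_def Suc_leI less_imp_le power_increasing power_one_right)
          then have "n \<le> t * p ^ j" using tp by (meson mult_le_mono2 le_trans)
          then show "degree (shift d f0 - f0) < t * p ^ j"
            using degree_shift_diff[of f0 d] n2 n_def by simp
        qed
        ultimately show "coeff (shift d f - f) (t * p ^ j) = 0" unfolding split by simp
      qed
      moreover have "coeff (shift d S - S) t = 0"
        unfolding S_def using \<open>t > 1\<close> not_pow[of 0] by (intro shift_linearised_coeff) auto
      ultimately have "coeff (shift d f0 - f0) t = 0" unfolding split by simp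
      then show "d \<in> {d. coeff (shift d f0) t = coeff f0 t}" by simp
    qed
    then have "card (as_translations p f) \<le> card {d. coeff (shift d f0) t = coeff f0 t}"
      using shift_coeff_fixed_card(1)[of f0 l r] nl lr(2) pn by (intro card_mono) (simp_all add: t_def n_def)
    also have "\<dots> \<le> p ^ r"
      using shift_coeff_fixed_card(2)[of f0 l r] nl lr(2) pn by (simp add: t_def n_def)
    finally show False using rs card by simp
  qed
  moreover have "coeff f0 0 = 0"
    using red[of 0] S2[of 0] by (simp add: f0_def)
  moreover have "coeff f0 1 = coeff f 1"
    using S2[of 1] p_pos by (simp add: f0_def)
  ultimately have "f0 = monom (coeff f 1) 1"
  proof (intro poly_eqI)
    fix i assume a: "degree f0 \<le> 1" "coeff f0 0 = 0" "coeff f0 1 = coeff f 1"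
    show "coeff f0 i = coeff (monom (coeff f 1) 1) i"
    proof (cases "i \<le> 1")
      case True
      then have "i = 0 \<or> i = 1" by auto
      then show ?thesis using a by auto
    next
      case False
      then show ?thesis using a(1) by (auto simp: coeff_eq_0)
    qed
  qed
  then have "f - S = monom (coeff f 1) 1" by (simp only: f0_def)
  then show ?thesis unfolding S_def by (simp add: diff_eq_eq add.commute)
qed

text \<open>Moving X by a produces the linear coefficient T = R(a) + e + sum of (c_i a)^(1/p^i),
  once every c_i a X^(p^i) has been replaced by its p^i-th root times X. The polynomial P evaluates
  at a to T^(p^s), which is free of roots; having positive degree, it has a zero.\<close>

lemma translate_linear_term:
  fixes c :: "nat \<Rightarrow> 'k"
  assumes cs: "c s \<noteq> 0" and ps: "\<not> p dvd 1 + p ^ s"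
  shows "\<exists>a. shift a ((\<Sum>i\<le>s. monom (c i) (1 + p ^ i)) + monom e 1)
     - (\<Sum>i\<le>s. monom (c i) (1 + p ^ i)) \<in> as_image p"
proof -
  define R where "R = (\<Sum>i\<le>s. monom (c i) (p ^ i))"
  define P where "P = (R + [:e:]) ^ p ^ s + (\<Sum>i\<le>s. [:0, c i:] ^ p ^ (s - i))"
  have "degree P > 0"
  proof -
    have "coeff P (p ^ s * p ^ s) \<noteq> 0 \<and> p ^ s * p ^ s > 0"
    proof (cases "s = 0")
      case True
      \<comment> \<open>For s = 0 the coefficient in question is 2 c_0, so characteristic 2 has to
        be ruled out; the hypothesis on 1 + p^s does this.\<close>
      have "\<not> p dvd 2" using ps True by (simp add: numeral_2_eq_2)
      then have "(of_nat 2 :: 'k) \<noteq> 0" by (simp only: of_nat_eq_0_iff_char_dvd char_p not_False_eq_True)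
      then have "(2::'k) \<noteq> 0" by simp
      moreover have "coeff P 1 = 2 * c 0" using True p_pos by (simp add: P_def R_def)
      ultimately show ?thesis using cs True by simp
    next
      case False
      \<comment> \<open>For s > 0 the exponent p^(2s) arises only from R^(p^s), with coefficient
        c_s^(p^s).\<close>
      then have q: "p ^ s > 1" using p_gt_1 by (simp add: one_less_power del: One_nat_def)
      have "degree ([:0, c i:] ^ p ^ (s - i)) \<le> p ^ (s - i)" for i
      proof -
        have "degree ([:0, c i:] ^ p ^ (s - i)) \<le> degree [:0, c i:] * p ^ (s - i)"
          by (rule degree_power_le)
        also have "\<dots> \<le> 1 * p ^ (s - i)" by (intro mult_le_mono1) simp
        finally show ?thesis by simp
      qed
      moreover have "p ^ (s - i) \<le> p ^ s" for i using p_pos by (intro power_increasing) auto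
      moreover have "p ^ s < p ^ s * p ^ s" using q p_pos by simp
      ultimately have "coeff ([:0, c i:] ^ p ^ (s - i)) (p ^ s * p ^ s) = 0" for i
        by (meson coeff_eq_0 le_less_trans)
      then have "coeff P (p ^ s * p ^ s) = coeff ((R + [:e:]) ^ p ^ s) (p ^ s * p ^ s)"
        by (simp add: P_def coeff_sum)
      also have "(R + [:e:]) ^ p ^ s = (\<Sum>i\<le>s. monom (c i ^ p ^ s) (p ^ i * p ^ s)) + [:e ^ p ^ s:]"
      proof -
        have "R ^ p ^ s = (\<Sum>i\<le>s. monom (c i) (p ^ i) ^ p ^ s)"
          unfolding R_def by (rule freshmans_dream_sum') (simp_all only: char_poly_p prime_p)
        then show ?thesis by (simp add: power_q_add_poly poly_const_pow monom_power)
      qed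
      also have "coeff \<dots> (p ^ s * p ^ s) = (\<Sum>i\<le>s. if i = s then c i ^ p ^ s else 0)"
      proof -
        have "coeff [:e ^ p ^ s:] (p ^ s * p ^ s) = 0"
          using p_pos by (intro coeff_eq_0) simp
        moreover have "p ^ i * p ^ s = p ^ s * p ^ s \<longleftrightarrow> i = s" for i
          using p_gt_1 by simp
        ultimately show ?thesis by (simp only: coeff_add coeff_sum coeff_monom) simp
      qed
      finally show ?thesis using cs p_pos by simp
    qed
    then show ?thesis by (metis le_degree less_le_trans)
  qed
  then obtain a where a: "poly P a = 0" using alg_closed_imp_poly_has_root by blast
  have "\<forall>i. \<exists>b. b ^ p ^ i = c i * a" using ex_root_p by blast
  then obtain root where root: "\<And>i. root i ^ p ^ i = c i * a" by metis
  define T where "T = poly R a + e + (\<Sum>i\<le>s. root i)"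
  have "T ^ p ^ s = (poly R a + e) ^ p ^ s + (\<Sum>i\<le>s. root i ^ p ^ s)"
    by (simp add: T_def power_q_add power_q_sum)
  also have "(\<Sum>i\<le>s. root i ^ p ^ s) = (\<Sum>i\<le>s. (c i * a) ^ p ^ (s - i))"
  proof (intro sum.cong refl)
    fix i assume "i \<in> {..s}"
    then have "p ^ s = p ^ i * p ^ (s - i)" by (simp flip: power_add)
    then show "root i ^ p ^ s = (c i * a) ^ p ^ (s - i)"
      by (simp only: power_mult root)
  qed
  also have "(poly R a + e) ^ p ^ s + (\<Sum>i\<le>s. (c i * a) ^ p ^ (s - i)) = poly P a"
    by (simp add: P_def poly_power poly_sum mult.commute)
  finally have T: "T = 0" using a by simp
  define S where "S = (\<Sum>i\<le>s. monom (c i) (1 + p ^ i))"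
  define w where "w i = monom (c i * a) (p ^ i) - monom (root i) 1" for i
  define C where "C = e * a + (\<Sum>i\<le>s. c i * a * a ^ p ^ i)"
  have "shift a S = S + (\<Sum>i\<le>s. monom (c i * a) (p ^ i)) + (\<Sum>i\<le>s. monom (c i * a ^ p ^ i) 1)
     + (\<Sum>i\<le>s. [:c i * a * a ^ p ^ i:])"
    unfolding S_def shift_sum shift_monom_Suc_q by (simp only: sum.distrib)
  moreover have "(\<Sum>i\<le>s. monom (c i * a) (p ^ i)) = (\<Sum>i\<le>s. w i) + monom (\<Sum>i\<le>s. root i) 1"
    by (simp add: w_def sum_subtractf monom_sum)
  moreover have "(\<Sum>i\<le>s. monom (c i * a ^ p ^ i) 1) = monom (poly R a) 1"
    by (simp add: R_def poly_sum poly_monom monom_sum)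
  moreover have "(\<Sum>i\<le>s. [:c i * a * a ^ p ^ i:]) = [:\<Sum>i\<le>s. c i * a * a ^ p ^ i:]"
    by (induction s) auto
  moreover have "shift a (monom e 1) = monom e 1 + [:e * a:]"
    using shift_monom_q[of a e 0] by simp
  ultimately have "shift a (S + monom e 1) - S = (\<Sum>i\<le>s. w i) + [:C:] + monom T 1"
    by (simp add: shift_add T_def C_def add_monom[symmetric])
  moreover have "(\<Sum>i\<le>n. w i) \<in> as_image p" for n
  proof (induction n)
    case 0
    then show ?case using monom_q_equiv[of "root 0" 0] root[of 0] by (simp add: w_def)
  next
    case (Suc n)
    then show ?case using monom_q_equiv[of "root (Suc n)" "Suc n"]
      by (simp only: sum.atMost_Suc w_def root as_image_add)
  qed
  ultimately have "shift a (S + monom e 1) - S \<in> as_image p"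
    using as_image_add[OF _ as_image_const] by (simp add: T)
  then show ?thesis unfolding S_def by blast
qed

text \<open>The part S with exponents 1 + p^i is X times an additive polynomial, so only the linear
  term of the reduced form stands in the way, and a translation absorbs it modulo the image.\<close>

lemma as_normal_form:
  fixes f :: "'k poly"
  assumes deg: "degree f = 1 + p ^ s" and pm: "\<not> p dvd degree f"
    and card: "card (as_translations p f) \<ge> p ^ s"
  shows "\<exists>a h R. additive_poly R \<and> pcompose f [:a, 1:] = [:0, 1:] * R + (h ^ p - h)"
proof -
  obtain g where g': "f - g \<in> as_image p" "as_translations p g = as_translations p f" "degree g = degree f"
    "lead_coeff g = lead_coeff f" "\<And>i. p dvd i \<Longrightarrow> coeff g i = 0"
    using ex_reduced[OF pm] by blast
  define w where "w = f - g"
  have w: "w \<in> as_image p" using g'(1) by (simp add: w_def)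
  have lf: "lead_coeff f \<noteq> 0" using pm by auto
  define c where "c i = coeff g (1 + p ^ i)" for i
  define S where "S = (\<Sum>i\<le>s. monom (c i) (1 + p ^ i))"
  have g: "g = S + monom (coeff g 1) 1"
    unfolding S_def c_def
  proof (rule linearised_part)
    show "coeff g i = 0" if "p dvd i" for i using g'(5) that .
    show "degree g = 1 + p ^ s" using g'(3) deg by simp
    show "p ^ s \<le> card (as_translations p g)" using card g'(2) by simp
  qed
  have "c s \<noteq> 0" using lf g'(3,4) deg by (simp add: c_def)
  then obtain a where "shift a (S + monom (coeff g 1) 1) - S \<in> as_image p"
    using translate_linear_term[of c s "coeff g 1"] pm unfolding deg S_def by blast
  then have "shift a g - S \<in> as_image p" using g by metis
  then have "(shift a g - S) + shift a w \<in> as_image p"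
    using w by (intro as_image_add as_image_shift)
  moreover have "(shift a g - S) + shift a w = shift a f - S"
    by (simp add: w_def shift_diff)
  ultimately obtain h' where "shift a f - S = h' ^ p - h'" by (auto simp: as_image_def)
  moreover have "S = [:0, 1:] * (\<Sum>i\<le>s. monom (c i) (p ^ i))"
    by (simp add: S_def sum_distrib_left monom_Suc)
  moreover have "additive_poly (\<Sum>i\<le>s. monom (c i) (p ^ i))"
    unfolding additive_poly_def char_p by blast
  ultimately have "pcompose f [:a, 1:] = [:0, 1:] * (\<Sum>i\<le>s. monom (c i) (p ^ i)) + (h' ^ p - h')"
    unfolding shift_def by (simp only: diff_eq_eq add.commute)
  with \<open>additive_poly _\<close> show ?thesis by blast
qed

end

section \<open>Existence of valuation rings\<close>

lemma is_subring_UNIV: "is_subring UNIV"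
  by (simp add: is_subring_def)

lemma is_subfield_UNIV: "is_subfield UNIV"
  by (simp add: is_subfield_def is_subring_UNIV)

context
  fixes A :: "'a::field set"
  assumes A: "is_subring A"
begin

lemma subring_0: "0 \<in> A" and subring_1: "1 \<in> A"
  using A by (auto simp: is_subring_def)

lemma subring_add: "x \<in> A \<Longrightarrow> y \<in> A \<Longrightarrow> x + y \<in> A"
  and subring_mult: "x \<in> A \<Longrightarrow> y \<in> A \<Longrightarrow> x * y \<in> A"
  and subring_uminus: "x \<in> A \<Longrightarrow> - x \<in> A"
  using A by (auto simp: is_subring_def)

lemma subring_diff: "x \<in> A \<Longrightarrow> y \<in> A \<Longrightarrow> x - y \<in> A"
  unfolding diff_conv_add_uminus by (intro subring_add subring_uminus)

lemma subring_power: "x \<in> A \<Longrightarrow> x ^ n \<in> A"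
  by (induction n) (auto intro: subring_1 subring_mult)

lemma subring_sum: "(\<And>i. i \<in> I \<Longrightarrow> g i \<in> A) \<Longrightarrow> sum g I \<in> A"
  by (induction I rule: infinite_finite_induct) (auto intro: subring_0 subring_add)

lemma subring_poly:
  assumes "\<And>i. coeff q i \<in> A" "x \<in> A"
  shows "poly q x \<in> A"
  unfolding poly_altdef using assms by (intro subring_sum subring_mult subring_power)

end

section \<open>Chevalley's construction of valuation rings\<close>

definition adjoin :: "'a::field set \<Rightarrow> 'a \<Rightarrow> 'a set" where
  "adjoin R z = {poly q z | q. \<forall>i. coeff q i \<in> R}"

lemma is_subring_adjoin:
  assumes R: "is_subring R"
  shows "is_subring (adjoin R z)"
  unfolding is_subring_def
proof (intro conjI ballI)
  have "poly 0 z \<in> adjoin R z" unfolding adjoin_def by (auto intro!: exI[of _ 0] simp: subring_0[OF R])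
  then show "0 \<in> adjoin R z" by simp
  have "poly 1 z \<in> adjoin R z" unfolding adjoin_def
    by (auto intro!: exI[of _ 1] simp: subring_0[OF R] subring_1[OF R] simp flip: of_bool_def)
  then show "1 \<in> adjoin R z" by simp
next
  fix x y assume "x \<in> adjoin R z" "y \<in> adjoin R z"
  then obtain q r where q: "x = poly q z" "\<forall>i. coeff q i \<in> R" and r: "y = poly r z" "\<forall>i. coeff r i \<in> R"
    by (auto simp: adjoin_def)
  have "x + y = poly (q + r) z" "\<forall>i. coeff (q + r) i \<in> R"
    using q r by (auto intro: subring_add[OF R])
  then show "x + y \<in> adjoin R z" unfolding adjoin_def by blast
  have "x * y = poly (q * r) z" "\<forall>i. coeff (q * r) i \<in> R"
    using q r by (auto simp: coeff_mult intro!: subring_sum[OF R] subring_mult[OF R])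
  then show "x * y \<in> adjoin R z" unfolding adjoin_def by blast
next
  fix x assume "x \<in> adjoin R z"
  then obtain q where q: "x = poly q z" "\<forall>i. coeff q i \<in> R" by (auto simp: adjoin_def)
  then have "- x = poly (- q) z" "\<forall>i. coeff (- q) i \<in> R" by (auto intro: subring_uminus[OF R])
  then show "- x \<in> adjoin R z" unfolding adjoin_def by blast
qed

lemma subset_adjoin:
  assumes R: "is_subring R"
  shows "R \<subseteq> adjoin R z"
proof
  fix r assume "r \<in> R"
  then have "r = poly [:r:] z" "\<forall>i. coeff [:r:] i \<in> R"
    using subring_0[OF R] by (auto simp: coeff_pCons split: nat.splits)
  then show "r \<in> adjoin R z" unfolding adjoin_def by blast
qed

lemma in_adjoin:
  assumes R: "is_subring R"
  shows "z \<in> adjoin R z"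
proof -
  have "z = poly [:0, 1:] z" "\<forall>i. coeff [:0, 1:] i \<in> R"
    using subring_0[OF R] subring_1[OF R] by (auto simp: coeff_pCons split: nat.splits)
  then show ?thesis unfolding adjoin_def by blast
qed

lemma adjoin_subset:
  assumes "is_subring R'" "R \<subseteq> R'" "z \<in> R'"
  shows "adjoin R z \<subseteq> R'"
  using assms subring_poly[of R'] unfolding adjoin_def by blast

text \<open>Maximality puts y into the Jacobson radical of R. If u = 1 - y r were not invertible,
  R[1/u] would contain 1/y; clearing denominators gives u^n = y a with a in R, whereas u^n = 1 - y
  b, so 1/y = a + b would lie in R.\<close>

lemma inverse_in_maximal_subring:
  fixes R L :: "'a::field set"
  assumes R: "is_subring R" "R \<subseteq> L" and L: "is_subfield L"
    and y: "y \<in> R" "inverse y \<notin> R"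
    and max: "\<And>R'. is_subring R' \<Longrightarrow> R \<subseteq> R' \<Longrightarrow> R' \<subseteq> L \<Longrightarrow> inverse y \<notin> R' \<Longrightarrow> R' = R"
    and r: "r \<in> R"
  shows "inverse (1 - y * r) \<in> R"
proof (rule ccontr)
  assume notin: "inverse (1 - y * r) \<notin> R"
  define u where "u = 1 - y * r"
  have y0: "y \<noteq> 0" using y subring_0[OF R(1)] by auto
  have uR: "u \<in> R" using y r by (auto simp: u_def intro: subring_diff subring_mult subring_1 R)
  have u0: "u \<noteq> 0" using notin subring_0[OF R(1)] by (auto simp: u_def)
  have upow: "\<exists>b\<in>R. u ^ n = 1 - y * b" for n
  proof (induction n)
    case 0
    then show ?case using subring_0[OF R(1)] by (intro bexI[of _ 0]) auto
  next
    case (Suc n)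
    then obtain b where b: "b \<in> R" "u ^ n = 1 - y * b" by blast
    have "u ^ Suc n = u * (1 - y * b)" by (simp add: b(2))
    also have "\<dots> = 1 - y * (r + b - r * (y * b))"
      by (simp add: u_def algebra_simps)
    finally have "u ^ Suc n = 1 - y * (r + b - r * (y * b))" .
    moreover have "r + b - r * (y * b) \<in> R"
      using b y r by (intro subring_diff subring_add subring_mult R)
    ultimately show ?case by blast
  qed
  have sL: "is_subring L" using L by (simp add: is_subfield_def)
  have "adjoin R (inverse u) \<subseteq> L"
    using uR R L by (intro adjoin_subset sL) (auto simp: is_subfield_def)
  moreover have "adjoin R (inverse u) \<noteq> R"
    using in_adjoin[OF R(1), of "inverse u"] notin by (auto simp: u_def)
  ultimately have "inverse y \<in> adjoin R (inverse u)"
    using max[of "adjoin R (inverse u)"] is_subring_adjoin[OF R(1)] subset_adjoin[OF R(1)] by blast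
  then obtain q where q: "inverse y = poly q (inverse u)" "\<forall>i. coeff q i \<in> R"
    by (auto simp: adjoin_def)
  define n where "n = degree q"
  define a where "a = (\<Sum>i\<le>n. coeff q i * u ^ (n - i))"
  have "u ^ n * inverse y = a"
    unfolding q(1) poly_altdef a_def n_def sum_distrib_left
    using u0 by (intro sum.cong refl) (auto simp: power_diff field_simps)
  then have "u ^ n = y * a" using y0 by (auto simp: field_simps)
  moreover obtain b where b: "b \<in> R" "u ^ n = 1 - y * b" using upow by blast
  ultimately have "inverse y = a + b" using y0 by (simp add: field_simps)
  moreover have "a \<in> R" unfolding a_def
    using q uR by (intro subring_sum subring_mult subring_power R) auto
  ultimately show False using b y(2) subring_add[OF R(1)] by simp
qed

text \<open>Two relations \<open>1 = \<Sum>i\<le>n. a\<^sub>i z\<^sup>i\<close> and \<open>1 = \<Sum>i\<le>n. b\<^sub>i z\<^sup>-\<^sup>i\<close> with coefficients in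
  \<open>y R\<close>, where \<open>1 + y R\<close> consists of units, combine into one of smaller degree.\<close>

lemma relation_descent:
  fixes R :: "'a::field set"
  assumes R: "is_subring R" and z: "z \<noteq> 0"
    and unit: "\<And>r. r \<in> R \<Longrightarrow> inverse (1 - y * r) \<in> R"
    and ynot: "\<And>r. r \<in> R \<Longrightarrow> y * r \<noteq> 1" and y: "y \<in> R"
    and a: "\<And>i. a i \<in> (*) y ` R" "(\<Sum>i\<le>Suc n. a i * z ^ i) = 1"
    and b: "\<And>i. b i \<in> (*) y ` R" "(\<Sum>i\<le>Suc n. b i * inverse z ^ i) = 1"
  shows "\<exists>c. (\<forall>i. c i \<in> (*) y ` R) \<and> (\<Sum>i\<le>n. c i * z ^ i) = 1"
proof -
  obtain r where r: "r \<in> R" "b 0 = y * r" using b(1) by blast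
  define u where "u = 1 - b 0"
  have u0: "u \<noteq> 0" using ynot[OF r(1)] by (simp add: u_def r(2))
  have uR: "inverse u \<in> R" using unit[OF r(1)] by (simp add: u_def r(2))
  \<comment> \<open>Multiplied by z^(n+1), the second relation expresses z^(n+1) through lower
    powers of z, as u = 1 - b_0 is invertible. Inserting this into the first relation gives the
    coefficients c.\<close>
  define c where "c i = a i + a (Suc n) * (b (Suc n - i) * inverse u)" for i
  have "u = (\<Sum>i\<le>n. b (Suc i) * inverse z ^ Suc i)"
    using b(2) unfolding sum.atMost_Suc_shift by (simp add: u_def algebra_simps)
  then have "u * z ^ Suc n = (\<Sum>i\<le>n. b (Suc i) * inverse z ^ Suc i * z ^ Suc n)"
    by (simp only: sum_distrib_right)
  also have "\<dots> = (\<Sum>i\<le>n. b (Suc i) * z ^ (n - i))"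
  proof (intro sum.cong refl)
    fix i assume "i \<in> {..n}"
    then have "z ^ Suc n = z ^ (n - i) * z ^ Suc i" by (simp only: power_add[symmetric]) simp
    moreover have "inverse z ^ Suc i * z ^ Suc i = 1"
      using z by (simp only: power_mult_distrib[symmetric]) simp
    ultimately show "b (Suc i) * inverse z ^ Suc i * z ^ Suc n = b (Suc i) * z ^ (n - i)"
      by (simp only: mult.assoc mult.left_commute[of _ "z ^ (n - i)"] mult_1_right) (rule mult.commute)
  qed
  also have "\<dots> = (\<Sum>i\<le>n. b (Suc n - i) * z ^ i)"
    by (rule sum.reindex_bij_witness[of _ "\<lambda>i. n - i" "\<lambda>i. n - i"]) (auto simp: Suc_diff_le)
  finally have "z ^ Suc n = (\<Sum>i\<le>n. b (Suc n - i) * z ^ i) * inverse u"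
    using u0 by (simp add: field_simps)
  then have zn: "z ^ Suc n = (\<Sum>i\<le>n. b (Suc n - i) * inverse u * z ^ i)"
    unfolding sum_distrib_right by (simp only: mult.assoc mult.commute[of _ "inverse u"])
  have "(\<Sum>i\<le>n. c i * z ^ i) = (\<Sum>i\<le>n. a i * z ^ i) + a (Suc n) * (\<Sum>i\<le>n. b (Suc n - i) * inverse u * z ^ i)"
    by (simp add: c_def distrib_right sum.distrib sum_distrib_left mult.assoc)
  also have "\<dots> = 1" using a(2) by (simp only: zn[symmetric] sum.atMost_Suc)
  finally have "(\<Sum>i\<le>n. c i * z ^ i) = 1" .
  moreover have "c i \<in> (*) y ` R" for i
  proof -
    obtain r1 r2 r3 where r: "r1 \<in> R" "a i = y * r1" "r2 \<in> R" "a (Suc n) = y * r2"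
        "r3 \<in> R" "b (Suc n - i) = y * r3"
      using a(1)[of i] a(1)[of "Suc n"] b(1)[of "Suc n - i"] by blast
    have "c i = y * (r1 + r2 * (y * r3 * inverse u))" by (simp add: c_def r algebra_simps)
    moreover have "r1 + r2 * (y * r3 * inverse u) \<in> R"
      using r uR y by (intro subring_add subring_mult R)
    ultimately show ?thesis by blast
  qed
  ultimately show ?thesis by blast
qed

text \<open>If z and 1/z are both missing, maximality forces 1/y into R[z] and into R[1/z], which
  yields relations for 1 with coefficients in y R in both directions. The descent ends with 1 in y
  R, contrary to 1/y not being in R.\<close>

lemma maximal_subring_valuation:
  fixes R L :: "'a::field set"
  assumes R: "is_subring R" "R \<subseteq> L" and L: "is_subfield L"
    and y: "y \<in> R" "inverse y \<notin> R"
    and max: "\<And>R'. is_subring R' \<Longrightarrow> R \<subseteq> R' \<Longrightarrow> R' \<subseteq> L \<Longrightarrow> inverse y \<notin> R' \<Longrightarrow> R' = R"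
    and z: "z \<in> L"
  shows "z \<in> R \<or> inverse z \<in> R"
proof (rule ccontr)
  assume notin: "\<not> (z \<in> R \<or> inverse z \<in> R)"
  then have z0: "z \<noteq> 0" using subring_0[OF R(1)] by auto
  have y0: "y \<noteq> 0" using y subring_0[OF R(1)] by auto
  define T where "T v n \<longleftrightarrow> (\<exists>c. (\<forall>i. c i \<in> (*) y ` R) \<and> (\<Sum>i\<le>n. c i * v ^ i) = 1)" for v n
  have sL: "is_subring L" using L by (simp add: is_subfield_def)
  have ex: "\<exists>d. \<forall>n\<ge>d. T v n" if "v \<in> L" "v \<notin> R" for v
  proof -
    have "adjoin R v \<subseteq> L" using that R by (intro adjoin_subset sL)
    moreover have "adjoin R v \<noteq> R" using in_adjoin[OF R(1), of v] that by auto
    ultimately have "inverse y \<in> adjoin R v"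
      using max[of "adjoin R v"] is_subring_adjoin[OF R(1)] subset_adjoin[OF R(1)] by blast
    then obtain q where q: "inverse y = poly q v" "\<forall>i. coeff q i \<in> R"
      by (auto simp: adjoin_def)
    \<comment> \<open>Padding with zero coefficients allows every larger n, so that both directions
      can start from a common degree.\<close>
    have "T v n" if "n \<ge> degree q" for n
    proof -
      have "poly q v = (\<Sum>i\<le>n. coeff q i * v ^ i)"
        unfolding poly_altdef using that by (intro sum.mono_neutral_left) (auto simp: coeff_eq_0)
      then have "(\<Sum>i\<le>n. y * coeff q i * v ^ i) = y * inverse y"
        unfolding q(1) by (simp add: sum_distrib_left mult.assoc)
      then show ?thesis unfolding T_def using q(2) y0 by (intro exI[of _ "\<lambda>i. y * coeff q i"]) auto
    qed
    then show ?thesis by blast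
  qed
  have zL: "inverse z \<in> L" using z L by (simp add: is_subfield_def)
  obtain d1 d2 where "\<forall>n\<ge>d1. T z n" "\<forall>n\<ge>d2. T (inverse z) n"
    using ex[OF z] ex[OF zL] notin by blast
  then have "T z (max d1 d2) \<and> T (inverse z) (max d1 d2)" by simp
  moreover have ynot: "y * r \<noteq> 1" if "r \<in> R" for r
    using that y(2) inverse_unique[of y r] by auto
  have step: "T v n" if v: "v \<noteq> 0" "T v (Suc n)" "T (inverse v) (Suc n)" for v n
    using v relation_descent[OF R(1) v(1) inverse_in_maximal_subring[OF R L y max] ynot y(1)]
    unfolding T_def by blast
  have "T z n \<and> T (inverse z) n \<Longrightarrow> T z 0" for n
  proof (induction n)
    case (Suc n)
    then show ?case using step[of z n] step[of "inverse z" n] z0 by simp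
  qed simp
  ultimately have "T z 0" by blast
  then obtain c where "\<forall>i. c i \<in> (*) y ` R" "c (0::nat) = 1" by (auto simp: T_def)
  then have "1 \<in> (*) y ` R" by metis
  then show False using ynot by (metis imageE)
qed

text \<open>Zorn's lemma for the subrings avoiding 1/y supplies a ring maximal in the sense of
  \<open>maximal_subring_valuation\<close>.\<close>

lemma ex_valuation_ring:
  fixes R0 L :: "'a::field set"
  assumes R0: "is_subring R0" "R0 \<subseteq> L" and L: "is_subfield L"
    and y: "y \<in> R0" "inverse y \<notin> R0"
  shows "\<exists>A. is_subring A \<and> R0 \<subseteq> A \<and> A \<subseteq> L \<and> inverse y \<notin> A \<and> (\<forall>z\<in>L. z \<in> A \<or> inverse z \<in> A)"
proof -
  define S where "S = {R. is_subring R \<and> R0 \<subseteq> R \<and> R \<subseteq> L \<and> inverse y \<notin> R}"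
  have "\<exists>N\<in>S. \<forall>Z\<in>S. N \<subseteq> Z \<longrightarrow> Z = N"
  proof (rule subset_Zorn_nonempty)
    show "S \<noteq> {}" using R0 y by (auto simp: S_def)
    fix C assume C: "C \<noteq> {}" "subset.chain S C"
    then have CS: "\<And>R. R \<in> C \<Longrightarrow> R \<in> S" by (auto simp: subset.chain_def)
    have dir: "\<exists>R\<in>C. a \<in> R \<and> b \<in> R" if ab: "a \<in> \<Union>C" "b \<in> \<Union>C" for a b
    proof -
      obtain R1 R2 where "R1 \<in> C" "a \<in> R1" "R2 \<in> C" "b \<in> R2" using ab by blast
      moreover have "R1 \<subseteq> R2 \<or> R2 \<subseteq> R1"
        using C(2) calculation by (auto simp: subset_chain_def)
      ultimately show ?thesis by blast
    qed
    have "is_subring (\<Union>C)"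
      unfolding is_subring_def
    proof (intro conjI ballI)
      obtain R where "R \<in> C" using C(1) by blast
      then show "0 \<in> \<Union>C" "1 \<in> \<Union>C" using CS[of R] subring_0[of R] subring_1[of R] by (auto simp: S_def)
    next
      fix a b assume "a \<in> \<Union>C" "b \<in> \<Union>C"
      then obtain R where "R \<in> C" "a \<in> R" "b \<in> R" using dir by blast
      then show "a + b \<in> \<Union>C" "a * b \<in> \<Union>C"
        using CS[of R] subring_add[of R a b] subring_mult[of R a b] by (auto simp: S_def)
    next
      fix a assume "a \<in> \<Union>C"
      then obtain R where "R \<in> C" "a \<in> R" by blast
      then show "- a \<in> \<Union>C" using CS[of R] subring_uminus[of R a] by (auto simp: S_def)
    qed
    moreover have "R0 \<subseteq> \<Union>C" using C(1) CS by (auto simp: S_def)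
    ultimately show "\<Union>C \<in> S" using CS by (auto simp: S_def)
  qed
  then obtain M where M: "M \<in> S" "\<And>Z. Z \<in> S \<Longrightarrow> M \<subseteq> Z \<Longrightarrow> Z = M" by blast
  have MS: "is_subring M" "R0 \<subseteq> M" "M \<subseteq> L" "inverse y \<notin> M" using M(1) by (auto simp: S_def)
  have "z \<in> M \<or> inverse z \<in> M" if "z \<in> L" for z
  proof (rule maximal_subring_valuation[OF MS(1,3) L _ MS(4) _ that])
    show "y \<in> M" using y MS by blast
    show "R' = M" if "is_subring R'" "M \<subseteq> R'" "R' \<subseteq> L" "inverse y \<notin> R'" for R'
      using that MS by (intro M(2)) (auto simp: S_def)
  qed
  then show ?thesis using MS by blast
qed

section \<open>Pole orders\<close>

definition vunits :: "'a::field set \<Rightarrow> 'a set" where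
  "vunits A = {z\<in>A. z \<noteq> 0 \<and> inverse z \<in> A}"

definition nonunits :: "'a::field set \<Rightarrow> 'a set" where
  "nonunits A = {z\<in>A. z = 0 \<or> inverse z \<notin> A}"

context
  fixes L :: "'a::field set"
  assumes L: "is_subfield L"
begin

lemma subfield_subring: "is_subring L"
  using L by (simp add: is_subfield_def)

lemmas subfield_closed =
  subring_0[OF subfield_subring] subring_1[OF subfield_subring] subring_add[OF subfield_subring]
  subring_mult[OF subfield_subring] subring_uminus[OF subfield_subring] subring_diff[OF subfield_subring]
  subring_power[OF subfield_subring]

lemma subfield_inverse: "z \<in> L \<Longrightarrow> inverse z \<in> L"
  using L by (simp add: is_subfield_def)

lemma subfield_divide: "y \<in> L \<Longrightarrow> z \<in> L \<Longrightarrow> y / z \<in> L"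
  unfolding divide_inverse by (intro subfield_closed subfield_inverse)

lemma subfield_power_int: "z \<in> L \<Longrightarrow> z powi n \<in> L"
  unfolding power_int_def by (simp add: subfield_closed subfield_inverse)

end

locale valuation =
  fixes L A :: "'a::field set"
  assumes subfield: "is_subfield L" and subring: "is_subring A" and subset: "A \<subseteq> L"
    and total: "z \<in> L \<Longrightarrow> z \<in> A \<or> inverse z \<in> A"
begin

lemmas A_closed = subring_0[OF subring] subring_1[OF subring] subring_add[OF subring]
  subring_mult[OF subring] subring_uminus[OF subring] subring_diff[OF subring] subring_power[OF subring]
lemmas L_closed = subfield_closed[OF subfield] subfield_inverse[OF subfield] subfield_divide[OF subfield]
  subfield_power_int[OF subfield]

lemma nonunits_subset: "nonunits A \<subseteq> A"
  by (auto simp: nonunits_def)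

lemma one_not_nonunit: "1 \<notin> nonunits A"
  by (auto simp: nonunits_def A_closed)

lemma vunits_iff: "z \<in> vunits A \<longleftrightarrow> z \<in> A \<and> z \<notin> nonunits A"
  by (auto simp: vunits_def nonunits_def)

lemma nonunits_mult:
  assumes "a \<in> A" "b \<in> nonunits A"
  shows "a * b \<in> nonunits A"
proof -
  have b: "b \<in> A" "b = 0 \<or> inverse b \<notin> A" using assms(2) by (auto simp: nonunits_def)
  have "a * b = 0 \<or> inverse (a * b) \<notin> A"
  proof (rule ccontr)
    assume *: "\<not> ?thesis"
    then have "a * inverse (a * b) \<in> A" using assms(1) by (intro A_closed) auto
    moreover have "a * inverse (a * b) = inverse b" using * by (simp add: field_simps)
    ultimately have "inverse b \<in> A" by metis
    then show False using b * by auto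
  qed
  then show ?thesis using b assms(1) by (auto simp: nonunits_def intro: A_closed)
qed

lemma nonunits_add:
  assumes "a \<in> nonunits A" "b \<in> nonunits A"
  shows "a + b \<in> nonunits A"
proof -
  have *: "a + b \<in> nonunits A" if "a \<in> nonunits A" "b \<in> nonunits A" "a * inverse b \<in> A" "b \<noteq> 0" for a b
  proof -
    have "(1 + a * inverse b) * b \<in> nonunits A"
      using that by (intro nonunits_mult A_closed(2,3))
    moreover have "(1 + a * inverse b) * b = a + b" using that(4) by (simp add: field_simps)
    ultimately show ?thesis by simp
  qed
  show ?thesis
  proof (cases "a = 0 \<or> b = 0")
    case True
    then show ?thesis using assms by auto
  next
    case False
    have "a * inverse b \<in> L"
      using assms nonunits_subset subset by (intro L_closed) auto
    then have "a * inverse b \<in> A \<or> inverse (a * inverse b) \<in> A" by (rule total)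
    moreover have "inverse (a * inverse b) = b * inverse a" using False by simp
    ultimately have "a * inverse b \<in> A \<or> b * inverse a \<in> A" by metis
    then show ?thesis
    proof
      assume "a * inverse b \<in> A"
      then show ?thesis using *[of a b] assms False by blast
    next
      assume "b * inverse a \<in> A"
      then have "b + a \<in> nonunits A" using *[of b a] assms False by blast
      then show ?thesis by (simp add: add.commute)
    qed
  qed
qed

lemma vunits_add_nonunit:
  assumes "u \<in> vunits A" "a \<in> nonunits A"
  shows "u + a \<in> vunits A"
proof (rule ccontr)
  assume "u + a \<notin> vunits A"
  moreover have "u + a \<in> A" using assms by (auto simp: vunits_def nonunits_def intro: A_closed)
  ultimately have "u + a \<in> nonunits A" by (simp add: vunits_iff)
  moreover have "- 1 * a \<in> nonunits A" using assms by (intro nonunits_mult A_closed)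
  ultimately have "(u + a) + - 1 * a \<in> nonunits A" by (rule nonunits_add)
  then show False using assms(1) by (simp add: vunits_iff)
qed

lemma vunits_1: "1 \<in> vunits A"
  by (simp add: vunits_def A_closed)

lemma vunits_mult: "a \<in> vunits A \<Longrightarrow> b \<in> vunits A \<Longrightarrow> a * b \<in> vunits A"
  by (auto simp: vunits_def intro: A_closed)

lemma vunits_inverse: "a \<in> vunits A \<Longrightarrow> inverse a \<in> vunits A"
  by (auto simp: vunits_def)

lemma vunits_power: "a \<in> vunits A \<Longrightarrow> a ^ n \<in> vunits A"
  by (induction n) (auto intro: vunits_1 vunits_mult)

text \<open>If z is not in A, then 1/z is a nonunit, and z^n in A would make 1 = z^n z^(-n) a
  nonunit.\<close>

lemma power_in_A_iff:
  assumes "z \<in> L" "n > 0"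
  shows "z ^ n \<in> A \<longleftrightarrow> z \<in> A"
proof
  assume zn: "z ^ n \<in> A"
  show "z \<in> A"
  proof (rule ccontr)
    assume z: "z \<notin> A"
    then have z0: "z \<noteq> 0" using A_closed by auto
    have iz: "inverse z \<in> nonunits A" using z z0 total[OF assms(1)] by (auto simp: nonunits_def)
    have "z ^ n * inverse z ^ (n - 1) \<in> A"
      using zn iz nonunits_subset by (intro A_closed(4)[OF zn] A_closed(7)) auto
    then have "z ^ n * inverse z ^ (n - 1) * inverse z \<in> nonunits A" using iz by (rule nonunits_mult)
    moreover have "z ^ n * inverse z ^ (n - 1) * inverse z = z ^ n * inverse z ^ n"
      using assms(2) by (cases n) (auto simp: mult_ac)
    also have "\<dots> = 1" using z0 by (simp flip: power_mult_distrib)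
    finally show False using one_not_nonunit by simp
  qed
qed (rule A_closed)

lemma vunits_of_power:
  assumes "z \<in> L" "n > 0" "z ^ n \<in> vunits A"
  shows "z \<in> vunits A"
proof -
  have "inverse z ^ n \<in> A" "z ^ n \<in> A" using assms by (auto simp: vunits_def power_inverse)
  then show ?thesis
    using power_in_A_iff[of z n] power_in_A_iff[of "inverse z" n] assms
    by (auto simp: vunits_def L_closed)
qed

end

text \<open>The pole order of \<open>z\<close> is read off from \<open>z\<^sup>p\<close>, which differs from a power of \<open>x\<close> by a unit,
  so that \<open>x\<close> has pole order \<open>p\<close>.\<close>

locale valuation_pole = valuation L A for L A :: "'a::field set" +
  fixes x :: 'a and p :: nat
  assumes x_L: "x \<in> L" and x_notin: "x \<notin> A" and p_positive: "p > 0"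
begin

text \<open>A relation rather than a function: discreteness of the valuation is not assumed, so an
  element has at most one pole order and may have none.\<close>

definition po :: "'a \<Rightarrow> int \<Rightarrow> bool" where
  "po z n \<longleftrightarrow> z \<in> L \<and> z \<noteq> 0 \<and> z ^ p * x powi (- n) \<in> vunits A"

lemma x_nz: "x \<noteq> 0"
  using x_notin A_closed by auto

lemma inverse_x: "inverse x \<in> A"
  using x_notin total x_L by blast

lemma power_int_x_in_A_iff: "x powi k \<in> A \<longleftrightarrow> k \<le> 0"
proof (cases "k \<le> 0")
  case True
  then have "x powi k = inverse x ^ nat (- k)" by (simp add: power_int_def)
  then show ?thesis using True inverse_x by (auto intro: A_closed)
next
  case False
  then have "x powi k = x ^ nat k" by (simp add: power_int_def)
  then show ?thesis using False x_notin power_in_A_iff[OF x_L, of "nat k"] by simp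
qed

lemma power_int_x_unit_iff: "x powi k \<in> vunits A \<longleftrightarrow> k = 0"
  using power_int_x_in_A_iff[of k] power_int_x_in_A_iff[of "- k"] x_nz
  by (auto simp: vunits_def power_int_minus)

lemma po_unique:
  assumes "po z a" "po z b"
  shows "a = b"
proof -
  have "inverse (z ^ p * x powi (- a)) * (z ^ p * x powi (- b)) \<in> vunits A"
    using vunits_mult[OF vunits_inverse] assms unfolding po_def by blast
  also have "inverse (z ^ p * x powi (- a)) * (z ^ p * x powi (- b)) = x powi (a - b)"
    using assms x_nz by (simp add: po_def power_int_minus power_int_diff field_simps)
  finally show ?thesis by (simp add: power_int_x_unit_iff)
qed

lemma po_in_A_iff:
  assumes "po z n"
  shows "z \<in> A \<longleftrightarrow> n \<le> 0"
proof -
  define u where "u = z ^ p * x powi (- n)"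
  have u: "u \<in> vunits A" "u \<in> A" "inverse u \<in> A" "u \<noteq> 0"
    using assms by (auto simp: po_def u_def vunits_def)
  have zp: "z ^ p = u * x powi n" using x_nz by (simp add: u_def power_int_minus)
  have "z \<in> A \<longleftrightarrow> z ^ p \<in> A"
    using power_in_A_iff[of z p] assms p_positive by (simp add: po_def)
  also have "\<dots> \<longleftrightarrow> x powi n \<in> A"
  proof
    assume "z ^ p \<in> A"
    then have "inverse u * z ^ p \<in> A" using u A_closed(4) by blast
    then show "x powi n \<in> A" unfolding zp using u by (simp add: mult.assoc[symmetric])
  qed (use zp u in \<open>auto intro: A_closed\<close>)
  finally show ?thesis by (simp add: power_int_x_in_A_iff)
qed

lemma po_mult:
  assumes "po y a" "po z b"
  shows "po (y * z) (a + b)"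
proof -
  have "(y ^ p * x powi (- a)) * (z ^ p * x powi (- b)) \<in> vunits A"
    using vunits_mult assms unfolding po_def by blast
  also have "x powi (- (a + b)) = x powi (- a) * x powi (- b)"
    using x_nz by (subst power_int_add[symmetric]) auto
  then have "(y ^ p * x powi (- a)) * (z ^ p * x powi (- b)) = (y * z) ^ p * x powi (- (a + b))"
    by (simp add: power_mult_distrib)
  finally show ?thesis using assms by (auto simp: po_def L_closed)
qed

lemma po_inverse:
  assumes "po z a"
  shows "po (inverse z) (- a)"
proof -
  have "inverse (z ^ p * x powi (- a)) \<in> vunits A"
    using assms by (intro vunits_inverse) (auto simp: po_def)
  also have "inverse (z ^ p * x powi (- a)) = inverse z ^ p * x powi (- (- a))"
    by (simp add: power_int_minus power_inverse)
  finally show ?thesis using assms by (auto simp: po_def L_closed)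
qed

lemma po_divide: "po y a \<Longrightarrow> po z b \<Longrightarrow> po (y / z) (a - b)"
  using po_mult[OF _ po_inverse, of y a z b] by (simp add: divide_inverse)

lemma po_nonunit_iff:
  assumes "po z n"
  shows "z \<in> nonunits A \<longleftrightarrow> n < 0"
  using po_in_A_iff[OF assms] po_in_A_iff[OF po_inverse[OF assms]] assms
  by (auto simp: nonunits_def po_def)

lemma po_unit: "z \<in> vunits A \<Longrightarrow> po z 0"
  using subset by (auto simp: po_def vunits_power) (auto simp: vunits_def)

lemma po_power: "po z n \<Longrightarrow> po (z ^ k) (int k * n)"
proof (induction k)
  case 0
  then show ?case using po_unit vunits_1 by simp
next
  case (Suc k)
  then show ?case using po_mult[of z n "z ^ k" "int k * n"] by (simp add: algebra_simps)
qed

lemma po_x: "po x (int p)"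
  using x_L x_nz by (simp add: po_def power_int_minus vunits_1)

text \<open>The sum is a (1 + b/a), where b/a is a nonunit.\<close>

lemma po_add:
  assumes "po a n" "b = 0 \<or> (\<exists>k<n. po b k)"
  shows "po (a + b) n"
proof (cases "b = 0")
  case True
  then show ?thesis using assms by simp
next
  case False
  then obtain k where k: "k < n" "po b k" using assms by blast
  have a0: "a \<noteq> 0" using assms by (simp add: po_def)
  have "b / a \<in> nonunits A" using po_nonunit_iff[OF po_divide[OF k(2) assms(1)]] k(1) by simp
  then have "po (1 + b / a) 0" by (intro po_unit vunits_add_nonunit vunits_1)
  then have "po (a * (1 + b / a)) (n + 0)" using assms by (intro po_mult)
  moreover have "a * (1 + b / a) = a + b" using a0 by (simp add: field_simps)
  ultimately show ?thesis by simp
qed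

text \<open>Terms of different pole orders cannot cancel, so the largest order survives.\<close>

lemma po_sum:
  assumes "finite I" "I \<noteq> {}" "\<And>i. i \<in> I \<Longrightarrow> po (t i) (n i)" "inj_on n I"
  shows "\<exists>i\<in>I. po (sum t I) (n i) \<and> (\<forall>j\<in>I. n j \<le> n i)"
  using assms
proof (induction I rule: finite_ne_induct)
  case (insert j I)
  obtain i where i: "i \<in> I" "po (sum t I) (n i)" "\<forall>j\<in>I. n j \<le> n i"
    using insert.IH insert.prems by (auto simp: inj_on_insert)
  have "n i \<noteq> n j" using insert i(1) by (auto simp: inj_on_def)
  then consider "n j < n i" | "n i < n j" by linarith
  then show ?case
  proof cases
    case 1
    have "po (sum t I + t j) (n i)"
      using 1 i insert.prems by (intro po_add) auto
    then show ?thesis using 1 i insert.hyps by (intro bexI[of _ i]) (auto simp: add.commute)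
  next
    case 2
    have "po (t j + sum t I) (n j)"
      using 2 i insert.prems by (intro po_add) auto
    then show ?thesis using 2 i insert.hyps by (intro bexI[of _ j]) (auto intro: order_trans)
  qed
qed auto

end

section \<open>Substitution into polynomials in one and two variables\<close>

lemma map_poly_add_hom:
  assumes "h 0 = 0" "\<And>a b. h (a + b) = h a + h b"
  shows "map_poly h (u + v) = map_poly h u + map_poly h v"
  by (rule poly_eqI) (simp add: coeff_map_poly assms)

lemma map_poly_mult_hom:
  fixes h :: "'a::comm_semiring_0 \<Rightarrow> 'b::comm_semiring_0"
  assumes "h 0 = 0" "\<And>a b. h (a + b) = h a + h b" "\<And>a b. h (a * b) = h a * h b"
  shows "map_poly h (u * v) = map_poly h u * map_poly h v"
proof (rule poly_eqI)
  have sum: "h (sum g I) = (\<Sum>i\<in>I. h (g i))" for g and I :: "nat set"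
    by (induction I rule: infinite_finite_induct) (simp_all add: assms)
  show "coeff (map_poly h (u * v)) n = coeff (map_poly h u * map_poly h v) n" for n
    by (simp add: coeff_map_poly coeff_mult assms sum)
qed

lemma emb_const_0 [simp]: "emb_const 0 = 0" and emb_const_1 [simp]: "emb_const 1 = 1"
  and emb_const_add: "emb_const (a + b) = emb_const a + emb_const b"
  and emb_const_mult: "emb_const (a * b) = emb_const a * emb_const b"
  and emb_const_uminus: "emb_const (- a) = - emb_const a"
  and emb_const_eq_0_iff [simp]: "emb_const a = 0 \<longleftrightarrow> a = 0"
proof -
  have [simp]: "to_fract [:1 :: 'x::field:] = 1" by (simp flip: one_pCons)
  have "[:a + b:] = [:a:] + [:b:]" "[:a * b:] = [:a:] * [:b:]" "[:- a:] = - [:a:]" "[:1::'a:] = 1" by simp_all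
  then show "emb_const 0 = 0" "emb_const 1 = 1" "emb_const (a + b) = emb_const a + emb_const b"
    "emb_const (a * b) = emb_const a * emb_const b" "emb_const (- a) = - emb_const a"
    "emb_const a = 0 \<longleftrightarrow> a = 0"
    unfolding emb_const_def emb_poly_def by (simp_all only: to_fract_add to_fract_mult to_fract_uminus
      to_fract_1 to_ac_add to_ac_mult to_ac_minus to_ac_1) simp_all
qed

lemma emb_const_inverse: "emb_const (inverse a) = inverse (emb_const a)"
proof (cases "a = 0")
  case False
  then have "emb_const a * emb_const (inverse a) = 1" by (simp flip: emb_const_mult)
  then show ?thesis by (simp add: inverse_unique)
qed simp

definition sub :: "'k::field rat_closure \<Rightarrow> 'k poly \<Rightarrow> 'k rat_closure" where
  "sub x g = poly (map_poly emb_const g) x"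

text \<open>A polynomial in X and W is stored as a polynomial in W with coefficients in k[X]; x
  replaces the inner variable and w the outer one.\<close>

definition ev :: "'k::field rat_closure \<Rightarrow> 'k rat_closure \<Rightarrow> 'k poly poly \<Rightarrow> 'k rat_closure" where
  "ev x w u = poly (map_poly (sub x) u) w"

lemma sub_0 [simp]: "sub x 0 = 0" and sub_1 [simp]: "sub x 1 = 1"
  and sub_add: "sub x (g + h) = sub x g + sub x h"
  and sub_mult: "sub x (g * h) = sub x g * sub x h"
  and sub_pCons: "sub x (pCons a g) = emb_const a + x * sub x g"
  by (simp_all add: sub_def map_poly_add_hom map_poly_mult_hom emb_const_add emb_const_mult map_poly_pCons)

lemma sub_const [simp]: "sub x [:a:] = emb_const a"
  by (simp add: sub_pCons)

lemma sub_uminus: "sub x (- g) = - sub x g"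
  using sub_add[of x g "- g"] by (simp add: eq_neg_iff_add_eq_0 add.commute)

lemma sub_diff: "sub x (g - h) = sub x g - sub x h"
  using sub_add[of x g "- h"] by (simp add: sub_uminus)

lemma sub_power: "sub x (g ^ n) = sub x g ^ n"
  by (induction n) (simp_all add: sub_mult)

lemma sub_smult: "sub x (smult a g) = emb_const a * sub x g"
  using sub_mult[of x "[:a:]" g] by simp

lemma sub_pcompose: "sub x (pcompose g h) = sub (sub x h) g"
  by (induction g) (simp_all add: pcompose_pCons sub_add sub_mult sub_pCons)

lemma ev_0 [simp]: "ev x w 0 = 0" and ev_1 [simp]: "ev x w 1 = 1"
  and ev_add: "ev x w (u + v) = ev x w u + ev x w v"
  and ev_mult: "ev x w (u * v) = ev x w u * ev x w v"
  and ev_pCons: "ev x w (pCons g u) = sub x g + w * ev x w u"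
  by (simp_all add: ev_def map_poly_add_hom map_poly_mult_hom sub_add sub_mult map_poly_pCons)

lemma ev_const [simp]: "ev x w [:g:] = sub x g"
  by (simp add: ev_pCons)

lemma ev_uminus: "ev x w (- u) = - ev x w u"
  using ev_add[of x w u "- u"] by (simp add: eq_neg_iff_add_eq_0 add.commute)

lemma ev_diff: "ev x w (u - v) = ev x w u - ev x w v"
  using ev_add[of x w u "- v"] by (simp add: ev_uminus)

lemma ev_power: "ev x w (u ^ n) = ev x w u ^ n"
  by (induction n) (simp_all add: ev_mult)

lemma ev_smult: "ev x w (smult g u) = sub x g * ev x w u"
  using ev_mult[of x w "[:g:]" u] by simp

lemma ev_pcompose: "ev x w (pcompose u v) = ev x (ev x w v) u"
  by (induction u) (simp_all add: pcompose_pCons ev_add ev_mult ev_pCons)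

lemma ev_altdef:
  assumes "degree u \<le> n"
  shows "ev x w u = (\<Sum>i\<le>n. sub x (coeff u i) * w ^ i)"
proof -
  have "ev x w u = (\<Sum>i\<le>degree (map_poly (sub x) u). coeff (map_poly (sub x) u) i * w ^ i)"
    by (simp add: ev_def poly_altdef)
  also have "\<dots> = (\<Sum>i\<le>n. coeff (map_poly (sub x) u) i * w ^ i)"
    using assms map_poly_degree_leq[of "sub x" u] by (intro sum.mono_neutral_left) (auto simp: coeff_eq_0)
  finally show ?thesis by (simp add: coeff_map_poly)
qed

lemma ev_map_const: "ev x w (map_poly (\<lambda>a. [:a:]) Q) = sub w Q"
  by (induction Q) (simp_all add: map_poly_pCons ev_pCons sub_pCons)

lemma sub_emb_poly: "sub (emb_poly [:0, 1:]) g = emb_poly g"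
proof (induction g)
  case 0
  then show ?case by (simp add: emb_poly_def)
next
  case (pCons a g)
  have "pCons a g = [:a:] + [:0, 1:] * g" by simp
  then have "emb_poly (pCons a g) = emb_poly [:a:] + emb_poly [:0, 1:] * emb_poly g"
    unfolding emb_poly_def by (simp only: to_fract_add to_fract_mult to_ac_add to_ac_mult)
  then show ?case using pCons by (simp add: sub_pCons emb_const_def)
qed

lemma emb_poly_eq_0_iff [simp]: "emb_poly g = 0 \<longleftrightarrow> g = 0"
  by (simp add: emb_poly_def)

section \<open>Pole orders of polynomials in x and w\<close>

locale curve_valuation = valuation_pole L A x p + alg_closed_char p K
  for L A :: "'k::alg_closed_field rat_closure set" and x p and K :: "'k itself" +
  assumes const_subset: "range emb_const \<subseteq> A"
begin

lemma emb_const_A: "emb_const a \<in> A"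
  using const_subset by auto

lemma emb_const_unit: "a \<noteq> 0 \<Longrightarrow> emb_const a \<in> vunits A"
  using emb_const_A[of a] emb_const_A[of "inverse a"] by (simp add: vunits_def emb_const_inverse)

lemma po_const: "a \<noteq> 0 \<Longrightarrow> po (emb_const a) 0"
  by (intro po_unit emb_const_unit)

lemma po_sub:
  assumes "g \<noteq> 0"
  shows "po (sub x g) (int (p * degree g))"
  using assms
proof (induction g)
  case (pCons a g)
  show ?case
  proof (cases "g = 0")
    case True
    then show ?thesis using pCons po_const by simp
  next
    case False
    then have "po (x * sub x g) (int p + int (p * degree g))" using pCons by (intro po_mult po_x)
    then have "po (x * sub x g + emb_const a) (int p + int (p * degree g))"
    proof (rule po_add)
      have "0 < int p + int (p * degree g)" using p_positive by linarith
      then show "emb_const a = 0 \<or> (\<exists>k<int p + int (p * degree g). po (emb_const a) k)"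
        using po_const[of a] by (cases "a = 0") auto
    qed
    then show ?thesis using False by (simp add: sub_pCons add.commute algebra_simps)
  qed
qed simp

lemma sub_L: "y \<in> L \<Longrightarrow> sub y g \<in> L"
  using subset emb_const_A by (induction g) (auto simp: sub_pCons intro!: L_closed)

text \<open>The pole of f(x) forces a pole of w, so in w^p - w = w^p (1 - w^(1-p)) the second factor
  is a unit. Thus w^p agrees with f(x), hence with x^(degree f), up to a unit.\<close>

lemma po_w:
  assumes w: "w \<in> L" "w ^ p - w = sub x f" and deg: "degree f > 0"
  shows "po w (int (degree f))"
proof -
  have pof: "po (sub x f) (int (p * degree f))" using deg by (intro po_sub) auto
  have "w \<notin> A"
  proof
    assume "w \<in> A"
    then have "w ^ p - w \<in> A" by (intro A_closed)
    then have "int (p * degree f) \<le> 0" using po_in_A_iff[OF pof] w(2) by simp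
    then show False using deg p_positive by (simp only: of_nat_le_0_iff) simp
  qed
  then have w0: "w \<noteq> 0" and iw: "inverse w \<in> nonunits A"
    using A_closed total[OF w(1)] by (auto simp: nonunits_def)
  define e where "e = 1 - inverse w ^ (p - 1)"
  have "inverse w ^ (p - 1) = inverse w ^ (p - 2) * inverse w"
    using p_gt_1 by (simp add: numeral_2_eq_2 power_Suc2[symmetric] Suc_diff_Suc del: power_Suc)
  moreover have "inverse w ^ (p - 2) * inverse w \<in> nonunits A"
    using iw nonunits_subset by (intro nonunits_mult A_closed) auto
  ultimately have "- 1 * inverse w ^ (p - 1) \<in> nonunits A"
    by (intro nonunits_mult A_closed) simp
  then have e: "e \<in> vunits A" unfolding e_def using vunits_add_nonunit[OF vunits_1] by fastforce
  have e0: "e \<noteq> 0" using e by (simp add: vunits_def)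
  have "w ^ p = w ^ (p - 1) * w" using p_gt_1 by (metis power_Suc2 Suc_diff_1 p_positive)
  then have fe: "sub x f = w ^ p * e"
    unfolding w(2)[symmetric] e_def using w0 by (simp add: field_simps)
  \<comment> \<open>The pole order of f(x) only controls its p-th power; since an element whose p-th
    power is a unit is itself a unit, f(x) can be compared with a power of x directly.\<close>
  define b where "b = sub x f * x powi (- int (degree f))"
  have "b ^ p = sub x f ^ p * x powi (- int (p * degree f))"
    by (simp add: b_def power_mult_distrib power_int_power' mult.commute)
  then have "b ^ p \<in> vunits A" using pof by (simp add: po_def)
  then have "b \<in> vunits A"
    using p_positive x_L by (intro vunits_of_power[of b p]) (auto simp: b_def intro!: L_closed sub_L)
  then have "b * inverse e \<in> vunits A" using e by (intro vunits_mult vunits_inverse)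
  moreover have "b * inverse e = w ^ p * x powi (- int (degree f))"
    using e0 by (simp add: b_def fe)
  ultimately show ?thesis using w w0 by (simp add: po_def)
qed

text \<open>The weighted degree of u(X, W), with weight p for X and m for W.\<close>

definition pole_number :: "nat \<Rightarrow> 'k poly poly \<Rightarrow> nat" where
  "pole_number m u = Max ((\<lambda>i. p * degree (coeff u i) + m * i) ` {i. coeff u i \<noteq> 0})"

text \<open>As m is invertible modulo p, the residue of the weighted degree modulo p determines i
  below p.\<close>

lemma pole_number_inj:
  assumes "\<not> p dvd m" "i < p" "j < p" "p * a + m * i = p * b + m * j"
  shows "i = j"
proof -
  have *: "\<not> i < j" if "j < p" "p * a + m * i = p * b + m * j" for i j a b :: nat
  proof
    assume "i < j"
    then obtain d where d: "j = i + d" "d > 0" using less_imp_add_positive by auto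
    then have "p * a = p * b + m * d" using that(2) by (simp add: algebra_simps)
    then have "p dvd m * d" by (metis dvd_add_right_iff dvd_triv_left)
    then have "p dvd d" using assms(1) prime_p by (simp add: prime_dvd_mult_iff)
    then show False using d that(1) by (auto dest: dvd_imp_le)
  qed
  show ?thesis using *[of j a i b] *[of i b j a] assms by (metis linorder_neqE_nat)
qed

lemma po_ev:
  assumes w: "po w (int m)" and m: "\<not> p dvd m" and u: "u \<noteq> 0" "degree u < p"
  shows "po (ev x w u) (int (pole_number m u))"
proof -
  define I where "I = {i. coeff u i \<noteq> 0}"
  define n where "n i = p * degree (coeff u i) + m * i" for i
  have I: "I \<subseteq> {..degree u}" by (auto simp: I_def intro: le_degree)
  then have fin: "finite I" using finite_subset by blast
  have ne: "I \<noteq> {}" using u(1) by (auto simp: I_def poly_eq_iff)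
  have "ev x w u = (\<Sum>i\<in>I. sub x (coeff u i) * w ^ i)"
    unfolding ev_altdef[OF order_refl] by (rule sum.mono_neutral_right) (use I in \<open>auto simp: I_def\<close>)
  moreover have "\<exists>i\<in>I. po (\<Sum>i\<in>I. sub x (coeff u i) * w ^ i) (int (n i)) \<and> (\<forall>j\<in>I. int (n j) \<le> int (n i))"
  proof (rule po_sum[OF fin ne])
    fix i assume "i \<in> I"
    then have "po (sub x (coeff u i) * w ^ i) (int (p * degree (coeff u i)) + int i * int m)"
      by (intro po_mult po_sub po_power w) (auto simp: I_def)
    then show "po (sub x (coeff u i) * w ^ i) (int (n i))" by (simp add: n_def mult.commute)
  next
    show "inj_on (\<lambda>i. int (n i)) I"
    proof (rule inj_onI)
      fix i j assume ij: "i \<in> I" "j \<in> I" "int (n i) = int (n j)"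
      then have "i < p" "j < p" using I u(2) by auto
      moreover have "n i = n j" using ij(3) by simp
      ultimately show "i = j" unfolding n_def by (rule pole_number_inj[OF m])
    qed
  qed
  then obtain i where i: "i \<in> I" "po (\<Sum>i\<in>I. sub x (coeff u i) * w ^ i) (int (n i))" "\<forall>j\<in>I. n j \<le> n i"
    by auto
  moreover have "pole_number m u = n i"
    unfolding pole_number_def I_def[symmetric] n_def[symmetric] using i fin by (intro Max_eqI) auto
  ultimately show ?thesis by simp
qed

lemma ev_nonzero:
  assumes "po w (int m)" "\<not> p dvd m" "u \<noteq> 0" "degree u < p"
  shows "ev x w u \<noteq> 0"
  using po_ev[OF assms] by (simp add: po_def)

end

section \<open>The function field and its places\<close>

lemma sub_altdef:
  assumes "degree g \<le> n"
  shows "sub x g = (\<Sum>i\<le>n. emb_const (coeff g i) * x ^ i)"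
proof -
  have "sub x g = (\<Sum>i\<le>degree (map_poly emb_const g). coeff (map_poly emb_const g) i * x ^ i)"
    by (simp add: sub_def poly_altdef)
  also have "\<dots> = (\<Sum>i\<le>n. coeff (map_poly emb_const g) i * x ^ i)"
    using assms map_poly_degree_leq[of emb_const g] by (intro sum.mono_neutral_left) (auto simp: coeff_eq_0)
  finally show ?thesis by (simp add: coeff_map_poly)
qed

lemma sub_reflect_poly:
  assumes "x \<noteq> 0"
  shows "sub x (reflect_poly g) = x ^ degree g * sub (inverse x) g"
proof -
  have "sub x (reflect_poly g) = (\<Sum>i\<le>degree g. emb_const (coeff g (degree g - i)) * x ^ i)"
    unfolding sub_altdef[OF degree_reflect_poly_le] by (intro sum.cong refl) (simp add: coeff_reflect_poly)
  also have "\<dots> = (\<Sum>i\<le>degree g. emb_const (coeff g i) * x ^ (degree g - i))"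
    by (rule sum.reindex_bij_witness[of _ "\<lambda>i. degree g - i" "\<lambda>i. degree g - i"]) auto
  also have "\<dots> = (\<Sum>i\<le>degree g. x ^ degree g * (emb_const (coeff g i) * inverse x ^ i))"
    using assms by (intro sum.cong refl) (simp add: power_diff field_simps)
  finally show ?thesis by (simp add: sub_altdef[OF order_refl] sum_distrib_left)
qed

definition transc :: "'k::field rat_closure \<Rightarrow> bool" where
  "transc y \<longleftrightarrow> (\<forall>g. sub y g = 0 \<longrightarrow> g = 0)"

lemma transc_nonzero: "transc y \<Longrightarrow> y \<noteq> 0"
proof
  assume "transc y" "y = 0"
  then have "sub y [:0, 1:] = 0" by (simp add: sub_pCons)
  with \<open>transc y\<close> show False by (auto simp: transc_def)
qed

lemma transc_inverse:
  assumes "transc y"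
  shows "transc (inverse y)"
  unfolding transc_def
proof (intro allI impI)
  fix g assume "sub (inverse y) g = 0"
  then have "sub y (reflect_poly g) = 0" using transc_nonzero[OF assms] by (simp add: sub_reflect_poly)
  then show "g = 0" using assms by (auto simp: transc_def)
qed

lemma transc_emb_poly: "transc (emb_poly [:0, 1:])"
  by (simp add: transc_def sub_emb_poly)

lemma transc_add_const:
  assumes "transc y"
  shows "transc (y + emb_const c)"
  unfolding transc_def
proof (intro allI impI)
  fix g assume "sub (y + emb_const c) g = 0"
  then have "sub y (pcompose g [:c, 1:]) = 0" by (simp add: sub_pcompose sub_pCons add.commute)
  then have "pcompose g [:c, 1:] = 0" using assms by (simp add: transc_def)
  then show "g = 0" by (subst (asm) pcompose_eq_0_iff) auto
qed

text \<open>The ring k[y] does not contain 1/y since y is transcendental. A valuation ring above it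
  gives a place where y vanishes: a place at infinity for y = 1/X, a finite one for y = X -
  c.\<close>

lemma ex_valuation_zero:
  fixes y :: "'k::field rat_closure"
  assumes L: "is_subfield L" "range emb_const \<subseteq> L" "y \<in> L" and y: "transc y"
  shows "\<exists>A. valuation L A \<and> range (sub y) \<subseteq> A \<and> inverse y \<notin> A"
proof -
  have sL: "is_subring L" using L by (simp add: is_subfield_def)
  have "is_subring (range (sub y))"
    unfolding is_subring_def
  proof (intro conjI ballI)
    show "0 \<in> range (sub y)" by (rule range_eqI[of _ _ 0]) simp
    show "1 \<in> range (sub y)" by (rule range_eqI[of _ _ 1]) simp
  qed (auto simp flip: sub_add sub_mult sub_uminus)
  moreover have "range (sub y) \<subseteq> L"
  proof -
    have "sub y g \<in> L" for g
      using L by (induction g) (auto simp: sub_pCons intro!: subring_0[OF sL] subring_add[OF sL] subring_mult[OF sL])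
    then show ?thesis by blast
  qed
  moreover have "y \<in> range (sub y)" by (rule range_eqI[of _ _ "[:0, 1:]"]) (simp add: sub_pCons)
  moreover have "inverse y \<notin> range (sub y)"
  proof
    assume "inverse y \<in> range (sub y)"
    then obtain g where "inverse y = sub y g" by blast
    then have "y * sub y g = 1" using transc_nonzero[OF y] by (metis right_inverse)
    then have "sub y (pCons 0 g - 1) = 0" by (simp add: sub_diff sub_pCons)
    then have "pCons 0 g - 1 = 0" using y unfolding transc_def by blast
    then have "pCons 0 g = 1" by simp
    then have "coeff (pCons 0 g) 0 = coeff 1 0" by metis
    then show False by simp
  qed
  ultimately obtain A where "is_subring A" "range (sub y) \<subseteq> A" "A \<subseteq> L" "inverse y \<notin> A"
      "\<forall>z\<in>L. z \<in> A \<or> inverse z \<in> A"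
    using ex_valuation_ring[of "range (sub y)" L y] L(1) by blast
  then show ?thesis using L(1) by (intro exI[of _ A]) (auto simp: valuation_def)
qed

lemma range_emb_const_sub: "range emb_const \<subseteq> range (sub y)"
proof -
  have "emb_const c = sub y [:c:]" for c by simp
  then show ?thesis by (metis image_subsetI rangeI)
qed

section \<open>The curve W^p - W = f and its function field\<close>

locale as_curve = alg_closed_char p K for p and K :: "'k::alg_closed_field itself" +
  fixes f :: "'k poly" and m :: nat
  assumes deg_f: "degree f = m" and m_coprime: "\<not> p dvd m" and m_ge_2: "m \<ge> 2"
begin

abbreviation "xx \<equiv> emb_poly [:0, 1 :: 'k:]"
abbreviation "ww \<equiv> as_root f"
abbreviation "LL \<equiv> function_field f"

lemma ww_eq: "ww ^ p - ww = sub xx f"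
  using as_root_eq[of f] p_pos by (simp add: char_p sub_emb_poly)

text \<open>Irreducibility is not assumed; that no nonzero polynomial of smaller degree vanishes at
  a generic point is \<open>good_ev_nonzero\<close>.\<close>

definition minpoly :: "'k poly poly" where
  "minpoly = monom 1 p - [:f, 1:]"

lemma degree_minpoly: "degree minpoly = p"
  unfolding minpoly_def diff_conv_add_uminus using p_gt_1
  by (subst degree_add_eq_left) (auto simp: degree_monom_eq)

lemma minpoly_nonzero: "minpoly \<noteq> 0"
  using degree_minpoly p_pos by auto

lemma ev_minpoly:
  assumes "w ^ p - w = sub x f"
  shows "ev x w minpoly = 0"
proof -
  have "(monom 1 p :: 'k poly poly) = [:0, 1:] ^ p" by (simp add: monom_altdef)
  then have "ev x w (monom 1 p) = w ^ p" by (simp add: ev_power ev_pCons)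
  then show ?thesis using assms by (simp add: minpoly_def ev_diff ev_pCons algebra_simps)
qed

text \<open>Pseudo-division in W. The factor a and the remainder r depend on u alone and serve all
  points (x, w) of the curve at once, which later transfers relations between points.\<close>

lemma reduce_mod_minpoly:
  "\<exists>a r. a \<noteq> 0 \<and> degree r < p \<and> (\<forall>x w. w ^ p - w = sub x f \<longrightarrow> sub x a * ev x w u = ev x w r)"
proof -
  define r where "r = pseudo_mod u minpoly"
  obtain a q where a: "a \<noteq> 0" "smult a u = minpoly * q + r"
    using pseudo_mod(1)[OF minpoly_nonzero, of u] r_def by blast
  have "r = 0 \<or> degree r < p"
    using pseudo_mod(2)[OF minpoly_nonzero, of u] r_def degree_minpoly by simp
  then have "degree r < p" using p_pos by auto
  moreover have "sub x a * ev x w u = ev x w r" if "w ^ p - w = sub x f" for x w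
    using arg_cong[OF a(2), of "ev x w"] that by (simp add: ev_smult ev_add ev_mult ev_minpoly)
  ultimately show ?thesis using a(1) by blast
qed

text \<open>A generic point of the curve: a solution of the equation whose first coordinate is
  transcendental over k.\<close>

definition good :: "'k rat_closure \<Rightarrow> 'k rat_closure \<Rightarrow> bool" where
  "good x w \<longleftrightarrow> transc x \<and> w ^ p - w = sub x f"

text \<open>The whole algebraic closure already has a valuation ring in which x has a pole, and
  there the value has a definite pole order. So 1, w, ..., w^(p-1) are independent over
  k(x).\<close>

lemma good_ev_nonzero:
  assumes "good x w" "u \<noteq> 0" "degree u < p"
  shows "ev x w u \<noteq> 0"
proof -
  have tr: "transc x" and w: "w ^ p - w = sub x f" using assms(1) by (auto simp: good_def)
  obtain A where A: "valuation UNIV A" "range (sub (inverse x)) \<subseteq> A" "inverse (inverse x) \<notin> A"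
    using ex_valuation_zero[OF is_subfield_UNIV _ _ transc_inverse[OF tr]] by auto
  interpret valuation UNIV A by fact
  interpret curve_valuation UNIV A x p K
    using A range_emb_const_sub[of "inverse x"] p_pos by unfold_locales auto
  have "po w (int m)" using po_w[OF _ w] deg_f m_ge_2 by simp
  then show ?thesis using ev_nonzero[OF _ m_coprime assms(2,3)] by blast
qed

text \<open>All generic points satisfy the same polynomial equations, so replacing one by another is
  a well-defined map of fields.\<close>

lemma good_ev_eq_0_iff:
  assumes "good x w" "good x' w'"
  shows "ev x w u = 0 \<longleftrightarrow> ev x' w' u = 0"
proof -
  obtain a r where r: "a \<noteq> 0" "degree r < p" "\<forall>x w. w ^ p - w = sub x f \<longrightarrow> sub x a * ev x w u = ev x w r"
    using reduce_mod_minpoly by blast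
  have "ev x w u = 0 \<longleftrightarrow> r = 0" if "good x w" for x w
  proof -
    have "sub x a \<noteq> 0" using that r(1) by (auto simp: good_def transc_def)
    then have "ev x w u = 0 \<longleftrightarrow> sub x a * ev x w u = 0" by simp
    also have "\<dots> \<longleftrightarrow> ev x w r = 0" using r(3) that by (simp add: good_def)
    also have "\<dots> \<longleftrightarrow> r = 0" using good_ev_nonzero[OF that _ r(2)] by auto
    finally show ?thesis .
  qed
  then show ?thesis using assms by metis
qed

lemma good_xx_ww: "good xx ww"
  by (simp add: good_def transc_emb_poly ww_eq)

text \<open>Euclid's algorithm against \<open>minpoly\<close>: the pseudo-remainder s has smaller
  degree than r and its value is a multiple of that of r, so a multiplier for s yields one for
  r.\<close>

lemma ex_norm:
  assumes "r \<noteq> 0" "degree r < p"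
  shows "\<exists>u g. g \<noteq> 0 \<and> ev xx ww r * ev xx ww u = emb_poly g"
  using assms
proof (induction "degree r" arbitrary: r rule: less_induct)
  case less
  show ?case
  proof (cases "degree r = 0")
    case True
    then obtain g where "r = [:g:]" by (auto elim: degree_eq_zeroE)
    then show ?thesis using less.prems by (intro exI[of _ 1] exI[of _ g]) (simp add: sub_emb_poly)
  next
    case False
    define s where "s = pseudo_mod minpoly r"
    obtain a q where a: "a \<noteq> 0" "smult a minpoly = r * q + s"
      using pseudo_mod(1)[OF less.prems(1), of minpoly] s_def by blast
    have s: "s = 0 \<or> degree s < degree r"
      using pseudo_mod(2)[OF less.prems(1), of minpoly] s_def by simp
    have eq: "ev xx ww r * ev xx ww q + ev xx ww s = 0"
      using arg_cong[OF a(2), of "ev xx ww"] ev_minpoly[OF ww_eq] by (simp add: ev_smult ev_add ev_mult)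
    \<comment> \<open>If s were zero, r and q would both have degree below p, hence nonzero values
      at the generic point, and yet product zero there.\<close>
    have "s \<noteq> 0"
    proof
      assume "s = 0"
      then have *: "smult a minpoly = r * q" using a by simp
      have "r * q \<noteq> 0" using * a(1) minpoly_nonzero by (metis smult_eq_0_iff)
      then have "q \<noteq> 0" by auto
      have "degree r + degree q = p"
        using arg_cong[OF *, of degree] a(1) degree_minpoly \<open>q \<noteq> 0\<close> less.prems(1)
        by (simp add: degree_mult_eq)
      then have "degree q < p" using False by simp
      then have "ev xx ww q \<noteq> 0" "ev xx ww r \<noteq> 0"
        using good_ev_nonzero[OF good_xx_ww] \<open>q \<noteq> 0\<close> less.prems by auto
      with eq \<open>s = 0\<close> show False by simp
    qed
    with s have "degree s < degree r" by simp
    then obtain u g where "g \<noteq> 0" "ev xx ww s * ev xx ww u = emb_poly g"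
      using less.hyps[of s] \<open>s \<noteq> 0\<close> less.prems by auto
    moreover have "ev xx ww s = - (ev xx ww r * ev xx ww q)" using eq by (simp add: eq_neg_iff_add_eq_0 add.commute)
    ultimately have "ev xx ww r * ev xx ww (- q * u) = emb_poly g"
      by (simp add: ev_mult ev_uminus mult.assoc)
    with \<open>g \<noteq> 0\<close> show ?thesis by blast
  qed
qed

lemma emb_poly_add: "emb_poly (g + h) = emb_poly g + emb_poly h" for g h :: "'k poly"
  using sub_add[of xx g h] by (simp add: sub_emb_poly)

lemma emb_poly_mult: "emb_poly (g * h) = emb_poly g * emb_poly h" for g h :: "'k poly"
  using sub_mult[of xx g h] by (simp add: sub_emb_poly)

text \<open>Denominators from k[X] suffice for the whole field; \<open>ex_norm\<close> is what makes
  this set closed under inverses.\<close>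

definition fractions :: "'k rat_closure set" where
  "fractions = {ev xx ww u / emb_poly g | u g. g \<noteq> 0}"

lemma fractionsI: "g \<noteq> 0 \<Longrightarrow> ev xx ww u / emb_poly g \<in> fractions"
  by (auto simp: fractions_def)

lemma is_subfield_fractions: "is_subfield fractions"
  unfolding is_subfield_def is_subring_def
proof (intro conjI ballI)
  have 1: "emb_poly (1 :: 'k poly) = 1" using sub_1[of xx] by (simp add: sub_emb_poly del: sub_1)
  show "0 \<in> fractions" using fractionsI[of 1 0] by simp
  show "1 \<in> fractions" using fractionsI[of 1 1] 1 by simp
  fix y assume "y \<in> fractions"
  then obtain u g where u: "y = ev xx ww u / emb_poly g" "g \<noteq> 0" by (auto simp: fractions_def)
  show "- y \<in> fractions" using fractionsI[OF u(2), of "- u"] by (simp add: u ev_uminus)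
  show "inverse y \<in> fractions"
  proof -
    obtain a r where r: "a \<noteq> 0" "degree r < p" "sub xx a * ev xx ww u = ev xx ww r"
      using reduce_mod_minpoly[of u] ww_eq by blast
    show ?thesis
    proof (cases "r = 0")
      case True
      then have "y = 0" using r u by (simp add: sub_emb_poly)
      then show ?thesis using fractionsI[of 1 0] by simp
    next
      case False
      then obtain v h where v: "h \<noteq> 0" "ev xx ww r * ev xx ww v = emb_poly h"
        using ex_norm r(2) by blast
      have nz: "emb_poly a \<noteq> 0" "emb_poly g \<noteq> 0" "emb_poly h \<noteq> 0" using r u v by auto
      have eu: "ev xx ww u = ev xx ww r / emb_poly a" using r nz by (simp add: sub_emb_poly field_simps)
      have er: "ev xx ww r \<noteq> 0" using v nz by auto
      have ev: "ev xx ww v = emb_poly h / ev xx ww r" using v er by (simp add: field_simps)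
      have "inverse y = ev xx ww (smult (a * g) v) / emb_poly h"
        using nz er by (simp add: u(1) eu ev ev_smult sub_emb_poly emb_poly_mult field_simps)
      then show ?thesis using fractionsI[OF v(1)] by simp
    qed
  qed
  fix y' assume "y' \<in> fractions"
  then obtain u' g' where u': "y' = ev xx ww u' / emb_poly g'" "g' \<noteq> 0" by (auto simp: fractions_def)
  have nz: "g * g' \<noteq> 0" "emb_poly g \<noteq> 0" "emb_poly g' \<noteq> 0" using u u' by auto
  have "y + y' = ev xx ww (smult g' u + smult g u') / emb_poly (g * g')"
    unfolding u(1) u'(1) ev_smult ev_add sub_emb_poly emb_poly_mult add_frac_eq[OF nz(2,3)]
    by (simp only: mult.commute)
  then show "y + y' \<in> fractions" using fractionsI[OF nz(1)] by simp
  have "y * y' = ev xx ww (u * u') / emb_poly (g * g')"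
    by (simp add: u(1) u'(1) ev_mult emb_poly_mult)
  then show "y * y' \<in> fractions" using fractionsI[OF nz(1)] by simp
qed

lemma ev_in_subfield:
  assumes "is_subfield L" "range emb_const \<subseteq> L" "x \<in> L" "w \<in> L"
  shows "ev x w u \<in> L" and "sub x g \<in> L"
proof -
  note c = subfield_closed[OF assms(1)]
  have s: "sub x g \<in> L" for g
    using assms by (induction g) (auto simp: sub_pCons intro!: c)
  then show "sub x g \<in> L" .
  show "ev x w u \<in> L"
    using assms s by (induction u) (auto simp: ev_pCons intro!: c)
qed

lemma function_field_eq: "LL = fractions"
proof
  have 1: "emb_poly (1 :: 'k poly) = 1" using sub_1[of xx] by (simp add: sub_emb_poly del: sub_1)
  have ev: "ev xx ww u \<in> fractions" for u using fractionsI[of 1 u] 1 by simp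
  have "emb_const c \<in> fractions" for c using ev[of "[:[:c:]:]"] by simp
  moreover have "xx \<in> fractions" using ev[of "[:[:0, 1:]:]"] by (simp add: sub_pCons)
  moreover have "ww \<in> fractions" using ev[of "[:0, 1:]"] by (simp add: ev_pCons)
  ultimately show "LL \<subseteq> fractions"
    using is_subfield_fractions unfolding function_field_def by blast
  show "fractions \<subseteq> LL"
    unfolding function_field_def
  proof (intro Inter_greatest)
    fix L assume "L \<in> {L. is_subfield L \<and> range emb_const \<subseteq> L \<and> xx \<in> L \<and> ww \<in> L}"
    then have L: "is_subfield L" "range emb_const \<subseteq> L" "xx \<in> L" "ww \<in> L" by auto
    show "fractions \<subseteq> L"
      using ev_in_subfield[OF L] by (auto simp: fractions_def sub_emb_poly intro!: subfield_divide[OF L(1)])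
  qed
qed

lemma LL_subfield: "is_subfield LL"
  using is_subfield_fractions function_field_eq by simp

lemma LL_xx: "xx \<in> LL" and LL_ww: "ww \<in> LL" and LL_const: "range emb_const \<subseteq> LL"
  by (auto simp: function_field_def)

lemma LL_emb_const: "emb_const c \<in> LL"
  using LL_const by auto

lemma LL_reduced:
  assumes "z \<in> LL"
  shows "\<exists>u g. g \<noteq> 0 \<and> degree u < p \<and> z = ev xx ww u / emb_poly g"
proof -
  obtain u g where u: "z = ev xx ww u / emb_poly g" "g \<noteq> 0"
    using assms by (auto simp: function_field_eq fractions_def)
  obtain a r where r: "a \<noteq> 0" "degree r < p" "sub xx a * ev xx ww u = ev xx ww r"
    using reduce_mod_minpoly[of u] ww_eq by blast
  have "emb_poly a \<noteq> 0" "emb_poly g \<noteq> 0" using r u by auto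
  then have "z = ev xx ww r / emb_poly (a * g)"
    using r(3)[symmetric] by (simp add: u sub_emb_poly emb_poly_mult)
  then show ?thesis using r u by (intro exI[of _ r] exI[of _ "a * g"]) auto
qed

lemma valuation_ring_valuation: "is_valuation_ring LL A \<Longrightarrow> valuation LL A"
  using LL_subfield by (auto simp: is_valuation_ring_def valuation_def)

lemma infinite_curve_valuation:
  assumes "is_valuation_ring LL A" "xx \<notin> A"
  shows "curve_valuation LL A xx p"
proof -
  interpret valuation LL A using assms(1) by (rule valuation_ring_valuation)
  show ?thesis using assms LL_xx p_pos char_p by unfold_locales (auto simp: is_valuation_ring_def)
qed

lemma infinite_po_ww:
  assumes "is_valuation_ring LL A" "xx \<notin> A"
  shows "valuation_pole.po LL A xx p ww (int m)"
proof -
  interpret curve_valuation LL A xx p K using infinite_curve_valuation[OF assms] .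
  show ?thesis using po_w[OF LL_ww ww_eq] deg_f m_ge_2 by simp
qed

text \<open>Whether u(X, W)/g(X) belongs to the ring is decided by weighted degrees alone, which do
  not depend on the ring: infinity is totally ramified.\<close>

lemma infinite_valuation_unique:
  assumes A: "is_valuation_ring LL A" "xx \<notin> A" and B: "is_valuation_ring LL B" "xx \<notin> B"
  shows "A = B"
proof -
  have *: "z \<in> C \<longleftrightarrow> u = 0 \<or> int (curve_valuation.pole_number p m u) \<le> int (p * degree g)"
    if C: "is_valuation_ring LL C" "xx \<notin> C" and z: "z = ev xx ww u / emb_poly g" "g \<noteq> 0" "degree u < p" for C z u g
  proof -
    interpret curve_valuation LL C xx p K using infinite_curve_valuation[OF C] .
    show ?thesis
    proof (cases "u = 0")
      case True
      then show ?thesis using z A_closed by simp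
    next
      case False
      have "po (ev xx ww u / sub xx g) (int (pole_number m u) - int (p * degree g))"
        using False z by (intro po_divide po_ev po_sub infinite_po_ww[OF C] m_coprime)
      then show ?thesis using po_in_A_iff False z by (simp add: sub_emb_poly)
    qed
  qed
  have "z \<in> A \<longleftrightarrow> z \<in> B" if "z \<in> LL" for z
    using LL_reduced[OF that] *[OF A] *[OF B] by metis
  moreover have "A \<subseteq> LL" "B \<subseteq> LL" using A B by (auto simp: is_valuation_ring_def)
  ultimately show ?thesis by blast
qed

lemma ex_valuation_ring_zero:
  assumes y: "y \<in> LL" "transc y"
  shows "\<exists>A. is_valuation_ring LL A \<and> range (sub y) \<subseteq> A \<and> inverse y \<notin> A"
proof -
  obtain A where A: "valuation LL A" "range (sub y) \<subseteq> A" "inverse y \<notin> A"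
    using ex_valuation_zero[OF LL_subfield LL_const y] by blast
  have "y \<in> A" using A(2) sub_pCons[of y 0 "[:1:]"] by (metis add_0 emb_const_0 emb_const_1 mult_1_right range_subsetD sub_const)
  moreover have "y \<notin> range emb_const"
  proof
    assume "y \<in> range emb_const"
    then obtain c where "y = emb_const c" by blast
    then have "sub y [:- c, 1:] = 0" by (simp add: sub_pCons emb_const_uminus)
    then show False using y(2) by (auto simp: transc_def)
  qed
  moreover have "inverse y \<in> LL" using y(1) subfield_inverse[OF LL_subfield] by blast
  ultimately show ?thesis
    using A subset_trans[OF range_emb_const_sub A(2)]
    by (intro exI[of _ A]) (auto simp: is_valuation_ring_def valuation_def)
qed

definition ring_infinity :: "'k rat_closure set" where
  "ring_infinity = (THE A. is_valuation_ring LL A \<and> xx \<notin> A)"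

lemma ring_infinity: "is_valuation_ring LL ring_infinity" "xx \<notin> ring_infinity"
proof -
  have "inverse xx \<in> LL" using LL_xx subfield_inverse[OF LL_subfield] by blast
  then obtain A where "is_valuation_ring LL A" "inverse (inverse xx) \<notin> A"
    using ex_valuation_ring_zero[of "inverse xx"] transc_inverse[OF transc_emb_poly] by blast
  then have "\<exists>!A. is_valuation_ring LL A \<and> xx \<notin> A"
    using infinite_valuation_unique by auto
  from theI'[OF this] show "is_valuation_ring LL ring_infinity" "xx \<notin> ring_infinity"
    by (auto simp: ring_infinity_def)
qed

lemma ring_infinityI: "is_valuation_ring LL A \<Longrightarrow> xx \<notin> A \<Longrightarrow> A = ring_infinity"
  using infinite_valuation_unique ring_infinity by blast

lemma nonunits_determine:
  assumes "is_valuation_ring LL A"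
  shows "A = {z\<in>LL. z = 0 \<or> inverse z \<notin> nonunits A}"
proof -
  interpret valuation LL A using assms by (rule valuation_ring_valuation)
  show ?thesis using subset total A_closed(1) by (auto simp: nonunits_def)
qed

lemma rational_infinity_subset_iff:
  assumes A: "is_valuation_ring LL A"
  shows "rational_infinity \<subseteq> nonunits A \<longleftrightarrow> xx \<notin> A"
proof
  assume *: "rational_infinity \<subseteq> nonunits A"
  have "emb_poly 1 / xx \<in> rational_infinity"
    unfolding rational_infinity_def by (intro CollectI exI[of _ 1] exI[of _ "[:0, 1:]"]) auto
  moreover have "emb_poly (1 :: 'k poly) = 1" using sub_1[of xx] by (simp add: sub_emb_poly del: sub_1)
  ultimately have "inverse xx \<in> nonunits A" using * by (auto simp: divide_inverse)
  then show "xx \<notin> A" by (auto simp: nonunits_def)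
next
  assume xA: "xx \<notin> A"
  interpret curve_valuation LL A xx p K using infinite_curve_valuation[OF A xA] .
  show "rational_infinity \<subseteq> nonunits A"
  proof
    fix z :: "'k rat_closure" assume "z \<in> rational_infinity"
    then obtain g h where z: "z = emb_poly g / emb_poly h" "h \<noteq> 0" "g = 0 \<or> degree g < degree h"
      by (auto simp: rational_infinity_def)
    show "z \<in> nonunits A"
    proof (cases "g = 0")
      case True
      then have "z = 0" using z by (simp add: emb_poly_def)
      then show ?thesis using A_closed(1) by (simp add: nonunits_def)
    next
      case False
      have "po (sub xx g / sub xx h) (int (p * degree g) - int (p * degree h))"
        using False z by (intro po_divide po_sub)
      moreover have "p * degree g < p * degree h" using z False p_pos by simp
      ultimately show ?thesis using po_nonunit_iff z by (simp add: sub_emb_poly del: of_nat_mult)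
    qed
  qed
qed

lemma place_infinity_eq: "place_infinity f = nonunits ring_infinity"
  unfolding place_infinity_def
proof (rule the_equality)
  show "is_place LL (nonunits ring_infinity) \<and> rational_infinity \<subseteq> nonunits ring_infinity"
    using ring_infinity rational_infinity_subset_iff by (auto simp: is_place_def nonunits_def)
  fix P assume P: "is_place LL P \<and> rational_infinity \<subseteq> P"
  then obtain A where A: "is_valuation_ring LL A" "P = nonunits A"
    by (auto simp: is_place_def nonunits_def)
  then have "A = ring_infinity" using P rational_infinity_subset_iff ring_infinityI by blast
  then show "P = nonunits ring_infinity" using A by simp
qed

text \<open>W is integral over k[X]: dividing the equation by W^(p-1) expresses W through X and 1/W,
  and 1/W would lie in A if W did not.\<close>

lemma ww_in_valuation_ring:
  assumes A: "is_valuation_ring LL A" and x: "xx \<in> A"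
  shows "ww \<in> A"
proof (rule ccontr)
  assume w: "ww \<notin> A"
  interpret valuation LL A using A by (rule valuation_ring_valuation)
  have w0: "ww \<noteq> 0" using w A_closed(1) by auto
  have iw: "inverse ww \<in> A" using total[OF LL_ww] w by blast
  have "emb_const c \<in> A" for c using A by (auto simp: is_valuation_ring_def)
  then have "sub xx g \<in> A" for g
    using x by (induction g) (auto simp: sub_pCons intro!: A_closed)
  then have "sub xx f * inverse ww ^ (p - 1) + inverse ww ^ (p - 2) \<in> A"
    using iw by (intro A_closed)
  moreover have "ww = sub xx f * inverse ww ^ (p - 1) + inverse ww ^ (p - 2)"
  proof -
    obtain n where n: "p = Suc (Suc n)" using p_gt_1 by (cases p; cases "p - 1") auto
    have "sub xx f = ww * ww ^ Suc n - ww" using ww_eq n by simp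
    then show ?thesis using w0 by (simp add: n field_simps)
  qed
  ultimately show False using w by simp
qed

text \<open>A zero c of h gives a place where X - c vanishes; regularity there forces g(c) = 0, so X
  - c cancels and the degree of h drops.\<close>

lemma polynomial_if_regular:
  assumes h: "h \<noteq> 0"
    and reg: "\<And>A. is_valuation_ring LL A \<Longrightarrow> xx \<in> A \<Longrightarrow> emb_poly g / emb_poly h \<in> A"
  shows "h dvd g"
  using assms
proof (induction "degree h" arbitrary: g h)
  case 0
  then have "is_unit h" by (simp add: is_unit_iff_degree)
  then show ?case by (rule unit_imp_dvd)
next
  case (Suc n)
  then obtain c where c: "poly h c = 0" using alg_closed_imp_poly_has_root[of h] by auto
  define y where "y = xx + emb_const (- c)"
  have "sub xx [:- c, 1:] = y" by (simp add: y_def sub_pCons add.commute)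
  then have ysub: "y = emb_poly [:- c, 1:]" unfolding sub_emb_poly by (rule sym)
  have yL: "y \<in> LL" unfolding y_def by (intro subfield_closed[OF LL_subfield] LL_xx LL_emb_const)
  have yt: "transc y" unfolding y_def by (rule transc_add_const[OF transc_emb_poly])
  obtain A where A: "is_valuation_ring LL A" "range (sub y) \<subseteq> A" "inverse y \<notin> A"
    using ex_valuation_ring_zero[OF yL yt] by blast
  interpret valuation LL A using A(1) by (rule valuation_ring_valuation)
  have pA: "emb_poly u \<in> A" for u :: "'k poly"
  proof -
    have "sub y (pcompose u [:c, 1:]) = sub xx u"
      by (simp add: sub_pcompose sub_pCons y_def add.commute emb_const_uminus)
    then show ?thesis using A(2) by (metis rangeI sub_emb_poly subsetD)
  qed
  have xA: "xx \<in> A" by (rule pA)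
  have yn: "y \<in> nonunits A" using A(3) pA ysub by (auto simp: nonunits_def)
  obtain h' where h': "h = [:- c, 1:] * h'" using c poly_eq_0_iff_dvd by (metis dvdE)
  have "poly g c = 0"
  proof (rule ccontr)
    assume gc: "poly g c \<noteq> 0"
    have "[:- c, 1:] dvd g - [:poly g c:]" by (simp flip: poly_eq_0_iff_dvd)
    then obtain g' where g': "g = [:poly g c:] + [:- c, 1:] * g'" by (metis add.commute diff_add_cancel dvdE)
    have eg: "emb_poly g = emb_const (poly g c) + emb_poly g' * y"
    proof -
      have "emb_poly g = emb_poly ([:poly g c:] + [:- c, 1:] * g')" using g' by simp
      then show ?thesis by (simp only: emb_poly_add emb_poly_mult ysub emb_const_def mult.commute)
    qed
    have "emb_const (poly g c) \<in> vunits A"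
    proof -
      have "emb_const a \<in> A" for a using pA[of "[:a:]"] by (simp add: emb_const_def)
      then show ?thesis using gc by (simp add: vunits_def flip: emb_const_inverse)
    qed
    then have unit: "emb_poly g \<in> vunits A"
      unfolding eg using yn pA by (intro vunits_add_nonunit nonunits_mult)
    have "emb_poly h \<in> nonunits A"
      unfolding h' using nonunits_mult[OF pA yn, of h'] by (simp only: emb_poly_mult ysub mult.commute)
    then have "emb_poly g / emb_poly h * emb_poly h \<in> nonunits A"
      using Suc.prems(2)[OF A(1) xA] by (intro nonunits_mult)
    then have "emb_poly g \<in> nonunits A" using Suc.prems(1) by simp
    then show False using unit by (simp add: vunits_iff)
  qed
  then obtain g' where g': "g = [:- c, 1:] * g'" using poly_eq_0_iff_dvd by (metis dvdE)
  have h'0: "h' \<noteq> 0" using Suc.prems(1) h' by auto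
  have eq: "emb_poly g / emb_poly h = emb_poly g' / emb_poly h'"
    using transc_nonzero[OF yt] unfolding g' h' emb_poly_mult ysub[symmetric] by simp
  have "degree h = Suc (degree h')" using h'0 by (simp add: h' degree_mult_eq del: mult_pCons_left)
  then have "h' dvd g'"
    using Suc.hyps(1)[of h' g'] Suc.hyps(2) h'0 Suc.prems(2) unfolding eq by simp
  then show ?case unfolding g' h' by (rule mult_dvd_mono[OF dvd_refl])
qed

end

section \<open>Automorphisms\<close>

lemma emb_poly_1: "emb_poly 1 = 1"
  by (simp add: emb_poly_def)

lemma emb_const_of_nat: "emb_const (of_nat n) = of_nat n"
  by (induction n) (simp_all add: emb_const_add)

lemma CHAR_rat_closure: "CHAR('k::field rat_closure) = CHAR('k)"
proof (rule CHAR_eqI)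
  show "of_nat CHAR('k) = (0 :: 'k rat_closure)" by (simp flip: emb_const_of_nat)
  fix n assume "of_nat n = (0 :: 'k rat_closure)"
  then have "emb_const (of_nat n :: 'k) = 0" by (simp only: emb_const_of_nat)
  then show "CHAR('k) dvd n" by (simp add: of_nat_eq_0_iff_char_dvd)
qed

lemma (in alg_closed_char) frobenius_add_closure: "(x + y) ^ p = x ^ p + y ^ p" for x y :: "'k rat_closure"
  by (rule freshmans_dream) (simp_all only: CHAR_rat_closure char_p prime_p)

context as_curve
begin

lemma carrier_aut_group_iff:
  "\<sigma> \<in> carrier (aut_group f) \<longleftrightarrow> \<sigma> \<in> Bij LL \<and>
     (\<forall>x\<in>LL. \<forall>y\<in>LL. \<sigma> (x + y) = \<sigma> x + \<sigma> y \<and> \<sigma> (x * y) = \<sigma> x * \<sigma> y) \<and>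
     (\<forall>c. \<sigma> (emb_const c) = emb_const c)"
  by (simp add: aut_group_def)

lemmas LL_closed = subfield_closed[OF LL_subfield] subfield_inverse[OF LL_subfield]
  subfield_divide[OF LL_subfield] subfield_power_int[OF LL_subfield]

lemma sub_in_LL: "x \<in> LL \<Longrightarrow> sub x g \<in> LL"
  using ev_in_subfield(2)[OF LL_subfield LL_const _ LL_ww] .

lemma ev_in_LL: "x \<in> LL \<Longrightarrow> w \<in> LL \<Longrightarrow> ev x w u \<in> LL"
  using ev_in_subfield(1)[OF LL_subfield LL_const] .

context
  fixes \<sigma>
  assumes \<sigma>: "\<sigma> \<in> carrier (aut_group f)"
begin

lemma aut_bij: "bij_betw \<sigma> LL LL"
  using \<sigma> by (simp add: carrier_aut_group_iff Bij_def)

lemma aut_extensional: "\<sigma> \<in> extensional LL"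
  using \<sigma> by (simp add: carrier_aut_group_iff Bij_def)

lemma aut_closed: "z \<in> LL \<Longrightarrow> \<sigma> z \<in> LL"
  using aut_bij by (auto simp: bij_betw_def)

lemma aut_surj: "z \<in> LL \<Longrightarrow> \<exists>y\<in>LL. \<sigma> y = z"
  using aut_bij unfolding bij_betw_def by (metis imageE)

lemma aut_inj: "y \<in> LL \<Longrightarrow> z \<in> LL \<Longrightarrow> \<sigma> y = \<sigma> z \<longleftrightarrow> y = z"
  using aut_bij by (auto simp: bij_betw_def inj_on_def)

lemma aut_add: "y \<in> LL \<Longrightarrow> z \<in> LL \<Longrightarrow> \<sigma> (y + z) = \<sigma> y + \<sigma> z"
  and aut_mult: "y \<in> LL \<Longrightarrow> z \<in> LL \<Longrightarrow> \<sigma> (y * z) = \<sigma> y * \<sigma> z"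
  and aut_const: "\<sigma> (emb_const c) = emb_const c"
  using \<sigma> by (auto simp: carrier_aut_group_iff)

lemma aut_0: "\<sigma> 0 = 0" and aut_1: "\<sigma> 1 = 1"
  using aut_const[of 0] aut_const[of 1] by simp_all

lemma aut_uminus: "z \<in> LL \<Longrightarrow> \<sigma> (- z) = - \<sigma> z"
  using aut_add[of z "- z"] aut_0 LL_closed(5)[of z] by (simp add: eq_neg_iff_add_eq_0 add.commute)

lemma aut_eq_0_iff: "z \<in> LL \<Longrightarrow> \<sigma> z = 0 \<longleftrightarrow> z = 0"
  using aut_inj[of z 0] LL_closed(1) aut_0 by simp

lemma aut_inverse: "z \<in> LL \<Longrightarrow> \<sigma> (inverse z) = inverse (\<sigma> z)"
proof (cases "z = 0")
  case False
  assume z: "z \<in> LL"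
  then have "\<sigma> z * \<sigma> (inverse z) = 1"
    using aut_mult[of z "inverse z"] LL_closed(8)[of z] aut_1 False by simp
  then show ?thesis by (rule inverse_unique[symmetric])
qed (simp add: aut_0)

lemma aut_power: "z \<in> LL \<Longrightarrow> \<sigma> (z ^ n) = \<sigma> z ^ n"
  by (induction n) (simp_all add: aut_1 aut_mult LL_closed(7))

lemma aut_power_int: "z \<in> LL \<Longrightarrow> \<sigma> (z powi n) = \<sigma> z powi n"
  by (simp add: power_int_def aut_power aut_inverse LL_closed(8))

lemma aut_sub: "x \<in> LL \<Longrightarrow> \<sigma> (sub x g) = sub (\<sigma> x) g"
  by (induction g) (simp_all add: aut_0 sub_pCons aut_add aut_mult aut_const LL_emb_const sub_in_LL LL_closed(4))

lemma aut_ev: "x \<in> LL \<Longrightarrow> w \<in> LL \<Longrightarrow> \<sigma> (ev x w u) = ev (\<sigma> x) (\<sigma> w) u"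
  by (induction u) (simp_all add: aut_0 ev_pCons aut_add aut_mult aut_sub sub_in_LL ev_in_LL LL_closed(4))

lemma aut_fraction: "\<sigma> (ev xx ww u / emb_poly g) = ev (\<sigma> xx) (\<sigma> ww) u / sub (\<sigma> xx) g"
proof -
  have "emb_poly g = sub xx g" by (rule sub_emb_poly[symmetric])
  then show ?thesis
    using LL_xx LL_ww by (simp add: divide_inverse aut_mult aut_inverse aut_ev aut_sub ev_in_LL sub_in_LL LL_closed(8))
qed

lemma aut_curve: "\<sigma> ww ^ p - \<sigma> ww = sub (\<sigma> xx) f"
proof -
  have "\<sigma> (ww ^ p) = \<sigma> (sub xx f + ww)" using ww_eq by (simp add: diff_eq_eq)
  then show ?thesis using LL_ww LL_xx by (simp add: aut_power aut_add aut_sub sub_in_LL)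
qed

lemma aut_preimage_valuation_ring:
  assumes A: "is_valuation_ring LL A"
  shows "is_valuation_ring LL {z\<in>LL. \<sigma> z \<in> A}"
proof -
  interpret valuation LL A using A by (rule valuation_ring_valuation)
  have cA: "emb_const c \<in> A" for c using A by (auto simp: is_valuation_ring_def)
  obtain a where a: "a \<in> A" "a \<notin> range emb_const" using A by (auto simp: is_valuation_ring_def)
  obtain a' where a': "a' \<in> LL" "\<sigma> a' = a" using aut_surj a subset by blast
  have "a' \<notin> range emb_const" using a a' aut_const by auto
  moreover obtain b where b: "b \<in> LL" "b \<notin> A" using A by (auto simp: is_valuation_ring_def)
  obtain b' where b': "b' \<in> LL" "\<sigma> b' = b" using aut_surj b by blast
  moreover have "is_subring {z\<in>LL. \<sigma> z \<in> A}"
    by (auto simp: is_subring_def aut_0 aut_1 aut_add aut_mult aut_uminus intro!: LL_closed A_closed)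
  ultimately show ?thesis
    using a a' b b' cA LL_emb_const total
    by (auto simp: is_valuation_ring_def aut_const aut_inverse aut_closed LL_closed(8))
qed

end

lemma aut_eqI:
  assumes "\<sigma> \<in> carrier (aut_group f)" "\<tau> \<in> carrier (aut_group f)" "\<sigma> xx = \<tau> xx" "\<sigma> ww = \<tau> ww"
  shows "\<sigma> = \<tau>"
proof (rule extensionalityI)
  show "\<sigma> \<in> extensional LL" "\<tau> \<in> extensional LL" using assms aut_extensional by auto
  fix z assume "z \<in> LL"
  then obtain u g where "z = ev xx ww u / emb_poly g" using LL_reduced by blast
  then show "\<sigma> z = \<tau> z" using aut_fraction[OF assms(1)] aut_fraction[OF assms(2)] assms by simp
qed

lemma sub_map_shift: "ev (x + emb_const d) w (map_poly (shift (- d)) u) = ev x w u"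
proof (induction u)
  case (pCons g u)
  have "sub (x + emb_const d) (shift (- d) g) = sub x g"
    by (simp add: shift_def sub_pcompose sub_pCons emb_const_uminus)
  then show ?case using pCons by (simp add: map_poly_pCons ev_pCons shift_def)
qed simp

text \<open>The pair (x, w) is another generic point, so sending u(X, W)/g(X) to u(x, w)/g(x) is
  well defined and injective by \<open>good_ev_eq_0_iff\<close>.\<close>

lemma ex_translation_aut:
  fixes h :: "'k poly"
  assumes h: "shift d f - f = h ^ p - h"
  shows "\<exists>\<sigma>\<in>carrier (aut_group f). \<sigma> xx = xx + emb_const d \<and> \<sigma> ww = ww + sub xx h"
proof -
  define x where "x = xx + emb_const d"
  define w where "w = ww + sub xx h"
  have xL: "x \<in> LL" and wL: "w \<in> LL"
    unfolding x_def w_def using LL_xx LL_ww LL_emb_const ev_in_subfield(2)[OF LL_subfield LL_const LL_xx LL_ww]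
    by (auto intro!: LL_closed)
  have "w ^ p = ww ^ p + sub xx h ^ p"
    unfolding w_def by (rule frobenius_add_closure)
  then have "w ^ p - w = sub xx f + (sub xx h ^ p - sub xx h)"
    using ww_eq by (simp add: w_def algebra_simps)
  also have "\<dots> = sub xx (f + (h ^ p - h))" by (simp add: sub_add sub_diff sub_power)
  also have "f + (h ^ p - h) = shift d f" using h by (simp add: algebra_simps)
  also have "sub xx (shift d f) = sub x f" by (simp add: shift_def sub_pcompose sub_pCons x_def add.commute)
  finally have gw: "good x w" unfolding good_def x_def using transc_add_const[OF transc_emb_poly] by blast
  define rel where "rel z y \<longleftrightarrow> (\<exists>u g. g \<noteq> 0 \<and> z = ev xx ww u / emb_poly g \<and> y = ev x w u / sub x g)" for z y
  have sx: "sub x g \<noteq> 0" if "g \<noteq> 0" for g using gw that by (auto simp: good_def transc_def)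
  have rel_eq: "y1 = y2 \<longleftrightarrow> z1 = z2" if "rel z1 y1" "rel z2 y2" for z1 y1 z2 y2
  proof -
    obtain u1 g1 u2 g2 where *: "g1 \<noteq> 0" "z1 = ev xx ww u1 / emb_poly g1" "y1 = ev x w u1 / sub x g1"
      "g2 \<noteq> 0" "z2 = ev xx ww u2 / emb_poly g2" "y2 = ev x w u2 / sub x g2"
      using \<open>rel z1 y1\<close> \<open>rel z2 y2\<close> by (auto simp: rel_def)
    define v where "v = smult g2 u1 - smult g1 u2"
    have "y1 = y2 \<longleftrightarrow> ev x w v = 0"
      using sx[OF *(1)] sx[OF *(4)] by (simp add: * v_def ev_diff ev_smult frac_eq_eq mult.commute)
    also have "\<dots> \<longleftrightarrow> ev xx ww v = 0" by (rule good_ev_eq_0_iff[OF gw good_xx_ww])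
    also have "\<dots> \<longleftrightarrow> z1 = z2"
      using * by (simp add: v_def ev_diff ev_smult frac_eq_eq mult.commute sub_emb_poly)
    finally show ?thesis .
  qed
  have rel_ex: "\<exists>y\<in>LL. rel z y" if z: "z \<in> LL" for z
  proof -
    obtain u g where "g \<noteq> 0" "z = ev xx ww u / emb_poly g" using LL_reduced[OF z] by blast
    moreover have "ev x w u / sub x g \<in> LL"
      using ev_in_subfield[OF LL_subfield LL_const xL wL] by (intro LL_closed)
    ultimately show ?thesis by (auto simp: rel_def)
  qed
  have rel_surj: "\<exists>z\<in>LL. rel z y" if y: "y \<in> LL" for y
  proof -
    obtain u g where u: "g \<noteq> 0" "y = ev xx ww u / emb_poly g" using LL_reduced[OF y] by blast
    \<comment> \<open>Surjectivity comes from the inverse substitution X -> X - d, W -> W - h(X -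
      d).\<close>
    define u' where "u' = pcompose (map_poly (shift (- d)) u) [:- shift (- d) h, 1:]"
    define g' where "g' = shift (- d) g"
    have sg: "sub x (shift (- d) g) = sub xx g" for g
      by (simp add: x_def shift_def sub_pcompose sub_pCons emb_const_uminus)
    have "ev x w [:- shift (- d) h, 1:] = ww"
      by (simp add: ev_pCons sub_uminus sg w_def)
    then have "ev x w u' = ev xx ww u"
      unfolding u'_def ev_pcompose by (simp add: x_def sub_map_shift)
    moreover have "g' \<noteq> 0" using u(1) unfolding g'_def shift_def by (subst pcompose_eq_0_iff) auto
    ultimately have "rel (ev xx ww u' / emb_poly g') y"
      unfolding rel_def u(2) by (intro exI[of _ u'] exI[of _ g']) (simp add: g'_def sg sub_emb_poly)
    moreover have "ev xx ww u' / emb_poly g' \<in> LL"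
      using fractionsI[OF \<open>g' \<noteq> 0\<close>] by (simp add: function_field_eq)
    ultimately show ?thesis by blast
  qed
  define \<sigma> where "\<sigma> = (\<lambda>z\<in>LL. SOME y. rel z y)"
  have rel_\<sigma>: "rel z (\<sigma> z)" if "z \<in> LL" for z
    using rel_ex[OF that] that by (auto simp: \<sigma>_def intro: someI)
  have \<sigma>_eq: "\<sigma> z = y" if "rel z y" "z \<in> LL" for z y
    using rel_eq[OF rel_\<sigma>[OF that(2)] that(1)] by simp
  have \<sigma>_ev: "\<sigma> (ev xx ww u) = ev x w u" for u
  proof (rule \<sigma>_eq)
    show "rel (ev xx ww u) (ev x w u)"
      unfolding rel_def by (intro exI[of _ u] exI[of _ 1]) (simp add: emb_poly_1)
    show "ev xx ww u \<in> LL" using ev_in_subfield(1)[OF LL_subfield LL_const LL_xx LL_ww] .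
  qed
  have "bij_betw \<sigma> LL LL"
    unfolding bij_betw_def
  proof
    show "inj_on \<sigma> LL" using rel_eq rel_\<sigma> by (intro inj_onI) metis
    show "\<sigma> ` LL = LL"
    proof (intro equalityI subsetI)
      fix y assume "y \<in> \<sigma> ` LL"
      then obtain z where "z \<in> LL" "y = \<sigma> z" by blast
      then show "y \<in> LL" using rel_ex[of z] \<sigma>_eq by metis
    next
      fix y assume "y \<in> LL"
      then obtain z where "z \<in> LL" "rel z y" using rel_surj by blast
      then show "y \<in> \<sigma> ` LL" using \<sigma>_eq by blast
    qed
  qed
  then have "\<sigma> \<in> Bij LL" by (simp add: Bij_def \<sigma>_def)
  moreover have "\<sigma> (y + z) = \<sigma> y + \<sigma> z" "\<sigma> (y * z) = \<sigma> y * \<sigma> z" if yz: "y \<in> LL" "z \<in> LL" for y z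
  proof -
    obtain u g u' g' where y: "g \<noteq> 0" "y = ev xx ww u / emb_poly g" "\<sigma> y = ev x w u / sub x g"
      and z: "g' \<noteq> 0" "z = ev xx ww u' / emb_poly g'" "\<sigma> z = ev x w u' / sub x g'"
      using rel_\<sigma>[OF yz(1)] rel_\<sigma>[OF yz(2)] by (auto simp: rel_def)
    have nz: "g * g' \<noteq> 0" "emb_poly g \<noteq> 0" "emb_poly g' \<noteq> 0" using y z by auto
    show "\<sigma> (y + z) = \<sigma> y + \<sigma> z"
    proof (rule \<sigma>_eq)
      show "rel (y + z) (\<sigma> y + \<sigma> z)"
        unfolding rel_def y(3) z(3) add_frac_eq[OF sx[OF y(1)] sx[OF z(1)]]
        unfolding y(2) z(2) add_frac_eq[OF nz(2,3)]
        by (intro exI[of _ "smult g' u + smult g u'"] exI[of _ "g * g'"] conjI nz(1))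
          (simp_all only: ev_add ev_smult sub_emb_poly emb_poly_mult sub_mult mult.commute)
    qed (intro LL_closed yz)
    show "\<sigma> (y * z) = \<sigma> y * \<sigma> z"
    proof (rule \<sigma>_eq)
      show "rel (y * z) (\<sigma> y * \<sigma> z)"
        unfolding rel_def y(3) z(3)
        unfolding y(2) z(2)
        by (intro exI[of _ "u * u'"] exI[of _ "g * g'"] conjI nz(1))
          (simp_all only: ev_mult sub_emb_poly emb_poly_mult sub_mult times_divide_times_eq)
    qed (intro LL_closed yz)
  qed
  moreover have "\<sigma> (emb_const c) = emb_const c" for c using \<sigma>_ev[of "[:[:c:]:]"] by simp
  ultimately have "\<sigma> \<in> carrier (aut_group f)" by (simp add: carrier_aut_group_iff)
  moreover have "\<sigma> xx = xx + emb_const d" using \<sigma>_ev[of "[:[:0, 1:]:]"] by (simp add: sub_pCons x_def)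
  moreover have "\<sigma> ww = ww + sub xx h" using \<sigma>_ev[of "[:0, 1:]"] by (simp add: ev_pCons w_def)
  ultimately show ?thesis by blast
qed

text \<open>The preimage of the ring at infinity is a valuation ring in which X still has a pole, so
  uniqueness applies.\<close>

lemma translation_aut_ring_infinity:
  assumes \<sigma>: "\<sigma> \<in> carrier (aut_group f)" "\<sigma> xx = xx + emb_const d" and z: "z \<in> LL"
  shows "\<sigma> z \<in> ring_infinity \<longleftrightarrow> z \<in> ring_infinity"
proof -
  define A where "A = {z\<in>LL. \<sigma> z \<in> ring_infinity}"
  have "is_valuation_ring LL A"
    unfolding A_def by (rule aut_preimage_valuation_ring[OF \<sigma>(1) ring_infinity(1)])
  moreover have "xx \<notin> A"
  proof
    assume "xx \<in> A"
    then have "xx + emb_const d \<in> ring_infinity" using \<sigma>(2) by (simp add: A_def)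
    moreover have "emb_const d \<in> ring_infinity" "is_subring ring_infinity"
      using ring_infinity(1) by (auto simp: is_valuation_ring_def)
    ultimately have "xx + emb_const d - emb_const d \<in> ring_infinity" by (intro subring_diff)
    then show False using ring_infinity(2) by simp
  qed
  ultimately have "A = ring_infinity" by (rule ring_infinityI)
  then show ?thesis using z by (auto simp: A_def)
qed

text \<open>\<open>k[X,W]\<close> is integrally closed: the differences \<open>\<tau> z - z\<close> with \<open>\<tau> W = W + 1\<close> lower the degree
  in \<open>W\<close>, so the leading coefficient of a function regular away from infinity is regular as well.\<close>

lemma regular_imp_polynomial:
  assumes "g \<noteq> 0" "degree u < p"
    and "\<And>A. is_valuation_ring LL A \<Longrightarrow> xx \<in> A \<Longrightarrow> ev xx ww u / emb_poly g \<in> A"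
  shows "\<exists>v. degree v < p \<and> ev xx ww u / emb_poly g = ev xx ww v"
proof -
  \<comment> \<open>The generator W -> W + 1 of the Galois group over k(X) is the case d = 0, h =
    1.\<close>
  have "shift 0 f - f = 1 ^ p - 1" by (simp add: shift_0)
  from ex_translation_aut[OF this] obtain \<tau> where
    \<tau>: "\<tau> \<in> carrier (aut_group f)" "\<tau> xx = xx" "\<tau> ww = ww + 1" by auto
  define regular where "regular z \<longleftrightarrow> (\<forall>A. is_valuation_ring LL A \<longrightarrow> xx \<in> A \<longrightarrow> z \<in> A)" for z
  have sr: "is_subring A" if "is_valuation_ring LL A" for A using that by (simp add: is_valuation_ring_def)
  have reg_diff: "regular (y - z)" if "regular y" "regular z" for y z
    using that sr subring_diff unfolding regular_def by blast
  have reg_mult: "regular (y * z)" if "regular y" "regular z" for y z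
    using that sr subring_mult unfolding regular_def by blast
  have reg_const: "regular (emb_const c)" for c
    by (auto simp: regular_def is_valuation_ring_def)
  have reg_ww: "regular (ww ^ n)" for n
    using ww_in_valuation_ring sr subring_power unfolding regular_def by blast
  have reg_\<tau>: "regular (\<tau> z)" if z: "z \<in> LL" "regular z" for z
    unfolding regular_def
  proof (intro allI impI)
    fix A assume A: "is_valuation_ring LL A" "xx \<in> A"
    have "is_valuation_ring LL {z\<in>LL. \<tau> z \<in> A}" "xx \<in> {z\<in>LL. \<tau> z \<in> A}"
      using aut_preimage_valuation_ring[OF \<tau>(1) A(1)] A(2) \<tau>(2) LL_xx by auto
    then show "\<tau> z \<in> A" using z(2) unfolding regular_def by blast
  qed
  \<comment> \<open>Applying tau - 1 lowers the degree bound in W from d + 1 to d and multiplies the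
    leading coefficient by d + 1, which is invertible in k as d + 1 < p.\<close>
  have lead: "regular (emb_poly (coeff u d) / emb_poly g)"
    if "d < p" "degree u \<le> d" "g \<noteq> 0" "regular (ev xx ww u / emb_poly g)" for d g and u :: "'k poly poly"
    using that
  proof (induction d arbitrary: u)
    case 0
    then have "u = [:coeff u 0:]" by (metis degree_0_id le_zero_eq)
    then have "ev xx ww u = emb_poly (coeff u 0)" by (metis ev_const sub_emb_poly)
    then show ?case using 0 by simp
  next
    case (Suc d)
    define v where "v = shift 1 u - u"
    have "\<tau> (ev xx ww u / emb_poly g) = ev xx (ww + 1) u / emb_poly g"
      using aut_fraction[OF \<tau>(1), of u g] \<tau> by (simp add: sub_emb_poly)
    also have "ev xx (ww + 1) u = ev xx ww (shift 1 u)"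
      by (simp add: shift_def ev_pcompose ev_pCons add.commute)
    finally have "\<tau> (ev xx ww u / emb_poly g) - ev xx ww u / emb_poly g = ev xx ww v / emb_poly g"
      by (simp add: v_def ev_diff diff_divide_distrib)
    moreover have "ev xx ww u / emb_poly g \<in> LL"
      using fractionsI[OF \<open>g \<noteq> 0\<close>] by (simp add: function_field_eq)
    ultimately have regv: "regular (ev xx ww v / emb_poly g)"
      using Suc.prems(4) reg_\<tau> reg_diff by metis
    have vd: "degree v \<le> d"
    proof (cases "degree u = 0")
      case True
      then show ?thesis by (simp add: v_def degree_diff_le)
    next
      case False
      then show ?thesis using degree_shift_diff[of u 1] Suc.prems(2) by (simp add: v_def)
    qed
    have "degree (shift_coeff d u) \<le> 1"
      using degree_shift_coeff[of d u] Suc.prems(2) by simp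
    then have "coeff (shift 1 u) d = (\<Sum>i\<le>1. coeff (shift_coeff d u) i)"
      unfolding poly_shift_coeff[symmetric] poly_altdef power_one mult_1_right
      by (intro sum.mono_neutral_left) (auto simp: coeff_eq_0)
    also have "\<dots> = coeff u d + coeff u (Suc d) * of_nat (Suc d)"
      by (simp add: coeff_shift_coeff)
    finally have "coeff v d = of_nat (Suc d) * coeff u (Suc d)"
      by (simp add: v_def mult.commute)
    also have "of_nat (Suc d) = [:of_nat (Suc d) :: 'k:]" by (rule of_nat_poly)
    finally have cv: "emb_poly (coeff v d) = emb_const (of_nat (Suc d)) * emb_poly (coeff u (Suc d))"
      by (simp only: emb_poly_mult emb_const_def)
    have "\<not> p dvd Suc d" using Suc.prems(1) by (auto dest: dvd_imp_le)
    then have nz: "(of_nat (Suc d) :: 'k) \<noteq> 0"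
      by (simp add: of_nat_eq_0_iff_char_dvd char_p del: of_nat_Suc)
    have "regular (emb_poly (coeff v d) / emb_poly g)"
      using Suc.IH[OF _ vd Suc.prems(3) regv] Suc.prems(1) by simp
    then have "regular (emb_const (inverse (of_nat (Suc d))) * (emb_poly (coeff v d) / emb_poly g))"
      using reg_const by (intro reg_mult)
    moreover have "emb_const (inverse (of_nat (Suc d))) * (emb_poly (coeff v d) / emb_poly g)
       = emb_poly (coeff u (Suc d)) / emb_poly g"
      unfolding cv emb_const_inverse using nz by (simp del: of_nat_Suc)
    ultimately show ?case by metis
  qed
  have "\<exists>v. degree v \<le> d \<and> ev xx ww u / emb_poly g = ev xx ww v"
    if "d < p" "degree u \<le> d" "g \<noteq> 0" "regular (ev xx ww u / emb_poly g)" for d g and u :: "'k poly poly"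
    using that
  proof (induction d arbitrary: u)
    case 0
    have "g dvd coeff u 0"
      using lead[OF 0] 0(3) unfolding regular_def by (intro polynomial_if_regular) auto
    then obtain q where q: "coeff u 0 = g * q" by (rule dvdE)
    have "u = [:coeff u 0:]" using 0 by (metis degree_0_id le_zero_eq)
    then have "ev xx ww u = emb_poly g * emb_poly q" by (metis ev_const sub_emb_poly q emb_poly_mult)
    then have "ev xx ww u / emb_poly g = ev xx ww [:q:]" using 0(3) by (simp add: sub_emb_poly)
    then show ?case by (intro exI[of _ "[:q:]"]) simp
  next
    case (Suc d)
    \<comment> \<open>The leading coefficient over g is a regular rational function in X, hence a
      polynomial q, and the term q W^(d+1) can be split off.\<close>
    have "g dvd coeff u (Suc d)"
      using lead[OF Suc.prems] Suc.prems(3) unfolding regular_def by (intro polynomial_if_regular) auto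
    then obtain q where q: "coeff u (Suc d) = g * q" by (rule dvdE)
    define u' where "u' = u - monom (g * q) (Suc d)"
    have mon: "ev xx ww (monom a n) = emb_poly a * ww ^ n" for a n
      by (induction n) (simp_all add: monom_0 monom_Suc ev_pCons sub_emb_poly)
    have "degree u' \<le> d"
    proof (intro degree_le allI impI)
      fix i assume "d < i"
      then consider "i = Suc d" | "Suc d < i" by linarith
      then show "coeff u' i = 0"
        by cases (use Suc.prems(2) q in \<open>auto simp: u'_def coeff_eq_0\<close>)
    qed
    have eq: "ev xx ww u / emb_poly g = ev xx ww u' / emb_poly g + emb_poly q * ww ^ Suc d"
      using Suc.prems(3) by (simp add: u'_def ev_diff mon emb_poly_mult diff_divide_distrib)
    have "regular (emb_poly q)"
      unfolding regular_def
    proof (intro allI impI)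
      fix A assume A: "is_valuation_ring LL A" "xx \<in> A"
      then have "emb_const c \<in> A" for c by (auto simp: is_valuation_ring_def)
      then have "sub xx q \<in> A"
        using A(2) sr[OF A(1)]
        by (induction q) (auto simp: sub_pCons intro!: subring_0 subring_add subring_mult)
      then show "emb_poly q \<in> A" by (simp add: sub_emb_poly)
    qed
    then have "regular (ev xx ww u / emb_poly g - emb_poly q * ww ^ Suc d)"
      using Suc.prems(4) reg_ww by (intro reg_diff reg_mult)
    then have "regular (ev xx ww u' / emb_poly g)" unfolding eq by simp
    then obtain v where v: "degree v \<le> d" "ev xx ww u' / emb_poly g = ev xx ww v"
      using Suc.IH[OF _ \<open>degree u' \<le> d\<close> Suc.prems(3)] Suc.prems(1) by auto
    have "ev xx ww u / emb_poly g = ev xx ww (v + monom q (Suc d))"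
      unfolding eq v(2) by (simp only: ev_add mon)
    moreover have "degree (v + monom q (Suc d)) \<le> Suc d"
      using v(1) degree_monom_le[of q "Suc d"] by (intro degree_add_le) auto
    ultimately show ?case by blast
  qed
  note descend = this
  have "regular (ev xx ww u / emb_poly g)" using assms(3) unfolding regular_def by blast
  then obtain v where "degree v \<le> degree u" "ev xx ww u / emb_poly g = ev xx ww v"
    using descend[OF assms(2) order_refl assms(1)] by blast
  then show ?thesis using assms(2) by (intro exI[of _ v]) simp
qed

section \<open>Pole orders at infinity and the action of the inertia group\<close>

sublocale infinity: curve_valuation LL ring_infinity xx p K
  using infinite_curve_valuation[OF ring_infinity] .

abbreviation "po \<equiv> infinity.po"
abbreviation "pole_number \<equiv> infinity.pole_number m"

lemma po_ww: "po ww (int m)"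
  using infinite_po_ww[OF ring_infinity] .

lemma ex_po:
  assumes "z \<in> LL" "z \<noteq> 0"
  shows "\<exists>n. po z n"
proof -
  obtain u g where u: "g \<noteq> 0" "degree u < p" "z = ev xx ww u / emb_poly g"
    using LL_reduced[OF assms(1)] by blast
  then have "u \<noteq> 0" using assms(2) by auto
  then have "po (ev xx ww u / sub xx g) (int (pole_number u) - int (p * degree g))"
    using u by (intro infinity.po_divide infinity.po_ev infinity.po_sub po_ww m_coprime)
  then show ?thesis using u by (auto simp: sub_emb_poly)
qed

lemma po_power_int: "po z n \<Longrightarrow> po (z powi k) (k * n)"
  using infinity.po_power[of z n "nat k"] infinity.po_power[OF infinity.po_inverse, of z n "nat (- k)"]
  by (cases "k \<ge> 0") (auto simp: power_int_def)

lemma po_zero_iff: "po z 0 \<longleftrightarrow> z \<in> vunits ring_infinity"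
proof
  assume z: "po z 0"
  then show "z \<in> vunits ring_infinity"
    using infinity.po_in_A_iff[OF z] infinity.po_in_A_iff[OF infinity.po_inverse[OF z]]
    by (simp add: vunits_def infinity.po_def)
qed (rule infinity.po_unit)

text \<open>Bezout for the coprime pole orders p of X and m of W.\<close>

lemma ex_po_1: "\<exists>t. po t 1"
proof -
  have "coprime (int p) (int m)" using m_coprime prime_p by (simp add: prime_imp_coprime)
  then obtain a b where ab: "a * int p + b * int m = 1"
    using bezout_int[of "int p" "int m"] by auto
  have "po (xx powi a * ww powi b) (a * int p + b * int m)"
    by (intro infinity.po_mult po_power_int infinity.po_x po_ww)
  then show ?thesis using ab by auto
qed

text \<open>A valuation ring and its maximal ideal determine each other, so fixing the place amounts
  to preserving the ring.\<close>

lemma inertia_group_iff: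
  "\<sigma> \<in> carrier (inertia_group f) \<longleftrightarrow>
     \<sigma> \<in> carrier (aut_group f) \<and> (\<forall>z\<in>LL. \<sigma> z \<in> ring_infinity \<longleftrightarrow> z \<in> ring_infinity)"
proof (cases "\<sigma> \<in> carrier (aut_group f)")
  case True
  note s = True
  define P where "P = nonunits ring_infinity"
  have PL: "P \<subseteq> LL" using infinity.nonunits_subset infinity.subset by (auto simp: P_def)
  have ring: "z \<in> ring_infinity \<longleftrightarrow> z = 0 \<or> inverse z \<notin> P" if "z \<in> LL" for z
    using nonunits_determine[OF ring_infinity(1)] that unfolding P_def by blast
  have "\<sigma> ` P = P \<longleftrightarrow> (\<forall>z\<in>LL. \<sigma> z \<in> ring_infinity \<longleftrightarrow> z \<in> ring_infinity)"
  proof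
    assume eq: "\<sigma> ` P = P"
    show "\<forall>z\<in>LL. \<sigma> z \<in> ring_infinity \<longleftrightarrow> z \<in> ring_infinity"
    proof
      fix z assume z: "z \<in> LL"
      have iz: "inverse z \<in> LL" using z by (rule LL_closed)
      have "inverse (\<sigma> z) \<in> P \<longleftrightarrow> inverse z \<in> P"
      proof
        assume "inverse (\<sigma> z) \<in> P"
        then obtain y where y: "y \<in> P" "\<sigma> (inverse z) = \<sigma> y" using eq aut_inverse[OF s z] by (metis imageE)
        then have "inverse z = y" using aut_inj[OF s iz] PL by blast
        then show "inverse z \<in> P" using y by simp
      next
        assume "inverse z \<in> P"
        then have "\<sigma> (inverse z) \<in> P" using eq by blast
        then show "inverse (\<sigma> z) \<in> P" using aut_inverse[OF s z] by simp
      qed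
      then show "\<sigma> z \<in> ring_infinity \<longleftrightarrow> z \<in> ring_infinity"
        using ring[OF z] ring[OF aut_closed[OF s z]] aut_eq_0_iff[OF s z] by simp
    qed
  next
    assume *: "\<forall>z\<in>LL. \<sigma> z \<in> ring_infinity \<longleftrightarrow> z \<in> ring_infinity"
    have P: "\<sigma> z \<in> P \<longleftrightarrow> z \<in> P" if z: "z \<in> LL" for z
    proof -
      have iz: "inverse z \<in> LL" using z by (rule LL_closed)
      have "\<sigma> z \<in> ring_infinity \<longleftrightarrow> z \<in> ring_infinity" using * z by blast
      moreover have "inverse (\<sigma> z) \<in> ring_infinity \<longleftrightarrow> inverse z \<in> ring_infinity"
        using * iz unfolding aut_inverse[OF s z, symmetric] by blast
      ultimately show ?thesis by (simp only: P_def nonunits_def mem_Collect_eq aut_eq_0_iff[OF s z])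
    qed
    show "\<sigma> ` P = P"
    proof (intro equalityI subsetI)
      fix y assume y: "y \<in> P"
      then obtain z where "z \<in> LL" "\<sigma> z = y" using aut_surj[OF s] PL by blast
      then show "y \<in> \<sigma> ` P" using P y by blast
    qed (use P PL in blast)
  qed
  then show ?thesis using True by (simp add: inertia_group_def place_infinity_eq P_def)
qed (simp add: inertia_group_def)

context
  fixes \<sigma>
  assumes \<sigma>: "\<sigma> \<in> carrier (inertia_group f)"
begin

lemma inertia_aut: "\<sigma> \<in> carrier (aut_group f)"
  using \<sigma> by (simp add: inertia_group_iff)

lemma inertia_ring: "z \<in> LL \<Longrightarrow> \<sigma> z \<in> ring_infinity \<longleftrightarrow> z \<in> ring_infinity"
  using \<sigma> by (simp add: inertia_group_iff)

lemma inertia_unit: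
  assumes z: "z \<in> LL"
  shows "\<sigma> z \<in> vunits ring_infinity \<longleftrightarrow> z \<in> vunits ring_infinity"
  using inertia_ring[OF z] inertia_ring[OF LL_closed(8)[OF z]] aut_inverse[OF inertia_aut z]
    aut_eq_0_iff[OF inertia_aut z] by (auto simp: vunits_def)

text \<open>The value group is \<open>\<int>\<close>, whose only order preserving automorphism is the identity.\<close>

lemma inertia_po:
  assumes z: "po z n"
  shows "po (\<sigma> z) n"
proof -
  note s = inertia_aut
  \<comment> \<open>The quotient of y by t^k is a unit and stays one, so the automorphism multiplies
    every pole order by the order i of the image of t.\<close>
  have transport: "po (\<sigma> y) (k * i)" if y: "po y k" and t: "po t 1" "po (\<sigma> t) i" for y k t i
  proof -
    have yL: "y \<in> LL" "t \<in> LL" "y \<noteq> 0" "t \<noteq> 0" using y t by (auto simp: infinity.po_def)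
    have "po (y * t powi (- k)) (k + - k * 1)" by (intro infinity.po_mult po_power_int y t)
    then have "po (y * t powi (- k)) 0" by simp
    moreover have L: "y * t powi (- k) \<in> LL" using yL by (intro LL_closed)
    ultimately have "po (\<sigma> (y * t powi (- k))) 0" by (simp add: po_zero_iff inertia_unit)
    then have "po (\<sigma> (y * t powi (- k)) * \<sigma> t powi k) (0 + k * i)"
      by (intro infinity.po_mult po_power_int t)
    moreover have "\<sigma> (y * t powi (- k)) * \<sigma> t powi k = \<sigma> y"
    proof -
      have "\<sigma> t \<noteq> 0" using aut_eq_0_iff[OF s] yL by simp
      then show ?thesis
        using yL by (simp add: aut_mult[OF s] aut_power_int[OF s] LL_closed(10)) (simp add: power_int_minus)
    qed
    ultimately show ?thesis by simp
  qed
  obtain t where t: "po t 1" using ex_po_1 by blast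
  have tL: "t \<in> LL" "t \<noteq> 0" using t by (auto simp: infinity.po_def)
  obtain i where i: "po (\<sigma> t) i"
    using ex_po[OF aut_closed[OF s tL(1)]] aut_eq_0_iff[OF s tL(1)] tL by blast
  \<comment> \<open>The preimage of t shows that i divides 1; the sign is settled because t, and
    with it its image, has a pole.\<close>
  obtain r where r: "r \<in> LL" "\<sigma> r = t" using aut_surj[OF s tL(1)] by blast
  have "r \<noteq> 0" using r tL aut_0[OF s] by auto
  then obtain j where j: "po r j" using ex_po r by blast
  have "po t (j * i)" using transport[OF j t i] r by simp
  then have ji: "j * i = 1" using infinity.po_unique t by blast
  have "\<not> i \<le> 0"
    using infinity.po_in_A_iff[OF i] infinity.po_in_A_iff[OF t] inertia_ring[OF tL(1)] by simp
  moreover have "i = 1 \<or> i = - 1" using ji by (auto simp: zmult_eq_1_iff)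
  ultimately have "i = 1" by auto
  then show ?thesis using transport[OF z t i] by simp
qed

text \<open>Preimages of the valuation rings containing X again contain X, for otherwise they would
  be the ring at infinity. So the image has no finite poles and
  \<open>regular_imp_polynomial\<close> applies.\<close>

lemma inertia_regular:
  assumes z: "z \<in> LL" and reg: "\<And>A. is_valuation_ring LL A \<Longrightarrow> xx \<in> A \<Longrightarrow> z \<in> A"
  shows "\<exists>v. degree v < p \<and> \<sigma> z = ev xx ww v"
proof -
  note s = inertia_aut
  obtain u g where u: "g \<noteq> 0" "degree u < p" "\<sigma> z = ev xx ww u / emb_poly g"
    using LL_reduced[OF aut_closed[OF s z]] by blast
  have "\<sigma> z \<in> A" if A: "is_valuation_ring LL A" "xx \<in> A" for A
  proof -
    define B where "B = {y\<in>LL. \<sigma> y \<in> A}"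
    have B: "is_valuation_ring LL B" unfolding B_def by (rule aut_preimage_valuation_ring[OF s A(1)])
    have "xx \<in> B"
    proof (rule ccontr)
      assume "xx \<notin> B"
      then have eq: "B = ring_infinity" using B ring_infinityI by blast
      obtain y where y: "y \<in> LL" "\<sigma> y = xx" using aut_surj[OF s LL_xx] by blast
      then have "y \<in> B" using A(2) by (simp add: B_def)
      then have "\<sigma> y \<in> ring_infinity" using inertia_ring[OF y(1)] unfolding eq by blast
      then show False using ring_infinity(2) unfolding y(2) by blast
    qed
    then have "z \<in> B" using reg B by blast
    then show ?thesis by (simp add: B_def)
  qed
  then show ?thesis using regular_imp_polynomial[OF u(1,2)] unfolding u(3) by blast
qed

end

lemma pole_number_ge: "coeff u i \<noteq> 0 \<Longrightarrow> p * degree (coeff u i) + m * i \<le> pole_number u"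
proof -
  assume i: "coeff u i \<noteq> 0"
  have "finite {i. coeff u i \<noteq> 0}"
    by (rule finite_subset[of _ "{..degree u}"]) (auto intro: le_degree)
  then show ?thesis unfolding infinity.pole_number_def using i by (intro Max_ge) auto
qed

lemma pole_number_attained:
  assumes "u \<noteq> 0"
  shows "\<exists>i. coeff u i \<noteq> 0 \<and> pole_number u = p * degree (coeff u i) + m * i"
proof -
  have "finite {i. coeff u i \<noteq> 0}"
    by (rule finite_subset[of _ "{..degree u}"]) (auto intro: le_degree)
  moreover have "{i. coeff u i \<noteq> 0} \<noteq> {}" using assms by (auto simp: poly_eq_iff)
  ultimately have "pole_number u \<in> (\<lambda>i. p * degree (coeff u i) + m * i) ` {i. coeff u i \<noteq> 0}"
    unfolding infinity.pole_number_def by (intro Max_in) auto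
  then show ?thesis by auto
qed

text \<open>An upper bound for the pole order, also meaningful for \<open>0\<close>. In characteristic \<open>p\<close> it is stable
  under addition because \<open>z \<mapsto> z\<^sup>p\<close> is additive.\<close>

definition ple :: "'k rat_closure \<Rightarrow> int \<Rightarrow> bool" where
  "ple z n \<longleftrightarrow> z \<in> LL \<and> z ^ p * xx powi (- n) \<in> ring_infinity"

lemma po_imp_ple: "po z n \<Longrightarrow> ple z n"
  by (auto simp: infinity.po_def ple_def vunits_def)

lemma ple_0: "ple 0 n"
  using p_pos by (simp add: ple_def LL_closed(1) infinity.A_closed(1) power_0_left)

lemma ple_add:
  assumes "ple y n" "ple z n"
  shows "ple (y + z) n"
  using assms infinity.A_closed(3) by (auto simp: ple_def frobenius_add_closure distrib_right LL_closed(3))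

lemma ple_mult:
  assumes "ple y a" "ple z b"
  shows "ple (y * z) (a + b)"
proof -
  have "(y ^ p * xx powi (- a)) * (z ^ p * xx powi (- b)) \<in> ring_infinity"
    using assms infinity.A_closed(4) unfolding ple_def by blast
  moreover have "xx powi (- (a + b)) = xx powi (- a) * xx powi (- b)"
    using infinity.x_nz by (subst power_int_add[symmetric]) auto
  then have "(y ^ p * xx powi (- a)) * (z ^ p * xx powi (- b)) = (y * z) ^ p * xx powi (- (a + b))"
    by (simp add: power_mult_distrib)
  ultimately show ?thesis using assms by (simp add: ple_def LL_closed(4))
qed

lemma ple_mono:
  assumes "ple z a" "a \<le> b"
  shows "ple z b"
proof -
  have "(z ^ p * xx powi (- a)) * xx powi (a - b) \<in> ring_infinity"
    using assms infinity.A_closed(4) infinity.power_int_x_in_A_iff[of "a - b"] unfolding ple_def by simp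
  moreover have "xx powi (- b) = xx powi (- a) * xx powi (a - b)"
    using infinity.x_nz by (subst power_int_add[symmetric]) auto
  ultimately show ?thesis using assms by (simp add: ple_def mult.assoc)
qed

lemma po_ple_le:
  assumes "po z n" "ple z k"
  shows "n \<le> k"
proof -
  have "po (z ^ p * xx powi (- k)) (int p * n + - k * int p)"
    by (intro infinity.po_mult infinity.po_power po_power_int infinity.po_x assms)
  then have "int p * n + - k * int p \<le> 0"
    using infinity.po_in_A_iff assms(2) by (simp add: ple_def)
  then have "int p * n \<le> int p * k" by (simp add: algebra_simps)
  then show ?thesis using p_pos by simp
qed

lemma po_add_ple:
  assumes "po y n" "ple z k" "k < n"
  shows "po (y + z) n"
proof (cases "z = 0")
  case False
  then obtain j where "po z j" using ex_po assms(2) by (auto simp: ple_def)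
  then show ?thesis using assms po_ple_le by (intro infinity.po_add) force+
qed (use assms in simp)

lemma po_sub_affine:
  assumes y: "po y (int p)" "y = sub xx [:d, c:]" and g: "g \<noteq> 0" and c: "c \<noteq> 0"
  shows "po (sub y g) (int (p * degree g))"
proof -
  have "sub y g = sub xx (pcompose g [:d, c:])" by (simp add: y(2) sub_pcompose)
  moreover have "degree (pcompose g [:d, c:]) = degree g" using c by (simp add: degree_pcompose)
  moreover have "pcompose g [:d, c:] \<noteq> 0" using g c by (subst pcompose_eq_0_iff) auto
  ultimately show ?thesis using infinity.po_sub by metis
qed

text \<open>Every term beyond first order contains q at least twice. As q has order at most k, which
  does not exceed the order p of y, trading further factors y for q never raises the bound.\<close>

lemma taylor_remainder:
  assumes y: "po y (int p)" "y = sub xx [:d, c:]" "c \<noteq> 0" and q: "ple q k" "k \<le> int p" and deg: "degree g \<le> n"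
  shows "ple (sub (y + q) g - sub y g - q * sub y (pderiv g)) (int p * (int n - 2) + 2 * k)"
  using deg
proof (induction n arbitrary: g)
  case 0
  then obtain a where "g = [:a:]" by (metis degree_eq_zeroE le_zero_eq)
  then show ?case by (simp add: ple_0 pderiv_pCons)
next
  case (Suc n)
  obtain a g1 where g: "g = pCons a g1" by (cases g)
  have dg: "degree g1 \<le> n" using Suc.prems by (cases "g1 = 0") (auto simp: g)
  define E where "E = sub (y + q) g1 - sub y g1 - q * sub y (pderiv g1)"
  have E: "ple E (int p * (int n - 2) + 2 * k)" unfolding E_def by (rule Suc.IH[OF dg])
  have "ple (y * E) (int p + (int p * (int n - 2) + 2 * k))"
    by (intro ple_mult po_imp_ple y(1) E)
  then have 1: "ple (y * E) (int p * (int (Suc n) - 2) + 2 * k)" by (simp add: algebra_simps)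
  have "ple (q * E) (k + (int p * (int n - 2) + 2 * k))" by (intro ple_mult q(1) E)
  then have 2: "ple (q * E) (int p * (int (Suc n) - 2) + 2 * k)"
    by (rule ple_mono) (use q(2) in \<open>simp add: algebra_simps\<close>)
  have 3: "ple (q * q * sub y (pderiv g1)) (int p * (int (Suc n) - 2) + 2 * k)"
  proof (cases "pderiv g1 = 0")
    case True
    then show ?thesis by (simp add: ple_0)
  next
    case False
    have "degree (pderiv g1) \<le> degree g1 - 1"
      by (rule degree_le) (auto simp: coeff_pderiv coeff_eq_0)
    moreover have "degree g1 > 0"
    proof (rule ccontr)
      assume "\<not> degree g1 > 0"
      then obtain b where "g1 = [:b:]" by (auto elim: degree_eq_zeroE)
      then show False using False by (simp add: pderiv_pCons)
    qed
    ultimately have dn: "int (degree (pderiv g1)) \<le> int n - 1" using dg by linarith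
    have "ple (q * q * sub y (pderiv g1)) (k + k + int (p * degree (pderiv g1)))"
      by (intro ple_mult q(1) po_imp_ple po_sub_affine[OF y(1,2) False y(3)])
    then show ?thesis
    proof (rule ple_mono)
      have "int p * int (degree (pderiv g1)) \<le> int p * (int n - 1)"
        using dn by (intro mult_left_mono) auto
      then show "k + k + int (p * degree (pderiv g1)) \<le> int p * (int (Suc n) - 2) + 2 * k"
        by (simp add: algebra_simps)
    qed
  qed
  \<comment> \<open>Horner step for g = a + X g1: the remainder of g is y + q times that of g1, plus
    q^2 g1'(y).\<close>
  have "sub (y + q) g - sub y g - q * sub y (pderiv g) = y * E + q * E + q * q * sub y (pderiv g1)"
    by (simp add: g E_def sub_pCons pderiv_pCons sub_add algebra_simps)
  then show ?case using ple_add[OF ple_add[OF 1 2] 3] by simp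
qed

section \<open>The wild inertia group\<close>

lemma sub_xx_inj: "sub xx g = sub xx h \<longleftrightarrow> g = h"
  using transc_emb_poly sub_diff[of xx g h] by (auto simp: transc_def)

text \<open>A monomial X^a W^i costs p a + m i, and only p is available: X occurs at most linearly
  and never together with W. For m < p pure powers of W remain possible and are collected in Q. The
  coefficient c is nonzero because p = m i has no solution with i < p.\<close>

lemma inertia_form_xx:
  assumes \<sigma>: "\<sigma> \<in> carrier (inertia_group f)"
  shows "\<exists>c d Q. c \<noteq> 0 \<and> coeff Q 0 = 0 \<and> m * degree Q \<le> p \<and> \<sigma> xx = sub xx [:d, c:] + sub ww Q"
proof -
  obtain u where u: "degree u < p" "\<sigma> xx = ev xx ww u"
    using inertia_regular[OF \<sigma> LL_xx] by blast
  have po: "po (ev xx ww u) (int p)" using inertia_po[OF \<sigma> infinity.po_x] u by simp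
  then have u0: "u \<noteq> 0" by (auto simp: infinity.po_def)
  have "po (ev xx ww u) (int (pole_number u))" by (intro infinity.po_ev po_ww m_coprime u0 u)
  then have "int p = int (pole_number u)" by (rule infinity.po_unique[OF po])
  then have pn: "pole_number u = p" by simp
  have bound: "p * degree (coeff u i) + m * i \<le> p" if "coeff u i \<noteq> 0" for i
    using pole_number_ge[OF that] pn by simp
  have const: "degree (coeff u i) = 0" if "i > 0" for i
  proof (cases "coeff u i = 0")
    case False
    have "m * i > 0" using that m_ge_2 by simp
    then have "p * degree (coeff u i) < p * 1" using bound[OF False] by linarith
    then show ?thesis by (simp only: mult_less_cancel1) simp
  qed simp
  have lin: "degree (coeff u 0) \<le> 1"
  proof (cases "coeff u 0 = 0")
    case False
    then show ?thesis using bound[OF False] p_pos by simp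
  qed simp
  define d c where "d = coeff (coeff u 0) 0" and "c = coeff (coeff u 0) 1"
  have u0_eq: "coeff u 0 = [:d, c:]"
    using lin by (intro poly_eqI) (auto simp: d_def c_def coeff_pCons coeff_eq_0 split: nat.splits)
  define Q where "Q = map_poly (\<lambda>g. coeff g 0) (u - [:coeff u 0:])"
  have Q0: "coeff Q 0 = 0" by (simp add: Q_def coeff_map_poly)
  have Qi: "coeff Q i = coeff (coeff u i) 0" if "i > 0" for i
    using that by (cases i) (simp_all add: Q_def coeff_map_poly)
  have "u = [:coeff u 0:] + map_poly (\<lambda>a. [:a:]) Q"
  proof (rule poly_eqI)
    fix i
    show "coeff u i = coeff ([:coeff u 0:] + map_poly (\<lambda>a. [:a:]) Q) i"
    proof (cases i)
      case 0
      then show ?thesis using Q0 by (simp add: coeff_map_poly)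
    next
      case (Suc j)
      then show ?thesis using Qi[of i] degree_0_id[OF const[of i]] by (simp add: coeff_map_poly)
    qed
  qed
  then have "ev xx ww u = sub xx (coeff u 0) + ev xx ww (map_poly (\<lambda>a. [:a:]) Q)"
    by (metis ev_add ev_const)
  also have "ev xx ww (map_poly (\<lambda>a. [:a:]) Q) = sub ww Q" by (rule ev_map_const)
  finally have "\<sigma> xx = sub xx [:d, c:] + sub ww Q" using u u0_eq by simp
  moreover have "m * degree Q \<le> p"
  proof (cases "degree Q = 0")
    case False
    then have "coeff Q (degree Q) \<noteq> 0" by auto
    then have "coeff u (degree Q) \<noteq> 0" using Qi[of "degree Q"] False by auto
    then show ?thesis using bound by fastforce
  qed simp
  moreover have "c \<noteq> 0"
  proof
    assume "c = 0"
    obtain i where i: "coeff u i \<noteq> 0" "p = p * degree (coeff u i) + m * i"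
      using pole_number_attained[OF u0] pn by auto
    show False
    proof (cases "i = 0")
      case True
      then show ?thesis using i(2) \<open>c = 0\<close> u0_eq p_pos by simp
    next
      case False
      then have "p = m * i" using i(2) const[of i] by simp
      then have "p dvd m * i" by simp
      then have "p dvd i" using m_coprime prime_p by (simp add: prime_dvd_mult_iff)
      moreover have "i < p" using le_degree[OF i(1)] u(1) by simp
      ultimately show False using False by (auto dest: dvd_imp_le)
    qed
  qed
  ultimately show ?thesis using Q0 by blast
qed

text \<open>The same count with m available leaves room only for a multiple of W and a polynomial in
  X of degree at most m/p.\<close>

lemma inertia_form_ww:
  assumes \<sigma>: "\<sigma> \<in> carrier (inertia_group f)"
  shows "\<exists>a h. p * degree h \<le> m \<and> \<sigma> ww = emb_const a * ww + sub xx h"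
proof -
  obtain v where v: "degree v < p" "\<sigma> ww = ev xx ww v"
    using inertia_regular[OF \<sigma> LL_ww] ww_in_valuation_ring by blast
  have po: "po (ev xx ww v) (int m)" using inertia_po[OF \<sigma> po_ww] v by simp
  then have v0: "v \<noteq> 0" by (auto simp: infinity.po_def)
  have "po (ev xx ww v) (int (pole_number v))" by (intro infinity.po_ev po_ww m_coprime v0 v)
  then have "int m = int (pole_number v)" by (rule infinity.po_unique[OF po])
  then have pn: "pole_number v = m" by simp
  have bound: "p * degree (coeff v i) + m * i \<le> m" if "coeff v i \<noteq> 0" for i
    using pole_number_ge[OF that] pn by simp
  have high: "coeff v i = 0" if "i \<ge> 2" for i
  proof (rule ccontr)
    assume "coeff v i \<noteq> 0"
    then have "m * i \<le> m" using bound[of i] by linarith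
    moreover have "m * 2 \<le> m * i" using that by (rule mult_le_mono2)
    ultimately show False using m_ge_2 by simp
  qed
  have "degree (coeff v 1) = 0"
  proof (cases "coeff v 1 = 0")
    case False
    then show ?thesis using bound[OF False] p_pos by simp
  qed simp
  then obtain a where a: "coeff v 1 = [:a:]" by (auto elim: degree_eq_zeroE)
  have "v = [:coeff v 0, [:a:]:]"
    using high a by (intro poly_eqI) (auto simp: coeff_pCons split: nat.splits)
  then have "ev xx ww v = sub xx (coeff v 0) + ww * emb_const a"
    by (metis ev_pCons ev_0 sub_const mult_zero_right add_0_right)
  moreover have "p * degree (coeff v 0) \<le> m"
  proof (cases "coeff v 0 = 0")
    case False
    then show ?thesis using bound[OF False] by simp
  qed simp
  ultimately show ?thesis using v by (intro exI[of _ a] exI[of _ "coeff v 0"]) (simp add: algebra_simps)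
qed

text \<open>The task is to show Q = 0. By the curve equation f(y + q) - f(y) equals U = g(X) + b W.
  If Q were nonzero, the first Taylor term q f'(y) would give the left side the pole order k + p (m
  - 1) with k = m degree Q prime to p. On the right only multiples of p and the smaller number m are
  possible.\<close>

lemma inertia_form:
  assumes \<sigma>: "\<sigma> \<in> carrier (inertia_group f)"
  shows "\<exists>c d a h. c \<noteq> 0 \<and> \<sigma> xx = sub xx [:d, c:] \<and> \<sigma> ww = emb_const a * ww + sub xx h \<and>
    c ^ m = a \<and> a ^ p = a \<and> pcompose f [:d, c:] = smult a f + (h ^ p - h)"
proof -
  obtain c d Q where c: "c \<noteq> 0" and Q: "coeff Q 0 = 0" "m * degree Q \<le> p"
    and sx: "\<sigma> xx = sub xx [:d, c:] + sub ww Q"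
    using inertia_form_xx[OF \<sigma>] by blast
  obtain a h where h: "p * degree h \<le> m" and sw: "\<sigma> ww = emb_const a * ww + sub xx h"
    using inertia_form_ww[OF \<sigma>] by blast
  define y where "y = sub xx [:d, c:]"
  define q where "q = sub ww Q"
  define b where "b = a ^ p - a"
  define g where "g = smult (a ^ p) f + (h ^ p - h) - pcompose f [:d, c:]"
  define U where "U = [:g, [:b:]:]"
  have "sub (y + q) f = (emb_const a * ww + sub xx h) ^ p - (emb_const a * ww + sub xx h)"
    using aut_curve[OF inertia_aut[OF \<sigma>]] sx sw by (simp add: y_def q_def)
  also have "\<dots> = emb_const a ^ p * ww ^ p + sub xx h ^ p - (emb_const a * ww + sub xx h)"
    by (simp add: frobenius_add_closure power_mult_distrib)
  also have "ww ^ p = ww + sub xx f" using ww_eq by (simp add: diff_eq_eq add.commute)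
  also have "emb_const a ^ p = emb_const (a ^ p)"
    by (induction p) (simp_all add: emb_const_mult)
  also have "emb_const (a ^ p) * (ww + sub xx f) + sub xx h ^ p - (emb_const a * ww + sub xx h)
     = sub y f + ev xx ww U"
  proof -
    have "emb_const (a ^ p) = emb_const a + emb_const b"
      by (simp add: b_def flip: emb_const_add)
    moreover have "sub xx (smult (a ^ p) f) = emb_const (a ^ p) * sub xx f" by (rule sub_smult)
    ultimately show ?thesis
      by (simp add: U_def ev_pCons g_def y_def sub_add sub_diff sub_smult sub_power sub_pcompose algebra_simps)
  qed
  finally have eq: "sub (y + q) f - sub y f = ev xx ww U" by simp
  have dU: "degree U < p" using p_gt_1 by (simp add: U_def)
  have "Q = 0"
  proof (rule ccontr)
    assume Q_nz: "Q \<noteq> 0"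
    have dQ: "degree Q > 0"
      using Q(1) Q_nz by (metis degree_0_id gr0I pCons_0_0)
    have "degree Q < p"
    proof -
      have "2 * degree Q \<le> m * degree Q" using m_ge_2 by (rule mult_le_mono1)
      then show ?thesis using Q(2) dQ by linarith
    qed
    define k where "k = m * degree Q"
    have kp: "k \<le> p" "k > 0" using Q(2) dQ m_ge_2 by (auto simp: k_def)
    have pndvd: "\<not> p dvd k"
      unfolding k_def using m_coprime prime_p \<open>degree Q < p\<close> dQ
      by (auto simp: prime_dvd_mult_iff dest: dvd_imp_le)
    then have "k \<noteq> p" by auto
    with kp have kp': "k < p" by simp
    define u where "u = map_poly (\<lambda>a. [:a:]) Q"
    have cu: "coeff u i = [:coeff Q i:]" for i by (simp add: u_def coeff_map_poly)
    have qu: "q = ev xx ww u" by (simp add: q_def u_def ev_map_const)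
    have u0: "u \<noteq> 0" using Q_nz cu by (metis coeff_0 leading_coeff_0_iff pCons_eq_0_iff)
    have du: "degree u \<le> degree Q" unfolding u_def by (rule map_poly_degree_leq)
    have "pole_number u = k"
    proof (rule order_antisym)
      obtain i where "coeff u i \<noteq> 0" "pole_number u = p * degree (coeff u i) + m * i"
        using pole_number_attained[OF u0] by blast
      moreover from this have "i \<le> degree Q" using le_degree[of u i] du by simp
      ultimately show "pole_number u \<le> k" by (simp add: cu k_def)
      have "coeff u (degree Q) \<noteq> 0" using Q_nz by (simp add: cu)
      then show "k \<le> pole_number u" using pole_number_ge[of u "degree Q"] by (simp add: k_def)
    qed
    then have poq: "po q (int k)"
      using infinity.po_ev[OF po_ww m_coprime u0] du \<open>degree Q < p\<close> qu by simp
    have poy: "po y (int p)"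
      using infinity.po_sub[of "[:d, c:]"] c by (simp add: y_def)
    have cd: "coeff (pderiv f) (m - 1) = of_nat m * lead_coeff f"
      using m_ge_2 deg_f by (simp add: coeff_pderiv)
    have "lead_coeff f \<noteq> 0" using deg_f m_ge_2 by auto
    moreover have "(of_nat m :: 'k) \<noteq> 0" using m_coprime by (simp add: of_nat_eq_0_iff_char_dvd char_p)
    ultimately have cd': "coeff (pderiv f) (m - 1) \<noteq> 0" using cd by simp
    then have pd0: "pderiv f \<noteq> 0" by auto
    have "degree (pderiv f) \<le> m - 1"
      using deg_f by (intro degree_le) (auto simp: coeff_pderiv coeff_eq_0)
    then have pd: "degree (pderiv f) = m - 1" using cd' le_degree order_antisym by blast
    have "po (q * sub y (pderiv f)) (int k + int (p * (m - 1)))"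
      using po_sub_affine[OF poy y_def pd0 c] poq unfolding pd by (intro infinity.po_mult)
    moreover have "ple (sub (y + q) f - sub y f - q * sub y (pderiv f)) (int p * (int m - 2) + 2 * int k)"
      using taylor_remainder[OF poy y_def c po_imp_ple[OF poq]] kp deg_f by simp
    \<comment> \<open>The Taylor remainder is dominated exactly because k < p.\<close>
    moreover have "int p * (int m - 2) + 2 * int k < int k + int (p * (m - 1))"
    proof -
      have "int (p * (m - 1)) = int p * (int m - 1)" using m_ge_2 by (simp add: of_nat_diff)
      then show ?thesis using kp' by (simp add: algebra_simps)
    qed
    ultimately have "po (q * sub y (pderiv f) + (sub (y + q) f - sub y f - q * sub y (pderiv f)))
        (int k + int (p * (m - 1)))" by (rule po_add_ple)
    then have poU: "po (ev xx ww U) (int k + int (p * (m - 1)))" using eq by simp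
    then have U0: "U \<noteq> 0" by (auto simp: infinity.po_def)
    have "po (ev xx ww U) (int (pole_number U))" by (intro infinity.po_ev po_ww m_coprime U0 dU)
    then have "int (pole_number U) = int k + int (p * (m - 1))" using infinity.po_unique poU by blast
    then have pnU: "pole_number U = k + p * (m - 1)" by linarith
    obtain i where i: "coeff U i \<noteq> 0" "pole_number U = p * degree (coeff U i) + m * i"
      using pole_number_attained[OF U0] by blast
    then consider "i = 0" | "i = 1"
      by (auto simp: U_def coeff_pCons split: nat.splits)
    then show False
    proof cases
      case 1
      then have "k + p * (m - 1) = p * degree g" using i pnU by (simp add: U_def)
      then have "p dvd k" by (metis dvd_add_left_iff dvd_triv_left)
      then show False using pndvd by simp
    next
      case 2
      then have "k + p * (m - 1) = m" using i pnU by (simp add: U_def)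
      moreover have "2 * (m - 1) \<le> p * (m - 1)" using p_gt_1 by (intro mult_le_mono1) simp
      ultimately show False using kp m_ge_2 by linarith
    qed
  qed
  then have q0: "q = 0" by (simp add: q_def)
  then have "ev xx ww U = 0" using eq by simp
  then have "U = 0" using good_ev_nonzero[OF good_xx_ww _ dU] by blast
  then have "g = 0" "b = 0" by (auto simp: U_def)
  then have af: "a ^ p = a" "pcompose f [:d, c:] = smult a f + (h ^ p - h)"
    by (simp_all add: g_def b_def)
  have "2 * degree h \<le> p * degree h" using p_gt_1 by (intro mult_le_mono1) simp
  then have "degree h < m" using h m_ge_2 by linarith
  \<comment> \<open>At X^m the polynomial h^p - h contributes nothing: p does not divide m, and h
    has degree below m.\<close>
  then have "coeff (pcompose f [:d, c:]) m = a * coeff f m"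
    unfolding af(2) using m_coprime by (simp add: coeff_power_p coeff_eq_0)
  moreover have "coeff (pcompose f [:d, c:]) m = coeff f m * c ^ m"
    using lead_coeff_comp[of "[:d, c:]" f] c deg_f by (simp add: degree_pcompose)
  moreover have "coeff f m \<noteq> 0" using deg_f m_ge_2 by auto
  ultimately have "c ^ m = a" by simp
  then show ?thesis using c sx sw af q0 q_def by auto
qed

text \<open>The kernel of the character that sends an automorphism with X -> c X + d to c.\<close>

definition wild :: "('k rat_closure \<Rightarrow> 'k rat_closure) set" where
  "wild = {\<sigma>\<in>carrier (inertia_group f). \<exists>d. \<sigma> xx = sub xx [:d, 1:]}"

lemma wild_form:
  assumes "\<sigma> \<in> wild"
  shows "\<exists>d h. shift d f - f = h ^ p - h \<and> \<sigma> xx = xx + emb_const d \<and> \<sigma> ww = ww + sub xx h"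
proof -
  have \<sigma>: "\<sigma> \<in> carrier (inertia_group f)" using assms by (simp add: wild_def)
  obtain d' where d': "\<sigma> xx = sub xx [:d', 1:]" using assms by (auto simp: wild_def)
  obtain c d a h where *: "\<sigma> xx = sub xx [:d, c:]" "\<sigma> ww = emb_const a * ww + sub xx h"
    "c ^ m = a" "pcompose f [:d, c:] = smult a f + (h ^ p - h)"
    using inertia_form[OF \<sigma>] by blast
  have "c = 1" using *(1) unfolding d' sub_xx_inj by simp
  then have "a = 1" using *(3) by simp
  have sh: "shift d f = smult a f + (h ^ p - h)" using *(4) \<open>c = 1\<close> by (simp add: shift_def)
  then show ?thesis using * sh \<open>a = 1\<close> \<open>c = 1\<close>
    by (intro exI[of _ d] exI[of _ h]) (simp add: sub_pCons add.commute)
qed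

lemma translation_in_wild:
  assumes "\<sigma> \<in> carrier (aut_group f)" "\<sigma> xx = xx + emb_const d"
  shows "\<sigma> \<in> wild"
  using assms translation_aut_ring_infinity[OF assms]
  by (auto simp: wild_def inertia_group_iff sub_pCons add.commute)

section \<open>Group structure of the inertia group\<close>

lemma inertia_group_eq: "inertia_group f = (BijGroup LL)\<lparr>carrier := carrier (inertia_group f)\<rparr>"
  by (simp add: inertia_group_def aut_group_def)

lemma inertia_Bij: "\<sigma> \<in> carrier (inertia_group f) \<Longrightarrow> \<sigma> \<in> Bij LL"
  by (simp add: inertia_group_iff carrier_aut_group_iff)

lemma BijGroup_mult: "\<sigma> \<in> Bij LL \<Longrightarrow> \<tau> \<in> Bij LL \<Longrightarrow> \<sigma> \<otimes>\<^bsub>BijGroup LL\<^esub> \<tau> = compose LL \<sigma> \<tau>"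
  by (simp add: BijGroup_def)

lemma inertia_subgroup: "subgroup (carrier (inertia_group f)) (BijGroup LL)"
proof (rule group.subgroupI[OF group_BijGroup])
  show "carrier (inertia_group f) \<subseteq> carrier (BijGroup LL)"
    using inertia_Bij by (auto simp: BijGroup_def)
  have "(\<lambda>z\<in>LL. z) \<in> carrier (inertia_group f)"
    by (auto simp: inertia_group_iff carrier_aut_group_iff id_Bij LL_closed LL_emb_const)
  then show "carrier (inertia_group f) \<noteq> {}" by blast
next
  fix \<sigma> assume \<sigma>: "\<sigma> \<in> carrier (inertia_group f)"
  define g where "g = (\<lambda>z\<in>LL. inv_into LL \<sigma> z)"
  note s = inertia_aut[OF \<sigma>]
  have gL: "g z \<in> LL" and sg: "\<sigma> (g z) = z" if "z \<in> LL" for z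
    using aut_bij[OF s] that by (auto simp: g_def bij_betw_def inv_into_into f_inv_into_f)
  have geq: "g z = y" if "\<sigma> y = z" "y \<in> LL" "z \<in> LL" for y z
    using aut_inj[OF s gL[OF that(3)] that(2)] sg[OF that(3)] that(1) by simp
  have "g \<in> Bij LL" unfolding g_def by (rule restrict_inv_into_Bij[OF inertia_Bij[OF \<sigma>]])
  moreover have "g (x + y) = g x + g y" "g (x * y) = g x * g y" if xy: "x \<in> LL" "y \<in> LL" for x y
  proof -
    show "g (x + y) = g x + g y"
      by (rule geq) (use xy in \<open>auto simp: aut_add[OF s] gL sg LL_closed(3)\<close>)
    show "g (x * y) = g x * g y"
      by (rule geq) (use xy in \<open>auto simp: aut_mult[OF s] gL sg LL_closed(4)\<close>)
  qed
  moreover have "g (emb_const c) = emb_const c" for c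
    by (rule geq) (auto simp: aut_const[OF s] LL_emb_const)
  moreover have "g z \<in> ring_infinity \<longleftrightarrow> z \<in> ring_infinity" if "z \<in> LL" for z
    using inertia_ring[OF \<sigma> gL[OF that]] sg[OF that] by simp
  ultimately have "g \<in> carrier (inertia_group f)"
    by (simp add: inertia_group_iff carrier_aut_group_iff)
  then show "inv\<^bsub>BijGroup LL\<^esub> \<sigma> \<in> carrier (inertia_group f)"
    using inv_BijGroup[OF inertia_Bij[OF \<sigma>]] by (simp add: g_def)
next
  fix \<sigma> \<tau> assume \<sigma>: "\<sigma> \<in> carrier (inertia_group f)" and \<tau>: "\<tau> \<in> carrier (inertia_group f)"
  note s = inertia_aut[OF \<sigma>] and t = inertia_aut[OF \<tau>]
  have "compose LL \<sigma> \<tau> \<in> carrier (inertia_group f)"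
    using compose_Bij[OF inertia_Bij[OF \<sigma>] inertia_Bij[OF \<tau>]] aut_closed[OF t]
    by (simp add: inertia_group_iff carrier_aut_group_iff compose_def LL_closed LL_emb_const
        aut_add[OF s] aut_add[OF t] aut_mult[OF s] aut_mult[OF t] aut_const[OF s] aut_const[OF t]
        inertia_ring[OF \<sigma>] inertia_ring[OF \<tau>])
  then show "\<sigma> \<otimes>\<^bsub>BijGroup LL\<^esub> \<tau> \<in> carrier (inertia_group f)"
    using inertia_Bij \<sigma> \<tau> by (simp add: BijGroup_mult)
qed

sublocale G: group "inertia_group f"
  using subgroup.subgroup_is_group[OF inertia_subgroup group_BijGroup] inertia_group_eq by simp

lemma inertia_mult:
  assumes "\<sigma> \<in> carrier (inertia_group f)" "\<tau> \<in> carrier (inertia_group f)"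
  shows "\<sigma> \<otimes>\<^bsub>inertia_group f\<^esub> \<tau> = compose LL \<sigma> \<tau>"
  by (subst inertia_group_eq) (simp add: BijGroup_mult inertia_Bij assms)

lemma inertia_one: "\<one>\<^bsub>inertia_group f\<^esub> = (\<lambda>z\<in>LL. z)"
  by (subst inertia_group_eq) (simp add: BijGroup_def)

text \<open>The coefficient of X is multiplicative; this is the character whose kernel is
  \<open>wild\<close>.\<close>

lemma inertia_mult_xx:
  assumes \<sigma>: "\<sigma> \<in> carrier (inertia_group f)" and \<tau>: "\<tau> \<in> carrier (inertia_group f)"
    and "\<sigma> xx = sub xx [:d, c:]" "\<tau> xx = sub xx [:e, b:]"
  shows "(\<sigma> \<otimes>\<^bsub>inertia_group f\<^esub> \<tau>) xx = sub xx [:e + b * d, b * c:]"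
proof -
  have "(\<sigma> \<otimes>\<^bsub>inertia_group f\<^esub> \<tau>) xx = \<sigma> (sub xx [:e, b:])"
    using assms LL_xx by (simp add: inertia_mult compose_def)
  also have "\<dots> = sub (sub xx [:d, c:]) [:e, b:]"
    using aut_sub[OF inertia_aut[OF \<sigma>] LL_xx] assms by simp
  also have "\<dots> = sub xx (pcompose [:e, b:] [:d, c:])" by (simp add: sub_pcompose)
  finally show ?thesis by (simp add: pcompose_pCons mult.commute)
qed

lemma inertia_pow_xx:
  assumes \<sigma>: "\<sigma> \<in> carrier (inertia_group f)" and "\<sigma> xx = sub xx [:d, c:]"
  shows "\<exists>e. (\<sigma> [^]\<^bsub>inertia_group f\<^esub> (n::nat)) xx = sub xx [:e, c ^ n:]"
proof (induction n)
  case 0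
  then show ?case using LL_xx by (intro exI[of _ 0]) (simp add: inertia_one sub_pCons)
next
  case (Suc n)
  then obtain e where "(\<sigma> [^]\<^bsub>inertia_group f\<^esub> n) xx = sub xx [:e, c ^ n:]" by blast
  from inertia_mult_xx[OF G.nat_pow_closed[OF \<sigma>] \<sigma> this assms(2)]
  show ?case by (auto simp: mult.commute)
qed

text \<open>The multiplicative group of \<open>k\<close> has no element of order \<open>p\<close>.\<close>

lemma p_element_in_wild:
  assumes \<sigma>: "\<sigma> \<in> carrier (inertia_group f)" and pow: "\<sigma> [^]\<^bsub>inertia_group f\<^esub> (p ^ n) = \<one>\<^bsub>inertia_group f\<^esub>"
  shows "\<sigma> \<in> wild"
proof -
  obtain c d where c: "\<sigma> xx = sub xx [:d, c:]" using inertia_form[OF \<sigma>] by blast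
  obtain e where e: "(\<sigma> [^]\<^bsub>inertia_group f\<^esub> (p ^ n)) xx = sub xx [:e, c ^ p ^ n:]"
    using inertia_pow_xx[OF \<sigma> c] by blast
  then have "xx = sub xx [:e, c ^ p ^ n:]" using pow LL_xx by (simp add: inertia_one)
  moreover have "xx = sub xx [:0, 1:]" by (simp add: sub_pCons)
  ultimately have "[:0, 1:] = [:e, c ^ p ^ n:]" using sub_xx_inj by metis
  then have "c ^ p ^ n = 1" by simp
  moreover have "(c - 1 + 1) ^ p ^ n = (c - 1) ^ p ^ n + 1 ^ p ^ n" by (rule power_q_add)
  ultimately have "(c - 1) ^ p ^ n = 0" by simp
  then have "c = 1" by simp
  then show ?thesis using \<sigma> c by (auto simp: wild_def)
qed

lemma p_subgroup_in_wild:
  assumes H: "subgroup H (inertia_group f)" "card H = p ^ n"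
  shows "H \<subseteq> wild"
proof
  fix \<sigma> assume "\<sigma> \<in> H"
  then have \<sigma>: "\<sigma> \<in> carrier (inertia_group f)" using subgroup.mem_carrier[OF H(1)] by blast
  interpret H: group "inertia_group f\<lparr>carrier := H\<rparr>"
    using subgroup.subgroup_is_group[OF H(1) G.is_group] .
  have "\<sigma> [^]\<^bsub>inertia_group f\<lparr>carrier := H\<rparr>\<^esub> Coset.order (inertia_group f\<lparr>carrier := H\<rparr>)
      = \<one>\<^bsub>inertia_group f\<lparr>carrier := H\<rparr>\<^esub>"
    using \<open>\<sigma> \<in> H\<close> by (intro H.pow_order_eq_1) simp
  then have "\<sigma> [^]\<^bsub>inertia_group f\<^esub> (p ^ n) = \<one>\<^bsub>inertia_group f\<^esub>"
    using H(2) by (simp add: Coset.order_def nat_pow_def)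
  then show "\<sigma> \<in> wild" using p_element_in_wild[OF \<sigma>] by blast
qed

lemma inertia_inv_xx:
  assumes \<sigma>: "\<sigma> \<in> carrier (inertia_group f)" and c: "\<sigma> xx = sub xx [:d, c:]"
  shows "\<exists>e b. (inv\<^bsub>inertia_group f\<^esub> \<sigma>) xx = sub xx [:e, b:] \<and> b * c = 1"
proof -
  have i: "inv\<^bsub>inertia_group f\<^esub> \<sigma> \<in> carrier (inertia_group f)" using \<sigma> by simp
  obtain b e where b: "(inv\<^bsub>inertia_group f\<^esub> \<sigma>) xx = sub xx [:e, b:]" using inertia_form[OF i] by blast
  have "(\<sigma> \<otimes>\<^bsub>inertia_group f\<^esub> inv\<^bsub>inertia_group f\<^esub> \<sigma>) xx = sub xx [:e + b * d, b * c:]"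
    by (rule inertia_mult_xx[OF \<sigma> i c b])
  then have "xx = sub xx [:e + b * d, b * c:]" using \<sigma> LL_xx by (simp add: inertia_one)
  moreover have "xx = sub xx [:0, 1:]" by (simp add: sub_pCons)
  ultimately have "[:0, 1:] = [:e + b * d, b * c:]" using sub_xx_inj by metis
  then show ?thesis using b by auto
qed

lemma wild_subgroup: "subgroup wild (inertia_group f)"
proof (rule G.subgroupI)
  show "wild \<subseteq> carrier (inertia_group f)" by (auto simp: wild_def)
  have "\<one>\<^bsub>inertia_group f\<^esub> \<in> wild"
    using p_element_in_wild[of "\<one>\<^bsub>inertia_group f\<^esub>" 0] by simp
  then show "wild \<noteq> {}" by blast
next
  fix \<sigma> assume "\<sigma> \<in> wild"
  then obtain d where \<sigma>: "\<sigma> \<in> carrier (inertia_group f)" "\<sigma> xx = sub xx [:d, 1:]" by (auto simp: wild_def)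
  then show "inv\<^bsub>inertia_group f\<^esub> \<sigma> \<in> wild"
    using inertia_inv_xx[OF \<sigma>] by (auto simp: wild_def)
next
  fix \<sigma> \<tau> assume "\<sigma> \<in> wild" "\<tau> \<in> wild"
  then show "\<sigma> \<otimes>\<^bsub>inertia_group f\<^esub> \<tau> \<in> wild"
    using inertia_mult_xx[of \<sigma> \<tau> _ 1 _ 1] by (fastforce simp: wild_def)
qed

section \<open>Order of the wild part and its identification as the Sylow subgroup\<close>

lemma artin_schreier_fibre:
  fixes g :: "'k poly"
  assumes "g \<in> as_image p"
  shows "card {h. g = h ^ p - h} = p" and "finite {h. g = h ^ p - h}"
proof -
  obtain h0 where h0: "g = h0 ^ p - h0" using assms by (auto simp: as_image_def)
  have "h ^ p - h = g \<longleftrightarrow> (\<exists>c. c ^ p = c \<and> h = h0 + [:c:])" for h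
  proof
    assume h: "h ^ p - h = g"
    define u where "u = h - h0"
    have "h ^ p = h0 ^ p + u ^ p" using frobenius_add_poly[of h0 u] by (simp add: u_def)
    then have u: "u ^ p - u = 0" using h h0 by (simp add: u_def algebra_simps)
    \<comment> \<open>Two solutions differ by u with u^p = u, which for degree reasons is a
      constant, hence an element of the prime field.\<close>
    have "degree u = 0"
    proof (rule ccontr)
      assume "degree u \<noteq> 0"
      then have "degree (u ^ p - u) = p * degree u" using p_gt_1 by (intro degree_power_diff_self) auto
      then show False using u \<open>degree u \<noteq> 0\<close> p_pos by simp
    qed
    then obtain c where c: "u = [:c:]" by (auto elim: degree_eq_zeroE)
    then have "c ^ p = c" using u by (simp add: poly_const_pow)
    then show "\<exists>c. c ^ p = c \<and> h = h0 + [:c:]" using c by (auto simp: u_def algebra_simps)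
  next
    assume "\<exists>c. c ^ p = c \<and> h = h0 + [:c:]"
    then obtain c where "c ^ p = c" "h = h0 + [:c:]" by blast
    then show "h ^ p - h = g" by (simp add: frobenius_add_poly h0 poly_const_pow)
  qed
  then have eq: "{h. g = h ^ p - h} = (\<lambda>c. h0 + [:c:]) ` {c. c ^ p = c}" by (auto simp: eq_commute[of g])
  have c: "card {c::'k. c ^ p = c} = p" using card_fixed_power_q[of 1] by simp
  then show "card {h. g = h ^ p - h} = p"
    unfolding eq by (subst card_image) (auto simp: inj_on_def)
  have "finite {c::'k. c ^ p = c}" by (rule card_ge_0_finite) (simp add: c p_pos)
  then show "finite {h. g = h ^ p - h}" unfolding eq by simp
qed

lemma finite_as_translations: "finite (as_translations p f)"
proof -
  obtain l s where l: "m - 1 = l * p ^ s" "\<not> p dvd l"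
    using prime_power_canonical[OF prime_p, of "m - 1"] m_ge_2 by (metis Suc_1 Suc_le_lessD zero_less_diff)
  then have "degree f = 1 + l * p ^ s" using deg_f m_ge_2 by linarith
  then show ?thesis using degree_as_translations_bound(1)[of f l s] l deg_f m_coprime by simp
qed

text \<open>An element of \<open>wild\<close> is determined by its pair (d, h), every admissible
  pair occurs by \<open>ex_translation_aut\<close>, and each d comes with p choices of h.\<close>

lemma wild_card: "finite wild" "card wild = p * card (as_translations p f)"
proof -
  define T where "T = Sigma (as_translations p f) (\<lambda>d. {h. shift d f - f = h ^ p - h})"
  define F where "F = (\<lambda>(d, h). SOME \<sigma>. \<sigma> \<in> carrier (aut_group f) \<and> \<sigma> xx = xx + emb_const d \<and> \<sigma> ww = ww + sub xx h)"
  have im: "shift d f - f \<in> as_image p" if "d \<in> as_translations p f" for d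
    using that by (simp add: as_translations_def)
  have F: "F (d, h) \<in> carrier (aut_group f) \<and> F (d, h) xx = xx + emb_const d \<and> F (d, h) ww = ww + sub xx h"
    if "(d, h) \<in> T" for d h
  proof -
    have "shift d f - f = h ^ p - h" using that by (simp add: T_def)
    from someI_ex[OF ex_translation_aut[OF this, unfolded Bex_def]] show ?thesis by (simp add: F_def)
  qed
  have inj: "inj_on F T"
  proof (rule inj_onI)
    fix a b assume ab: "a \<in> T" "b \<in> T" "F a = F b"
    obtain d h e g where a: "a = (d, h)" "b = (e, g)" by (cases a, cases b)
    have "xx + emb_const d = xx + emb_const e" "ww + sub xx h = ww + sub xx g"
      using F[of d h] F[of e g] ab a by metis+
    then have "sub xx [:d:] = sub xx [:e:]" "sub xx h = sub xx g" by simp_all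
    then show "a = b" unfolding sub_xx_inj a by simp
  qed
  have img: "F ` T = wild"
  proof (intro equalityI subsetI)
    fix \<sigma> assume "\<sigma> \<in> F ` T"
    then obtain d h where dh: "(d, h) \<in> T" "\<sigma> = F (d, h)" by auto
    then show "\<sigma> \<in> wild" using F[OF dh(1)] translation_in_wild by blast
  next
    fix \<sigma> assume w: "\<sigma> \<in> wild"
    then obtain d h where dh: "shift d f - f = h ^ p - h" "\<sigma> xx = xx + emb_const d" "\<sigma> ww = ww + sub xx h"
      using wild_form by blast
    then have "(d, h) \<in> T" by (auto simp: T_def as_translations_def as_image_def)
    moreover have "F (d, h) = \<sigma>"
    proof (rule aut_eqI)
      show "\<sigma> \<in> carrier (aut_group f)" using w inertia_aut by (simp add: wild_def)
    qed (use F[OF \<open>(d, h) \<in> T\<close>] dh in auto)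
    ultimately show "\<sigma> \<in> F ` T" by blast
  qed
  have "finite T" unfolding T_def
    by (intro finite_SigmaI finite_as_translations artin_schreier_fibre(2) im)
  then show "finite wild" using img by (metis finite_imageI)
  have "card wild = card T" using card_image[OF inj] img by simp
  also have "\<dots> = (\<Sum>d\<in>as_translations p f. card {h. shift d f - f = h ^ p - h})"
    unfolding T_def by (rule card_SigmaI) (auto intro: finite_as_translations artin_schreier_fibre(2) im)
  also have "\<dots> = (\<Sum>d\<in>as_translations p f. p)"
    by (intro sum.cong refl artin_schreier_fibre(1) im)
  finally show "card wild = p * card (as_translations p f)" by simp
qed

text \<open>From c^m = a and a^(p-1) = 1 the factor c is a root of unity of bounded order, and
  automorphisms with the same c lie in one coset of the finite group \<open>wild\<close>.\<close>

lemma finite_inertia: "finite (carrier (inertia_group f))"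
proof -
  define C where "C = {c::'k. c ^ (m * (p - 1)) = 1}"
  have "finite C"
  proof -
    have n: "m * (p - 1) > 0" using m_ge_2 p_gt_1 by simp
    then have "degree (monom 1 (m * (p - 1)) - 1 :: 'k poly) = m * (p - 1)"
      unfolding diff_conv_add_uminus by (subst degree_add_eq_left) (auto simp: degree_monom_eq)
    then have "monom 1 (m * (p - 1)) - 1 \<noteq> (0 :: 'k poly)" using n by auto
    from poly_roots_finite[OF this] show ?thesis by (simp add: C_def poly_monom)
  qed
  have C: "\<exists>c\<in>C. \<exists>d. \<sigma> xx = sub xx [:d, c:]" if \<sigma>: "\<sigma> \<in> carrier (inertia_group f)" for \<sigma>
  proof -
    obtain c d a where *: "c \<noteq> 0" "\<sigma> xx = sub xx [:d, c:]" "c ^ m = a" "a ^ p = a"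
      using inertia_form[OF \<sigma>] by blast
    then have "a \<noteq> 0" by auto
    moreover have "a ^ p = a * a ^ (p - 1)" using p_pos by (metis Suc_pred' power_Suc)
    ultimately have "c ^ (m * (p - 1)) = 1" using * by (simp add: power_mult)
    then show ?thesis using * by (auto simp: C_def)
  qed
  define S where "S c = {\<sigma>\<in>carrier (inertia_group f). \<exists>d. \<sigma> xx = sub xx [:d, c:]}" for c
  have "finite (S c)" if "c \<in> C" for c
  proof (cases "S c = {}")
    case False
    then obtain \<sigma> d where \<sigma>: "\<sigma> \<in> carrier (inertia_group f)" "\<sigma> xx = sub xx [:d, c:]" by (auto simp: S_def)
    obtain e b where b: "(inv\<^bsub>inertia_group f\<^esub> \<sigma>) xx = sub xx [:e, b:]" "b * c = 1"
      using inertia_inv_xx[OF \<sigma>] by blast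
    have "S c \<subseteq> (\<lambda>\<rho>. \<sigma> \<otimes>\<^bsub>inertia_group f\<^esub> \<rho>) ` wild"
    proof
      fix \<tau> assume "\<tau> \<in> S c"
      then obtain d' where \<tau>: "\<tau> \<in> carrier (inertia_group f)" "\<tau> xx = sub xx [:d', c:]" by (auto simp: S_def)
      define \<rho> where "\<rho> = inv\<^bsub>inertia_group f\<^esub> \<sigma> \<otimes>\<^bsub>inertia_group f\<^esub> \<tau>"
      have "\<rho> xx = sub xx [:d' + c * e, c * b:]"
        unfolding \<rho>_def by (intro inertia_mult_xx b \<tau>) (use \<sigma> in simp)
      then have "\<rho> \<in> wild" using b(2) \<sigma> \<tau> by (auto simp: wild_def \<rho>_def mult.commute)
      moreover have "\<tau> = \<sigma> \<otimes>\<^bsub>inertia_group f\<^esub> \<rho>"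
        using \<sigma> \<tau> by (simp add: \<rho>_def G.m_assoc[symmetric])
      ultimately show "\<tau> \<in> (\<lambda>\<rho>. \<sigma> \<otimes>\<^bsub>inertia_group f\<^esub> \<rho>) ` wild" by blast
    qed
    then show ?thesis using wild_card(1) finite_subset by blast
  qed simp
  then have "finite (\<Union>c\<in>C. S c)" using \<open>finite C\<close> by blast
  moreover have "carrier (inertia_group f) \<subseteq> (\<Union>c\<in>C. S c)" using C by (auto simp: S_def)
  ultimately show ?thesis using finite_subset by blast
qed

text \<open>The order of \<open>wild\<close> is a power of p and every subgroup of p-power order
  lies in it. A larger p-part would give, by Sylow, a larger such subgroup; so \<open>wild\<close>
  is Sylow, and the only one.\<close>

lemma wild_inertia_group_eq: "wild_inertia_group f = wild"
proof -
  obtain n where n: "card (as_translations p f) = p ^ n"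
    using card_additive_subgroup[OF finite_as_translations zero_in_as_translations
        as_translations_add as_translations_uminus] by blast
  have cw: "card wild = p ^ Suc n" using wild_card(2) n by simp
  define N where "N = Coset.order (inertia_group f)"
  have N0: "N > 0" unfolding N_def by (simp add: G.order_gt_0_iff_finite finite_inertia)
  have dvd: "p ^ Suc n dvd N"
    using G.lagrange[OF wild_subgroup] cw by (metis N_def dvd_triv_right)
  have "multiplicity p N = Suc n"
  proof (rule ccontr)
    assume *: "multiplicity p N \<noteq> Suc n"
    have "Suc n \<le> multiplicity p N" using dvd N0 prime_p by (intro multiplicity_geI) auto
    then have "p ^ Suc (Suc n) dvd N" using * by (intro multiplicity_dvd') simp
    then obtain k where "Coset.order (inertia_group f) = p ^ Suc (Suc n) * k" unfolding N_def by blast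
    then obtain H where H: "subgroup H (inertia_group f)" "card H = p ^ Suc (Suc n)"
      using sylow_thm[OF prime_p G.is_group _ finite_inertia] by blast
    have "p ^ Suc (Suc n) \<le> p ^ Suc n"
      using card_mono[OF wild_card(1) p_subgroup_in_wild[OF H]] H(2) cw by simp
    then show False using p_gt_1 by simp
  qed
  then have syl: "is_sylow_subgroup p P (inertia_group f) \<longleftrightarrow>
      subgroup P (inertia_group f) \<and> card P = p ^ Suc n" for P
    using finite_inertia by (simp add: is_sylow_subgroup_def N_def)
  show ?thesis
    unfolding wild_inertia_group_def char_p syl
  proof (rule the_equality)
    show "subgroup wild (inertia_group f) \<and> card wild = p ^ Suc n" using wild_subgroup cw by simp
    fix P assume "subgroup P (inertia_group f) \<and> card P = p ^ Suc n"
    then show "P = wild"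
      using p_subgroup_in_wild[of P "Suc n"] wild_card(1) cw by (intro card_subset_eq) auto
  qed
qed

lemma card_wild_inertia_group: "card (wild_inertia_group f) = p * card (as_translations p f)"
  by (simp add: wild_inertia_group_eq wild_card(2))

end

section \<open>The bounds and their sharpness\<close>

context alg_closed_char
begin

lemma card_wild_inertia_group_eq:
  fixes f :: "'k poly"
  assumes "\<not> p dvd degree f" "degree f \<ge> 2"
  shows "card (wild_inertia_group f) = p * card (as_translations p f)"
proof -
  interpret as_curve p K f "degree f" using assms by unfold_locales auto
  show ?thesis by (rule card_wild_inertia_group)
qed

lemma coprime_p_iff: "coprime n p \<longleftrightarrow> \<not> p dvd n"
  using prime_p by (metis coprime_commute prime_imp_coprime coprime_absorb_left not_prime_unit)

lemma not_dvd_one_plus: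
  assumes "p dvd n"
  shows "\<not> p dvd 1 + n"
proof
  assume "p dvd 1 + n"
  then have "p dvd 1" using assms dvd_diff_nat[of p "1 + n" n] by simp
  then show False using p_gt_1 by simp
qed

lemma two_le_power_p: "s > 0 \<Longrightarrow> 2 \<le> p ^ s"
  using self_le_power[of p s] p_gt_1 by linarith

text \<open>The p^e translations of \<open>ex_many_translations\<close> meet an upper bound of the
  same size. The exponent e may be smaller than s, with n - 1 = l p^(s-e) making up the difference,
  as is needed for p = 2.\<close>

lemma ex_exact_translations:
  assumes e: "e > 0" and n: "\<not> p dvd n" "n \<ge> 2"
    and deg: "1 + (n - 1) * p ^ e = 1 + l * p ^ s" and l: "\<not> p dvd l" "l \<ge> 2" and s: "s > 0"
    and le: "\<And>f :: 'k poly. degree f = 1 + l * p ^ s \<Longrightarrow> card (as_translations p f) \<le> p ^ e"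
  shows "\<exists>f :: 'k poly. degree f = 1 + l * p ^ s \<and> card (wild_inertia_group f) = p ^ (e + 1)"
proof -
  obtain f :: "'k poly" where f: "degree f = 1 + l * p ^ s" "{d. d ^ p ^ e = d} \<subseteq> as_translations p f"
    using ex_many_translations[OF e n] deg by auto
  have "p dvd l * p ^ s" using s by simp
  then have nd: "\<not> p dvd degree f" unfolding f(1) by (rule not_dvd_one_plus)
  have "card {d::'k. d ^ p ^ e = d} \<le> card (as_translations p f)"
    using degree_as_translations_bound(1)[OF f(1) l(1) nd] f(2) by (rule card_mono)
  then have "card (as_translations p f) = p ^ e"
    using le[OF f(1)] card_fixed_power_q[OF e] by simp
  moreover have "1 * 1 \<le> l * p ^ s" using l(2) p_pos by (intro mult_le_mono) auto
  then have "degree f \<ge> 2" using f(1) by linarith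
  ultimately show ?thesis using card_wild_inertia_group_eq[OF nd] f(1) by auto
qed

end

theorem theorem1p1:
  fixes f :: "'k::alg_closed_field poly" and p m :: nat
  assumes "CHAR('k) = p" and "p > 0"
    and "m = degree f" and "coprime m p"
    and "as_genus f > 1"
  shows
    "card (wild_inertia_group f) \<le> p * (m - 1)\<^sup>2
     \<and> (coprime (m - 1) p \<longrightarrow> card (wild_inertia_group f) = p)
     \<and> (f = monom 1 m \<longrightarrow>
          ((\<nexists>s. m - 1 = p ^ s) \<longrightarrow> card (wild_inertia_group f) = p) \<and>
          (\<forall>s. m - 1 = p ^ s \<longrightarrow> card (wild_inertia_group f) = p ^ (2 * s + 1)))
     \<and> (\<forall>l s. m - 1 = l * p ^ s \<and> s > 0 \<and> l > 1 \<and> coprime l p \<longrightarrow>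
          (p > 2 \<longrightarrow> card (wild_inertia_group f) \<le> p ^ (s + 1)) \<and>
          (p = 2 \<longrightarrow> card (wild_inertia_group f) \<le> 2 ^ s))
     \<and> (p > 2 \<longrightarrow> (\<forall>s>0. \<exists>l (f' :: 'k poly). l > 1 \<and> coprime l p \<and>
          degree f' = 1 + l * p ^ s \<and> as_genus f' > 1 \<and>
          card (wild_inertia_group f') = p ^ (s + 1)))
     \<and> (p = 2 \<longrightarrow> (\<forall>s>0. \<forall>l>1. coprime l p \<longrightarrow> (\<exists>f' :: 'k poly.
          degree f' = 1 + l * p ^ s \<and> as_genus f' > 1 \<and>
          card (wild_inertia_group f') = 2 ^ s)))
     \<and> (real (card (wild_inertia_group f)) / as_genus f > real p / (real p - 1) \<longrightarrow>
          (\<exists>a h R. additive_poly R \<and> pcompose f [:a, 1:] = [:0, 1:] * R + (h ^ p - h)))"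
proof -
  interpret alg_closed_char p "TYPE('k)" using assms by unfold_locales auto
  define V where "V = as_translations p f"
  have pm: "\<not> p dvd m" using assms(4) by (simp add: coprime_p_iff)
  have m2: "m \<ge> 2"
  proof (rule ccontr)
    assume "\<not> m \<ge> 2"
    then have "real m - 1 \<le> 0" by simp
    moreover have "real p - 1 \<ge> 0" using p_gt_1 by simp
    ultimately have "(real m - 1) * (real p - 1) \<le> 0" by (rule mult_nonpos_nonneg)
    then show False using assms by (simp add: as_genus_def)
  qed
  have W: "card (wild_inertia_group f) = p * card V"
    unfolding V_def using card_wild_inertia_group_eq[of f] pm m2 assms by simp
  obtain l s where ls: "m - 1 = l * p ^ s" "\<not> p dvd l"
    using prime_power_canonical[OF prime_p, of "m - 1"] m2 by (metis Suc_1 Suc_le_lessD zero_less_diff)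
  have l0: "l > 0" using ls(2) by (cases l) auto
  have deg: "degree f = 1 + l * p ^ s" using ls(1) m2 assms by linarith
  have pf: "\<not> p dvd degree f" using pm assms by simp
  have a: "card V \<le> (m - 1)\<^sup>2"
    unfolding V_def ls(1) using degree_as_translations_bound(2)[OF deg ls(2) pf] .
  have b: "card V = 1" if "\<not> p dvd m - 1"
    unfolding V_def using as_translations_trivial[of f] pf that assms by simp
  have c1: "card V = 1" if "f = monom 1 m" "\<nexists>s. m - 1 = p ^ s"
  proof -
    have "l \<noteq> 1" using that(2) ls(1) by auto
    then have l2: "l \<ge> 2" using l0 by simp
    have "m = 1 + l * p ^ s" using ls(1) m2 by linarith
    from as_translations_monom_trivial[OF this ls(2) l2 pm] show ?thesis
      unfolding V_def that(1) by simp
  qed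
  have c2: "card V = p ^ (2 * s)" if "f = monom 1 m" "m - 1 = p ^ s" for s
  proof (cases "s = 0")
    case True
    then show ?thesis using b that(2) p_gt_1 by simp
  next
    case False
    have "m = 1 + p ^ s" using that(2) m2 by linarith
    then show ?thesis using card_as_translations_monom_Suc_q[of s] False that(1) by (simp add: V_def)
  qed
  have d: "(p > 2 \<longrightarrow> card V \<le> p ^ s) \<and> (p = 2 \<longrightarrow> card V \<le> 2 ^ (s - 1))"
    if "m - 1 = l * p ^ s" "s > 0" "l > 1" "\<not> p dvd l" for l s
  proof -
    have dl: "degree f = 1 + l * p ^ s" using that(1) m2 assms by linarith
    show ?thesis
      using as_translations_card_le[OF dl that(4) _ pf] as_translations_card_le_two[OF dl that(4) _ pf _ that(2)]
        that(3) by (auto simp: V_def)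
  qed
  have genus: "as_genus g > 1" if "degree g = 1 + l * p ^ s" "l > 1" "s > 0"
    for g :: "'k poly" and l s
  proof -
    have "2 * 2 \<le> l * p ^ s"
      using that(2) two_le_power_p[OF that(3)] by (intro mult_le_mono) auto
    then have "4 \<le> real (l * p ^ s)" by linarith
    moreover have "1 \<le> real p - 1" using p_gt_1 by simp
    ultimately have "4 * 1 \<le> real (l * p ^ s) * (real p - 1)" by (intro mult_mono) auto
    moreover have "real (degree g) - 1 = real (l * p ^ s)" unfolding that(1) by simp
    ultimately have "4 * 1 \<le> (real (degree g) - 1) * (real p - 1)" by metis
    then show ?thesis by (simp add: as_genus_def char_p)
  qed
  \<comment> \<open>The example with e = s needs l and n = l + 1 both prime to p; l = p + 1 and n =
    p + 2 satisfy this as p > 2.\<close>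
  have opt1: "\<exists>l (f' :: 'k poly). l > 1 \<and> coprime l p \<and> degree f' = 1 + l * p ^ s \<and> as_genus f' > 1 \<and>
      card (wild_inertia_group f') = p ^ (s + 1)" if p2: "p > 2" and s: "s > 0" for s
  proof -
    have np: "\<not> p dvd p + 1" "\<not> p dvd p + 2"
    proof -
      have "\<not> p dvd 1" "\<not> p dvd 2" using p2 by (auto dest: dvd_imp_le)
      then show "\<not> p dvd p + 1" "\<not> p dvd p + 2" by (simp_all only: dvd_add_right_iff dvd_refl not_False_eq_True)
    qed
    have "\<exists>f :: 'k poly. degree f = 1 + (p + 1) * p ^ s \<and> card (wild_inertia_group f) = p ^ (s + 1)"
    proof (rule ex_exact_translations[OF s np(2) _ _ np(1) _ s])
      fix g :: "'k poly" assume g: "degree g = 1 + (p + 1) * p ^ s"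
      have "p dvd (p + 1) * p ^ s" using s by simp
      then have "\<not> p dvd degree g" unfolding g by (rule not_dvd_one_plus)
      then show "card (as_translations p g) \<le> p ^ s"
        using as_translations_card_le[OF g np(1)] p_gt_1 by simp
    qed (use p_gt_1 in auto)
    then obtain g :: "'k poly" where g: "degree g = 1 + (p + 1) * p ^ s" "card (wild_inertia_group g) = p ^ (s + 1)"
      by blast
    then show ?thesis
      using genus[OF g(1)] p2 s np by (intro exI[of _ "p + 1"] exI[of _ g]) (auto simp: coprime_p_iff)
  qed
  have opt2: "\<exists>f' :: 'k poly. degree f' = 1 + l * p ^ s \<and> as_genus f' > 1 \<and> card (wild_inertia_group f') = 2 ^ s"
    if p2: "p = 2" and s: "s > 0" and l: "l > 1" "coprime l p" for s l
  proof -
    have nl: "\<not> p dvd l" using l by (simp add: coprime_p_iff)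
    have ev: "p dvd l * p ^ s" using s by simp
    have "\<exists>g :: 'k poly. degree g = 1 + l * p ^ s \<and> card (wild_inertia_group g) = 2 ^ s"
    proof (cases "s = 1")
      case True
      define g where "g = (monom 1 (1 + l * p ^ s) :: 'k poly)"
      have dg: "degree g = 1 + l * p ^ s" by (simp only: g_def degree_monom_eq one_neq_zero not_False_eq_True)
      have nd: "\<not> p dvd degree g" unfolding dg using ev by (rule not_dvd_one_plus)
      have "as_translations p g = {0}"
        unfolding g_def using nd dg nl l by (intro as_translations_monom_trivial[OF refl]) auto
      moreover have "1 * 1 \<le> l * p ^ s" using l(1) p_pos by (intro mult_le_mono) auto
      then have "degree g \<ge> 2" using dg by linarith
      ultimately show ?thesis using card_wild_inertia_group_eq[OF nd] dg True p2 by auto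
    next
      case False
      then obtain e where e: "s = Suc e" "e > 0" using s by (cases s) auto
      \<comment> \<open>Here e = s - 1, and n = 2 l + 1 is odd with (n - 1) 2^(s-1) = l 2^s.\<close>
      have "\<exists>g :: 'k poly. degree g = 1 + l * p ^ s \<and> card (wild_inertia_group g) = p ^ (e + 1)"
      proof (rule ex_exact_translations[OF e(2) _ _ _ nl _ s])
        show "\<not> p dvd 2 * l + 1" using p2 by simp
        show "1 + (2 * l + 1 - 1) * p ^ e = 1 + l * p ^ s" using p2 e by simp
        fix g :: "'k poly" assume g: "degree g = 1 + l * p ^ s"
        have "\<not> p dvd degree g" unfolding g using ev by (rule not_dvd_one_plus)
        then show "card (as_translations p g) \<le> p ^ e"
          using as_translations_card_le_two[OF g nl _ _ p2 s] l e p2 by simp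
      qed (use l in auto)
      then show ?thesis using e p2 by simp
    qed
    then obtain g :: "'k poly" where g: "degree g = 1 + l * p ^ s" "card (wild_inertia_group g) = 2 ^ s"
      by blast
    then show ?thesis using genus[OF g(1)] l s by (intro exI[of _ g]) auto
  qed
  have e: "\<exists>a h R. additive_poly R \<and> pcompose f [:a, 1:] = [:0, 1:] * R + (h ^ p - h)"
    if ratio: "real (card (wild_inertia_group f)) / as_genus f > real p / (real p - 1)"
  proof -
    \<comment> \<open>After inserting the genus, the hypothesis says exactly 2 |V| > m - 1.\<close>
    have "real p * real (card V) / ((real m - 1) * (real p - 1) / 2) > real p / (real p - 1)"
      using ratio W assms by (simp add: as_genus_def)
    moreover have pos: "real m - 1 > 0" "real p - 1 > 0" using m2 p_gt_1 by auto
    moreover have "real p * real (card V) / ((real m - 1) * (real p - 1) / 2)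
        = 2 * real (card V) / (real m - 1) * (real p / (real p - 1))" by simp
    ultimately have "1 * (real p / (real p - 1)) < 2 * real (card V) / (real m - 1) * (real p / (real p - 1))"
      by (simp only: mult_1)
    moreover have "real p / (real p - 1) > 0" using pos p_pos by simp
    ultimately have "1 < 2 * real (card V) / (real m - 1)" by (simp only: mult_less_cancel_right_pos)
    then have "2 * real (card V) > real m - 1" using pos by (simp add: less_divide_eq)
    then have big: "2 * card V > m - 1" using m2 by linarith
    \<comment> \<open>For s > 0, l > 1 would give |V| at most p^s and hence at most (m - 1)/2, so l
      = 1. Being a power of p larger than p^s / 2, |V| is then at least p^s.\<close>
    have "l = 1 \<and> card V \<ge> p ^ s"
    proof (cases "s = 0")
      case True
      then have "\<not> p dvd m - 1" using ls by simp
      then have "card V = 1" by (rule b)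
      then show ?thesis using big m2 ls(1) True by simp
    next
      case False
      obtain n where n: "card V = p ^ n"
        using card_additive_subgroup[of V] degree_as_translations_bound(1)[OF deg ls(2) pf]
          zero_in_as_translations as_translations_add as_translations_uminus unfolding V_def by metis
      have "l = 1"
      proof (rule ccontr)
        assume "l \<noteq> 1"
        then have l2: "l > 1" using l0 by simp
        have "2 * p ^ s \<le> l * p ^ s" using l2 by (intro mult_le_mono1) simp
        moreover have "card V \<le> p ^ s"
        proof (cases "p = 2")
          case True
          then have "card V \<le> 2 ^ (s - 1)" using d[OF ls(1) _ l2 ls(2)] False by simp
          also have "\<dots> \<le> 2 ^ s" by (intro power_increasing) auto
          finally show ?thesis using True by simp
        next
          case False
          then show ?thesis using d[OF ls(1) _ l2 ls(2)] \<open>s \<noteq> 0\<close> p_gt_1 by simp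
        qed
        ultimately show False using big ls(1) by linarith
      qed
      moreover have "n \<ge> s"
      proof (rule ccontr)
        assume "\<not> n \<ge> s"
        then have "p ^ Suc n \<le> p ^ s" using p_pos by (intro power_increasing) auto
        moreover have "2 * p ^ n \<le> p ^ Suc n" using p_gt_1 by simp
        moreover have "p ^ s < 2 * p ^ n" using big ls(1) n \<open>l = 1\<close> by simp
        ultimately show False by linarith
      qed
      then have "p ^ s \<le> p ^ n" using p_pos by (intro power_increasing) auto
      ultimately show ?thesis using n by simp
    qed
    then show ?thesis using as_normal_form[of f s] deg pf by (simp add: V_def)
  qed
  have d': "(p > 2 \<longrightarrow> p * card V \<le> p ^ (s + 1)) \<and> (p = 2 \<longrightarrow> p * card V \<le> 2 ^ s)"
    if "m - 1 = l * p ^ s \<and> s > 0 \<and> l > 1 \<and> \<not> p dvd l" for l s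
    using d[of l s] that p_pos by (cases s) auto
  have a': "p * card V \<le> p * (m - 1)\<^sup>2" using a by simp
  have c2': "p * card V = p ^ (2 * s + 1)" if "f = monom 1 m" "m - 1 = p ^ s" for s
    using c2[OF that] by simp
  have b': "p * card V = p" if "card V = 1" using that by simp
  show ?thesis
    unfolding W coprime_p_iff
    using a' b b' c1 c2' d' opt1 opt2 e[unfolded W] unfolding coprime_p_iff by blast
qed

end
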